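(* Let $r$ be a positive integer, let $\kappa<0$ and $p>0$ satisfy $p+(r+1)\kappa\ge 0$, and set $p_i=p+(i-1)\kappa$ for $1\le i\le r+1$. Assume that there exists a feedback law $u_0:\mathbb{R}^r\to\mathbb{R}$, homogeneous of degree $p_{r+1}$ with respect to $(\delta_\varepsilon)_{\varepsilon>0}$, such that the closed-loop system $\dot z=J_rz+u_0(z)e_r$ is finite-time stable and the following conditions hold: (i) the vector field $z\mapsto J_rz+u_0(z)e_r$ is homogeneous of degree $\kappa$ with respect to $(\delta_\varepsilon)_{\varepsilon>0}$, and there exists a continuous positive definite function $V_1:\mathbb{R}^r\to\mathbb{R}_+$, $C^1$ except at the origin, homogeneous of degree $2p_{r+1}$ with respect to $(\delta_\varepsilon)_{\varepsilon>0}$, such that there exist $c>0$ and $\alpha\in(0,1)$ for which the time derivative of $V_1$ along non-trivial trajectories of $\dot z=J_rz+u_0(z)e_r$ satisfies $\dot V_1\le -cV_1^\alpha$; (ii) $z\mapsto\partial_rV_1(z)$ is homogeneous of non-negative degree with respect to $(\delta_\varepsilon)_{\varepsilon>0}$, and $z\mapsto\partial_rV_1(z)\,u_0(z)$ is non-positive over $\mathbb{R}^r$. Then, for every $k_P\ge 1$ and $k_I>0$, the $r$-th order chain of integrators $\dot z=J_rz+ue_r$ is stabilized in finite time by the controller $$u_{ST}(z,t)=k_Pu_0(z(t))-k_I\int_0^t\partial_rV_1(z(s))\,ds .$$ Moreover, setting $\xi(t):=-k_I\int_0^t\partial_rV_1(z(s))\,ds$, write the closed-loop system $\dot z=J_rz+u_{ST}e_r$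 as the differential inclusion over $\mathbb{R}^{r+1}$ $$\dot z=J_rz+(k_Pu_0(z)+\xi)e_r,\qquad \dot\xi=-k_I\,\partial_rV_1(z).\qquad ( * )$$ Then there exists $A>0$ such that the continuous function $W:\mathbb{R}^{r+1}\to\mathbb{R}$ defined by $$W(z,\xi)=A\Big(V_1(z)+\frac{\xi^2}{2k_I}\Big)^{2-\alpha}-z_r\xi$$ is positive definite, $C^1$ except at the origin, homogeneous with respect to $(\psi_\varepsilon)_{\varepsilon>0}$, and there exists $d>0$ for which the time derivative of $W$ along non-trivial trajectories of $( * )$ satisfies $\dot W\le -dW^{1/(2-\alpha)}$. As a consequence, trajectories of $( * )$ converge to zero in finite time.
   Context: $z=(z_1,\dots,z_r)^T\in\mathbb{R}^r$; $e_1,\dots,e_r$ is the canonical basis of $\mathbb{R}^r$; $J_r$ is the $r\times r$ nilpotent Jordan block with $(J_rz)_i=z_{i+1}$ for $1\le i\le r-1$ and $(J_rz)_r=0$. Thus the $r$-th order chain of integrators $\dot z=J_rz+ue_r$, with $u\in\mathbb{R}$ the scalar control, reads $\dot z_i=z_{i+1}$ for $1\le i\le r-1$, $\dot z_r=u$. $\partial_r$ denotes the partial derivative with respect to $z_r$. Dilations: for $\varepsilon>0$, $\delta_\varepsilon(z)=(\varepsilon^{p_1}z_1,\dots,\varepsilon^{p_r}z_r)$ on $\mathbb{R}^r$ and $\psi_\varepsilon(z,\xi)=(\varepsilon^{p_1}z_1,\dots,\varepsilon^{p_r}z_r,\varepsilon^{p_{r+1}}\xi)$ on $\mathbb{R}^{r+1}$.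 A real-valued function $f$ is homogeneous of degree $q$ with respect to $(\delta_\varepsilon)$ if $f(\delta_\varepsilon(z))=\varepsilon^qf(z)$ for all $\varepsilon>0$ and all $z$ (where $f$ is defined); a vector field $F$ is homogeneous of degree $q$ if $F(\delta_\varepsilon(z))=\varepsilon^q\delta_\varepsilon(F(z))$; similarly for $(\psi_\varepsilon)$. Differential equations with discontinuous right-hand side are understood in the sense of Filippov differential inclusions. A system is finite-time stable if the origin is Lyapunov stable and every trajectory reaches the origin in finite time and stays there afterwards; a controller stabilizes a system in finite time if the resulting closed-loop trajectories $z$ converge to the origin in finite time in this sense.
   Formalization: W is shown C^1 where z≠0, and off the origin if V_1 is C^1 everywhere (literal claim fails for r=1, V_1=|z|, u_0=-sgn(z)|z|^{1/2}); u_0 is assumed locally bounded with a null set of discontinuities, the regularity implicit in the Filippov setting. *)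

theory Defs
  imports "HOL-Analysis.Analysis"
begin

section \<open>Filippov differential inclusions\<close>

text \<open>
  The Filippov set-valued map of a vector field:
  closed convex hulls of the values near a point, disregarding Lebesgue null sets.  In particular it
  does not depend on the value of the field on a null set, for instance at a single point.
\<close>

definition filippov :: "('a::euclidean_space \<Rightarrow> 'a) \<Rightarrow> 'a \<Rightarrow> 'a set" where
  "filippov F x = (\<Inter>\<delta>\<in>{0<..}. \<Inter>N\<in>{N. negligible N}. closure (convex hull (F ` (ball x \<delta> - N))))"

text \<open>
  Standing regularity of a discontinuous scalar feedback: locally bounded, and with a null set of
  discontinuity points.
\<close>

definition admissible_feedback :: "('a::euclidean_space \<Rightarrow> real) \<Rightarrow> bool" where
  "admissible_feedback u \<longleftrightarrow>
     (\<forall>S. bounded S \<longrightarrow> bounded (u ` S)) \<and> negligible {z. \<not> isCont u z}"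

definition abs_cont_on :: "real \<Rightarrow> real \<Rightarrow> (real \<Rightarrow> 'a::euclidean_space) \<Rightarrow> bool" where
  "abs_cont_on a b x \<longleftrightarrow>
     (\<forall>\<epsilon>>0. \<exists>\<delta>>0. \<forall>d. d division_of \<Union>d \<and> \<Union>d \<subseteq> {a..b} \<and> (\<Sum>k\<in>d. Sup k - Inf k) < \<delta>
        \<longrightarrow> (\<Sum>k\<in>d. norm (x (Sup k) - x (Inf k))) < \<epsilon>)"

text \<open>
  Trajectories on the time axis \<open>[0, \<infinity>)\<close> of the inclusion defined by the field \<open>F\<close>; the values
  \<open>x t\<close> for negative \<open>t\<close> are irrelevant.
\<close>

definition trajectory :: "('a::euclidean_space \<Rightarrow> 'a) \<Rightarrow> (real \<Rightarrow> 'a) \<Rightarrow> bool" where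
  "trajectory F x \<longleftrightarrow>
     (\<forall>T\<ge>0. abs_cont_on 0 T x) \<and>
     (AE t in lebesgue. t \<ge> 0 \<longrightarrow> (\<exists>v\<in>filippov F (x t). (x has_vector_derivative v) (at t)))"

text \<open>
  Stability notions for a family \<open>X\<close> of trajectories, so that they apply both to all the trajectories
  of an inclusion and to the \<open>z\<close>-components of those trajectories of a dynamic feedback that start
  with a prescribed controller state.
\<close>

definition lyapunov_stable :: "((real \<Rightarrow> 'a::euclidean_space) \<Rightarrow> bool) \<Rightarrow> bool" where
  "lyapunov_stable X \<longleftrightarrow>
     (\<forall>\<epsilon>>0. \<exists>\<delta>>0. \<forall>x. X x \<and> norm (x 0) < \<delta> \<longrightarrow> (\<forall>t\<ge>0. norm (x t) < \<epsilon>))"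

definition finite_time_stable :: "((real \<Rightarrow> 'a::euclidean_space) \<Rightarrow> bool) \<Rightarrow> bool" where
  "finite_time_stable X \<longleftrightarrow>
     lyapunov_stable X \<and> (\<forall>x. X x \<longrightarrow> (\<exists>T\<ge>0. \<forall>t\<ge>T. x t = 0))"

text \<open>
  The differential inequality \<open>dV/dt \<le> - c V\<^sup>\<alpha>\<close> at almost all times along the trajectories
  that are not identically zero.
\<close>

definition decay_along ::
    "('a::euclidean_space \<Rightarrow> 'a) \<Rightarrow> ('a \<Rightarrow> real) \<Rightarrow> real \<Rightarrow> real \<Rightarrow> bool" where
  "decay_along F V c \<alpha> \<longleftrightarrow>
     (\<forall>x. trajectory F x \<and> \<not> (\<forall>t\<ge>0. x t = 0) \<longrightarrow>
        (AE t in lebesgue. t \<ge> 0 \<longrightarrow>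
           (\<exists>D. ((\<lambda>s. V (x s)) has_real_derivative D) (at t) \<and> D \<le> - c * V (x t) powr \<alpha>)))"

section \<open>Regularity, definiteness and homogeneity\<close>

definition C1_on :: "('a::euclidean_space \<Rightarrow> real) \<Rightarrow> 'a set \<Rightarrow> bool" where
  "C1_on f S \<longleftrightarrow>
     (\<exists>f' :: 'a \<Rightarrow> 'a \<Rightarrow>\<^sub>L real.
        (\<forall>x\<in>S. (f has_derivative blinfun_apply (f' x)) (at x)) \<and> continuous_on S f')"

definition positive_definite :: "('a::euclidean_space \<Rightarrow> real) \<Rightarrow> bool" where
  "positive_definite f \<longleftrightarrow> f 0 = 0 \<and> (\<forall>x. x \<noteq> 0 \<longrightarrow> f x > 0)"

text \<open>
  Homogeneity with respect to a family of dilations \<open>D \<epsilon>\<close>.  For functions, \<open>S\<close> is the set (invariant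
  under the dilations) on which the function is defined.
\<close>

definition homogeneous_on ::
    "(real \<Rightarrow> 'a \<Rightarrow> 'a) \<Rightarrow> 'a set \<Rightarrow> real \<Rightarrow> ('a \<Rightarrow> real) \<Rightarrow> bool" where
  "homogeneous_on D S q f \<longleftrightarrow> (\<forall>\<epsilon>>0. \<forall>x\<in>S. f (D \<epsilon> x) = \<epsilon> powr q * f x)"

definition homogeneous_field ::
    "(real \<Rightarrow> 'a::real_vector \<Rightarrow> 'a) \<Rightarrow> real \<Rightarrow> ('a \<Rightarrow> 'a) \<Rightarrow> bool" where
  "homogeneous_field D q F \<longleftrightarrow> (\<forall>\<epsilon>>0. \<forall>x. F (D \<epsilon> x) = \<epsilon> powr q *\<^sub>R D \<epsilon> (F x))"

section \<open>Chains of integrators\<close>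

text \<open>
  The space \<open>\<real>\<^sup>r\<close> is \<^typ>\<open>real^'n\<close> with \<open>r = CARD('n)\<close>; the linear order on \<^typ>\<open>'n\<close> numbers the
  coordinates \<open>1, \<dots>, r\<close>, and \<open>coord_no i\<close> is the number of the index \<open>i\<close>.  The space \<open>\<real>\<^sup>r\<^sup>+\<^sup>1\<close> is
  \<^typ>\<open>(real^'n) \<times> real\<close>.
\<close>

definition coord_no :: "'n::{finite,linorder} \<Rightarrow> nat" where
  "coord_no i = card {j. j \<le> i}"

definition last_index :: "'n::{finite,linorder}" where
  "last_index = Max UNIV"

definition e_last :: "real^'n::{finite,linorder}" where
  "e_last = axis last_index 1"

text \<open>The nilpotent Jordan block; \<open>Min {j. i < j}\<close> is the index that follows \<open>i\<close>.\<close>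

definition jordan :: "real^'n::{finite,linorder} \<Rightarrow> real^'n::{finite,linorder}" where
  "jordan z = (\<chi> i. if i = last_index then 0 else z $ Min {j. i < j})"

definition partial_last ::
    "(real^'n::{finite,linorder} \<Rightarrow> real) \<Rightarrow> real^'n::{finite,linorder} \<Rightarrow> real" where
  "partial_last V z = deriv (\<lambda>s. V (z + s *\<^sub>R e_last)) 0"

definition weight :: "real \<Rightarrow> real \<Rightarrow> nat \<Rightarrow> real" where
  "weight p \<kappa> i = p + (real i - 1) * \<kappa>"

definition dil ::
    "real \<Rightarrow> real \<Rightarrow> real \<Rightarrow> real^'n::{finite,linorder} \<Rightarrow> real^'n::{finite,linorder}" where
  "dil p \<kappa> \<epsilon> z = (\<chi> i. \<epsilon> powr weight p \<kappa> (coord_no i) * z $ i)"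

definition dil_ext ::
    "real \<Rightarrow> real \<Rightarrow> real \<Rightarrow>
      (real^'n::{finite,linorder}) \<times> real \<Rightarrow> (real^'n::{finite,linorder}) \<times> real" where
  "dil_ext p \<kappa> \<epsilon> = (\<lambda>(z, \<xi>). (dil p \<kappa> \<epsilon> z, \<epsilon> powr weight p \<kappa> (CARD('n) + 1) * \<xi>))"

definition closed_loop ::
    "(real^'n::{finite,linorder} \<Rightarrow> real) \<Rightarrow> real^'n::{finite,linorder} \<Rightarrow> real^'n::{finite,linorder}" where
  "closed_loop u z = jordan z + u z *\<^sub>R e_last"

section \<open>The super-twisting controller\<close>

text \<open>
  The field on \<open>\<real>\<^sup>r\<^sup>+\<^sup>1\<close> for the super-twisting feedback.  The gradient of \<open>V\<close> need not exist at
  \<open>z = 0\<close>, where \<^const>\<open>partial_last\<close> is then arbitrary; this concerns only the null set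
  \<open>{0} \<times> \<real>\<close> and does not affect the inclusion.
\<close>

definition st_field ::
    "(real^'n::{finite,linorder} \<Rightarrow> real) \<Rightarrow> (real^'n::{finite,linorder} \<Rightarrow> real) \<Rightarrow>
      real \<Rightarrow> real \<Rightarrow>
      (real^'n::{finite,linorder}) \<times> real \<Rightarrow> (real^'n::{finite,linorder}) \<times> real" where
  "st_field u0 V kP kI =
     (\<lambda>(z, \<xi>). (jordan z + (kP * u0 z + \<xi>) *\<^sub>R e_last, - kI * partial_last V z))"

text \<open>
  The trajectories \<open>z\<close> of the chain of integrators under the controller
  \<open>kP u0(z(t)) - kI \<integral>\<^sub>0\<^sup>t \<partial>\<^sub>r V(z(s)) ds\<close>.  The integral term \<open>\<xi>\<close> is the controller state that starts
  at \<open>0\<close>; its derivative is understood in the sense of Filippov, since \<open>\<partial>\<^sub>r V\<close> may be discontinuous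
  (and undefined) at the origin.
\<close>

definition st_controlled ::
    "(real^'n::{finite,linorder} \<Rightarrow> real) \<Rightarrow> (real^'n::{finite,linorder} \<Rightarrow> real) \<Rightarrow>
      real \<Rightarrow> real \<Rightarrow>
      (real \<Rightarrow> real^'n::{finite,linorder}) \<Rightarrow> bool" where
  "st_controlled u0 V kP kI z \<longleftrightarrow>
     (\<exists>\<xi>. trajectory (st_field u0 V kP kI) (\<lambda>t. (z t, \<xi> t)) \<and> \<xi> 0 = 0)"

text \<open>
  When \<open>V\<close> is continuously differentiable only away from the origin, \<open>W = st_lyapunov V kI \<alpha> A\<close> is in
  general not differentiable at the points \<open>(0, \<xi>)\<close> with \<open>\<xi> \<noteq> 0\<close>: with \<open>r = 1\<close> and
  \<open>V z = \<bar>z\<bar>\<close> (which arises from \<open>u0 z = - sgn z * sqrt \<bar>z\<bar>\<close>), it has a kink at all of them.  Hence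
  its continuous differentiability is a property on \<open>z \<noteq> 0\<close>, and on the complement of the origin
  when \<open>V\<close> is continuously differentiable everywhere.
\<close>

definition st_lyapunov ::
    "(real^'n::{finite,linorder} \<Rightarrow> real) \<Rightarrow> real \<Rightarrow> real \<Rightarrow> real \<Rightarrow>
      (real^'n::{finite,linorder}) \<times> real \<Rightarrow> real" where
  "st_lyapunov V kI \<alpha> A =
     (\<lambda>(z, \<xi>). A * (V z + \<xi>\<^sup>2 / (2 * kI)) powr (2 - \<alpha>) - z $ last_index * \<xi>)"

end

theory Submission
  imports Defs
begin

text \<open>
  Let \<open>q = p\<^sub>r\<^sub>+\<^sub>1\<close> and \<open>E = V1 + \<xi>\<^sup>2 / (2 kI)\<close>. Along the extended inclusion the integral action adds
  \<open>\<xi> \<partial>\<^sub>r V1\<close> to the derivative of \<open>V1\<close>, and the term \<open>\<xi>\<^sup>2 / (2 kI)\<close> subtracts it again. The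
  excess gain contributes \<open>(kP - 1) u0 \<partial>\<^sub>r V1 \<le> 0\<close>. Hence \<open>dE/dt \<le> - c V1 powr \<alpha>\<close>, which gives no decay in
  the direction of \<open>\<xi>\<close>. The cross term \<open>- z\<^sub>r \<xi>\<close> supplies it, because its derivative contains
  \<open>- \<xi>\<^sup>2\<close>; its remaining terms are bounded by \<open>\<xi>\<^sup>2 / 2\<close> and a multiple of \<open>V1\<close>, by homogeneity.
  Homogeneity also forces \<open>\<alpha> = 1 + \<kappa> / (2 q)\<close> (\<open>\<alpha>_eq\<close>), so \<open>E powr (2 - \<alpha>)\<close> has the degree
  of \<open>z\<^sub>r \<xi>\<close>, and for large \<open>A\<close> one gets \<open>dW/dt \<le> - const * E\<close> together with, off the origin,
  \<open>0 < W \<le> const * E powr (2 - \<alpha>)\<close> (\<open>st_lyapunov_derivative_le\<close>, \<open>super_twisting_lyapunov\<close>).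

  Three points need more than this computation. First, the decay of \<open>V1\<close> is known along trajectories,
  whereas the estimate uses it at points and for all Filippov velocities. A violation at a continuity
  point of \<open>u0\<close> would persist along any trajectory that starts there (\<open>pointwise_decay\<close>), so a
  trajectory has to exist: this is \<open>filippov_existence\<close>, which rests on the almost everywhere
  differentiability of Lipschitz functions. The inequality then passes from the continuity points
  to the Filippov velocities by convexity (\<open>filippov_velocity\<close>).

  Second, \<open>W\<close> need not be differentiable where \<open>z = 0\<close> and \<open>\<xi> \<noteq> 0\<close>. There \<open>u0\<close> is small and
  \<open>z\<^sub>r\<close> moves with velocity close to \<open>\<xi>\<close>, so trajectories meet these points at isolated times
  only (\<open>crossing_isolated\<close>), and continuity of \<open>W\<close> bridges them.

  Third, a pointwise differential inequality has to be integrated along absolutely continuous curves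
  (\<open>abs_cont_on_imp_real_increment_le\<close>); the locale \<open>strict_lyapunov\<close> draws the conclusion that
  zero is reached in finite time.
\<close>

section \<open>Lipschitz functions of one real variable\<close>

text \<open>
  The functions \<open>g\<close> and \<open>t \<mapsto> t - g t\<close> are both monotone, and their Stieltjes measures add up to
  Lebesgue measure. So the measure of \<open>g\<close> is absolutely continuous, and its Radon-Nikodym density is
  the integrand.
\<close>

lemma monotone_nonexpansive_imp_integral:
  fixes g :: "real \<Rightarrow> real"
  assumes mono: "\<And>x y. x \<le> y \<Longrightarrow> g x \<le> g y"
    and nonexp: "\<And>x y. x \<le> y \<Longrightarrow> g y - g x \<le> y - x"
  obtains w where "\<And>a b. a \<le> b \<Longrightarrow> (w has_integral (g b - g a)) {a..b}"
proof -
  have lip: "1-lipschitz_on UNIV g"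
  proof (rule lipschitz_onI)
    fix x y :: real
    show "dist (g x) (g y) \<le> 1 * dist x y"
      using mono[of x y] mono[of y x] nonexp[of x y] nonexp[of y x]
      by (cases "x \<le> y") (auto simp: dist_real_def)
  qed simp
  then have cont: "continuous_on UNIV g"
    by (rule lipschitz_on_continuous_on)
  let ?h = "\<lambda>t. t - g t"
  have conth: "continuous_on UNIV ?h"
    by (intro continuous_intros cont)
  have monoh: "\<And>x y. x \<le> y \<Longrightarrow> ?h x \<le> ?h y"
    using nonexp by (simp add: algebra_simps)
  define M1 where "M1 = interval_measure g"
  define M2 where "M2 = interval_measure ?h"
  \<comment> \<open>The sum of the two Stieltjes measures; it is identified with Lebesgue measure below.\<close>
  define N where "N = measure_of UNIV (sets borel) (\<lambda>A. emeasure M1 A + emeasure M2 A)"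
  have sets_N: "sets N = sets borel"
    unfolding N_def by (metis sets.sigma_sets_eq sets_measure_of space_borel subset_Pow_Union top_greatest sets.space_closed)
  have sM: "sets M1 = sets borel" "sets M2 = sets borel"
    by (auto simp: M1_def M2_def)
  have ca: "countably_additive (sets N) (\<lambda>A. emeasure M1 A + emeasure M2 A)"
  proof (rule countably_additiveI)
    fix A :: "nat \<Rightarrow> real set"
    assume A: "range A \<subseteq> sets N" "disjoint_family A"
    have "(\<Sum>i. emeasure M1 (A i) + emeasure M2 (A i)) = (\<Sum>i. emeasure M1 (A i)) + (\<Sum>i. emeasure M2 (A i))"
      by (rule suminf_add[symmetric]) auto
    then show "(\<Sum>i. emeasure M1 (A i) + emeasure M2 (A i)) = emeasure M1 (\<Union>(range A)) + emeasure M2 (\<Union>(range A))"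
      using A suminf_emeasure[of A M1] suminf_emeasure[of A M2] by (simp add: sets_N sM)
  qed
  have emN: "emeasure N A = emeasure M1 A + emeasure M2 A" if "A \<in> sets borel" for A
    by (rule emeasure_measure_of[OF N_def]) (use that ca in \<open>auto simp: sets_N positive_def\<close>)
  have "lborel = N"
  proof (rule lborel_eqI)
    fix l u :: real
    assume lu: "\<And>b. b \<in> Basis \<Longrightarrow> l \<bullet> b \<le> u \<bullet> b"
    then have lu: "l \<le> u" by simp
    have Ioo: "emeasure (interval_measure f) {l<..<u} = ennreal (f u - f l)"
      if m: "\<And>x y. x \<le> y \<Longrightarrow> f x \<le> f y" and c: "continuous_on UNIV f" for f
    proof (cases "l < u")
      case True
      have "{u} \<in> null_sets (interval_measure f)"
        using emeasure_interval_measure_Icc[OF order_refl m c, of u] by (simp add: null_sets_def)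
      then have "emeasure (interval_measure f) ({l<..<u} \<union> {u}) = emeasure (interval_measure f) {l<..<u}"
        by (intro emeasure_Un_null_set) auto
      moreover have "{l<..<u} \<union> {u} = {l<..u}" using True by auto
      moreover have "emeasure (interval_measure f) {l<..u} = ennreal (f u - f l)"
        using m c lu
        by (intro emeasure_interval_measure_Ioc)
           (auto simp: continuous_on_eq_continuous_at continuous_at_imp_continuous_at_within)
      ultimately show ?thesis by simp
    next
      case False
      with lu show ?thesis by simp
    qed
    have "emeasure N {l<..<u} = ennreal (g u - g l) + ennreal (?h u - ?h l)"
      using Ioo[OF mono cont] Ioo[OF monoh conth] by (simp add: emN M1_def M2_def)
    also have "\<dots> = ennreal (u - l)"
      using mono[OF lu] nonexp[OF lu] by (simp flip: ennreal_plus)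
    finally show "emeasure N (box l u) = (\<Prod>b\<in>Basis. (u - l) \<bullet> b)"
      by simp
  qed (rule sets_N)
  have ac: "absolutely_continuous lborel M1"
    unfolding absolutely_continuous_def
  proof
    fix A :: "real set" assume A: "A \<in> null_sets lborel"
    then have "emeasure N A = 0"
      by (metis \<open>lborel = N\<close> null_setsD1)
    then show "A \<in> null_sets M1"
      using emN[of A] A by (auto simp: null_sets_def sM)
  qed
  obtain w where w[measurable]: "w \<in> borel_measurable lborel" and dens: "density lborel w = M1"
    using sigma_finite_measure.Radon_Nikodym[OF sigma_finite_lborel ac] sM by auto
  show thesis
  proof
    fix a b :: real
    assume ab: "a \<le> b"
    have Icc: "emeasure M1 {a..b} = ennreal (g b - g a)"
      unfolding M1_def by (rule emeasure_interval_measure_Icc[OF ab mono cont])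
    let ?k = "\<lambda>t. indicator {a..b} t * w t"
    have int: "(\<integral>\<^sup>+ t. ?k t \<partial>lborel) = ennreal (g b - g a)"
      using Icc dens emeasure_density[of w lborel "{a..b}"] by (simp add: mult.commute)
    have fin: "AE t in lborel. ?k t \<noteq> \<infinity>"
      by (rule nn_integral_PInf_AE) (use int in auto)
    have "(\<integral>\<^sup>+ t. ennreal (enn2real (?k t)) \<partial>lborel) = ennreal (g b - g a)"
      unfolding int[symmetric] by (rule nn_integral_cong_AE) (use fin in \<open>auto simp: less_top\<close>)
    then have "((\<lambda>t. enn2real (?k t)) has_integral (g b - g a)) UNIV"
      by (intro nn_integral_has_integral) (use mono ab in auto)
    moreover have "enn2real (?k t) = (if t \<in> {a..b} then enn2real (w t) else 0)" for t
      by (auto simp: indicator_def)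
    ultimately show "((\<lambda>t. enn2real (w t)) has_integral (g b - g a)) {a..b}"
      by (simp only: has_integral_restrict_UNIV)
  qed
qed

text \<open>
  At almost every \<open>x\<close> the averages of \<open>w\<close> over \<open>[x, x + h]\<close> tend to \<open>w x\<close>. Applied to \<open>w\<close>
  and to its reflection \<open>t \<mapsto> w (- t)\<close> this gives the right and the left derivative, with the
  same value \<open>w x\<close>.
\<close>

lemma indefinite_integral_AE_differentiable:
  fixes g w :: "real \<Rightarrow> real"
  assumes w: "\<And>a b. a \<le> b \<Longrightarrow> (w has_integral (g b - g a)) {a..b}"
  shows "negligible {t. \<not> g differentiable (at t)}"
proof -
  have int: "w integrable_on cbox a b" for a b
    using w[of a b] by (cases "a \<le> b") (auto simp: has_integral_integrable)
  obtain N where N: "negligible N"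
    "\<And>x e. \<lbrakk>x \<notin> N; 0 < e\<rbrakk> \<Longrightarrow> \<exists>d>0. \<forall>h. 0 < h \<and> h < d \<longrightarrow>
            norm (integral (cbox x (x + h *\<^sub>R One)) w /\<^sub>R h ^ DIM(real) - w x) < e"
    using integrable_ccontinuous_explicit[of w] int by metis
  have intm: "((\<lambda>t. w (- t)) has_integral (g (-a) - g (-b))) {a..b}" if "a \<le> b" for a b
    using w[of "-b" "-a"] that has_integral_reflect_real[where f = w and a = "-b" and b = "-a"] by simp
  then have "(\<lambda>t. w (- t)) integrable_on cbox a b" for a b
    by (cases "a \<le> b") (auto simp: has_integral_integrable)
  then obtain N' where N': "negligible N'"
    "\<And>x e. \<lbrakk>x \<notin> N'; 0 < e\<rbrakk> \<Longrightarrow> \<exists>d>0. \<forall>h. 0 < h \<and> h < d \<longrightarrow>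
            norm (integral (cbox x (x + h *\<^sub>R One)) (\<lambda>t. w (- t)) /\<^sub>R h ^ DIM(real) - w (- x)) < e"
    using integrable_ccontinuous_explicit[of "\<lambda>t. w (- t)"] by metis
  have neg: "negligible (N \<union> uminus ` N')"
    by (intro negligible_Un N(1) negligible_differentiable_image_negligible N'(1)
          differentiable_on_minus differentiable_on_ident) simp
  have "g differentiable (at t)" if t: "t \<notin> N \<union> uminus ` N'" for t
  proof -
    have t2: "- t \<notin> N'" using t by force
    have "(g has_real_derivative w t) (at t)"
      unfolding DERIV_def LIM_def
    proof (intro allI impI)
      fix e :: real assume e: "0 < e"
      obtain d where d: "d > 0" "\<And>h. 0 < h \<and> h < d \<Longrightarrow>
            norm (integral (cbox t (t + h *\<^sub>R One)) w /\<^sub>R h ^ DIM(real) - w t) < e"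
        using N(2)[of t e] t e by auto
      obtain d' where d': "d' > 0" "\<And>h. 0 < h \<and> h < d' \<Longrightarrow>
            norm (integral (cbox (-t) (-t + h *\<^sub>R One)) (\<lambda>t. w (- t)) /\<^sub>R h ^ DIM(real) - w (- (-t))) < e"
        using N'(2)[OF t2 e] by auto
      show "\<exists>s>0. \<forall>h. h \<noteq> 0 \<and> dist h 0 < s \<longrightarrow> dist ((g (t + h) - g t) / h) (w t) < e"
      proof (intro exI[of _ "min d d'"] conjI allI impI)
        show "0 < min d d'" using d d' by auto
        fix h :: real assume h: "h \<noteq> 0 \<and> dist h 0 < min d d'"
        show "dist ((g (t + h) - g t) / h) (w t) < e"
        proof (cases "h > 0")
          case True
          then have "integral (cbox t (t + h *\<^sub>R One)) w /\<^sub>R h ^ DIM(real) = (g (t + h) - g t) / h"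
            using integral_unique[OF w[of t "t + h"]] by (simp add: inverse_eq_divide)
          moreover have "0 < h \<and> h < d" using True h by (simp add: dist_real_def)
          ultimately show ?thesis
            using d(2)[of h] by (simp only: dist_norm)
        next
          case False
          with h have h': "h < 0" "- h < d'" by (auto simp: dist_real_def)
          have "integral {-t..-t - h} (\<lambda>t. w (- t)) = g t - g (t + h)"
            using integral_unique[OF intm[of "-t" "-t - h"]] h' by (simp add: add.commute)
          then have "integral (cbox (-t) (-t + (-h) *\<^sub>R One)) (\<lambda>t. w (- t)) /\<^sub>R (-h) ^ DIM(real) = (g (t + h) - g t) / h"
            using h' by (simp add: inverse_eq_divide divide_simps) (simp add: algebra_simps)?
          moreover have "0 < - h \<and> - h < d'" using h' by simp
          ultimately show ?thesis
            using d'(2)[of "-h"] by (simp only: dist_norm minus_minus)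
        qed
      qed
    qed
    then show ?thesis
      using real_differentiable_def by blast
  qed
  then show ?thesis
    by (intro negligible_subset[OF neg]) blast
qed

text \<open>
  Rademacher's theorem in dimension one: \<open>(f t / K + t) / 2\<close> is monotone and nonexpansive when
  \<open>K\<close> is a positive Lipschitz constant of \<open>f\<close>.
\<close>

lemma lipschitz_AE_differentiable_real:
  fixes f :: "real \<Rightarrow> real"
  assumes "L-lipschitz_on UNIV f"
  shows "negligible {t. \<not> f differentiable (at t)}"
proof -
  define K where "K = L + 1"
  have "0 \<le> L" using assms lipschitz_on_nonneg by blast
  then have K: "K > 0" by (simp add: K_def)
  define g where "g t = (f t / K + t) / 2" for t
  have lip: "\<bar>f x - f y\<bar> \<le> K * \<bar>x - y\<bar>" for x y
    using lipschitz_onD[OF assms, of x y] by (simp add: dist_real_def K_def algebra_simps)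
  have lip': "\<bar>f x / K - f y / K\<bar> \<le> \<bar>x - y\<bar>" for x y
    using lip[of x y] K by (simp add: diff_divide_distrib[symmetric] divide_le_eq mult.commute)
  have mono: "g x \<le> g y" if "x \<le> y" for x y
    using lip'[of x y] that unfolding g_def by argo
  moreover have "g y - g x \<le> y - x" if "x \<le> y" for x y
    using lip'[of x y] that unfolding g_def by argo
  ultimately obtain w where "\<And>a b. a \<le> b \<Longrightarrow> (w has_integral (g b - g a)) {a..b}"
    using monotone_nonexpansive_imp_integral by blast
  then have "negligible {t. \<not> g differentiable (at t)}"
    by (rule indefinite_integral_AE_differentiable)
  moreover have "f differentiable (at t)" if "g differentiable (at t)" for t
  proof -
    have eq: "f = (\<lambda>t. K * (2 * g t - t))"
      using K by (auto simp: g_def add_divide_distrib)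
    show ?thesis
      unfolding eq by (intro differentiable_mult differentiable_diff differentiable_const differentiable_ident that)
  qed
  ultimately show ?thesis
    by (elim negligible_subset) blast
qed

section \<open>Absolutely continuous functions\<close>

text \<open>
  Choose a gauge for which the derivative controls the increment over every interval tagged
  outside the null set, while the intervals tagged in the null set have small total length; absolute
  continuity bounds the increments over the latter. Adding the increments over a fine tagged
  division gives the claim.
\<close>

lemma abs_cont_on_imp_real_increment_le:
  fixes f :: "real \<Rightarrow> real"
  assumes ac: "abs_cont_on a b f" and ab: "a \<le> b"
    and N: "negligible N"
    and deriv: "\<And>t. a < t \<Longrightarrow> t < b \<Longrightarrow> t \<notin> N \<Longrightarrow> \<exists>D. (f has_real_derivative D) (at t) \<and> D \<le> k"
  shows "f b - f a \<le> k * (b - a)"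
proof (rule field_le_epsilon)
  fix e :: real assume e: "0 < e"
  then have e4: "e / 4 > 0" by simp
  define \<eta> where "\<eta> = e / (4 * (b - a + 1))"
  have \<eta>: "\<eta> > 0" "\<eta> * (b - a) \<le> e / 4"
    using e ab by (auto simp: \<eta>_def field_simps)
  obtain \<delta> where \<delta>: "\<delta> > 0" and small0: "\<forall>d. d division_of \<Union>d \<and> \<Union>d \<subseteq> {a..b} \<and>
      (\<Sum>K\<in>d. Sup K - Inf K) < \<delta> \<longrightarrow> (\<Sum>K\<in>d. norm (f (Sup K) - f (Inf K))) < e / 4"
    using ac e4 unfolding abs_cont_on_def by blast
  have small: "(\<Sum>K\<in>d. norm (f (Sup K) - f (Inf K))) < e / 4"
    if "d division_of \<Union>d" "\<Union>d \<subseteq> {a..b}" "(\<Sum>K\<in>d. Sup K - Inf K) < \<delta>" for d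
    using small0 that by blast
  define \<delta>' where "\<delta>' = min \<delta> (e / (4 * (\<bar>k + \<eta>\<bar> + 1)))"
  have \<delta>': "\<delta>' > 0" "\<delta>' \<le> \<delta>" "\<bar>k + \<eta>\<bar> * \<delta>' \<le> e / 4"
  proof -
    show "\<delta>' > 0" "\<delta>' \<le> \<delta>"
      using \<delta> e by (auto simp: \<delta>'_def add_nonneg_pos)
    define K where "K = \<bar>k + \<eta>\<bar> + 1"
    have K: "K > 0" "\<bar>k + \<eta>\<bar> \<le> K" by (auto simp: K_def)
    have "\<bar>k + \<eta>\<bar> * \<delta>' \<le> K * (e / (4 * K))"
      using \<open>\<delta>' > 0\<close> K by (intro mult_mono) (auto simp: \<delta>'_def K_def)
    also have "\<dots> = e / 4"
      using K by simp
    finally show "\<bar>k + \<eta>\<bar> * \<delta>' \<le> e / 4" .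
  qed
  define M where "M = N \<union> {a, b}"
  have "negligible M" by (simp add: M_def N negligible_Un negligible_insert)
  then have "((indicator M :: real \<Rightarrow> real) has_integral 0) (cbox a b)"
    by (simp add: negligible_def)
  \<comment> \<open>The integral sums of the indicator of a null set are small: this bounds the length of the intervals tagged in \<open>M\<close>.\<close>
  from has_integralD[OF this \<delta>'(1)] obtain \<gamma> where \<gamma>: "gauge \<gamma>" "\<And>p. p tagged_division_of (cbox a b) \<Longrightarrow> \<gamma> fine p \<Longrightarrow>
      norm ((\<Sum>(x, K)\<in>p. measure lborel K *\<^sub>R (indicator M x :: real)) - 0) < \<delta>'"
    by blast
  have "\<exists>d>0. \<forall>u v. u \<le> x \<and> x \<le> v \<and> {u..v} \<subseteq> ball x d \<longrightarrow> f v - f u \<le> (k + \<eta>) * (v - u)"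
    if x: "x \<in> {a..b} - M" for x
  proof -
    obtain D where D: "(f has_real_derivative D) (at x)" "D \<le> k"
      using deriv[of x] x by (auto simp: M_def less_le)
    then have "(f has_derivative (\<lambda>h. D * h)) (at x)"
      by (simp add: has_field_derivative_def)
    then obtain d where d: "d > 0" "\<And>y. norm (y - x) < d \<Longrightarrow> norm (f y - f x - D * (y - x)) \<le> \<eta> * norm (y - x)"
      using \<eta>(1) unfolding has_derivative_at_alt by blast
    have "f v - f u \<le> (k + \<eta>) * (v - u)" if uv: "u \<le> x \<and> x \<le> v \<and> {u..v} \<subseteq> ball x d" for u v
    proof -
      have "u \<in> {u..v}" "v \<in> {u..v}" using uv by auto
      then have "u \<in> ball x d" "v \<in> ball x d" using uv by blast+
      then have "norm (f u - f x - D * (u - x)) \<le> \<eta> * norm (u - x)"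
        "norm (f v - f x - D * (v - x)) \<le> \<eta> * norm (v - x)"
        using d(2) by (auto simp: dist_norm norm_minus_commute)
      then have "f v - f u \<le> (D + \<eta>) * (v - u)"
        using uv by (auto simp: algebra_simps abs_le_iff)
      also have "\<dots> \<le> (k + \<eta>) * (v - u)"
        using uv D by (intro mult_right_mono) auto
      finally show ?thesis .
    qed
    with d(1) show ?thesis by blast
  qed
  then obtain \<rho> where \<rho>: "\<And>x. x \<in> {a..b} - M \<Longrightarrow> \<rho> x > 0"
    "\<And>x u v. x \<in> {a..b} - M \<Longrightarrow> u \<le> x \<Longrightarrow> x \<le> v \<Longrightarrow> {u..v} \<subseteq> ball x (\<rho> x) \<Longrightarrow> f v - f u \<le> (k + \<eta>) * (v - u)"
    by metis
  define \<gamma>' where "\<gamma>' x = \<gamma> x \<inter> (if x \<in> {a..b} - M then ball x (\<rho> x) else UNIV)" for x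
  have "gauge \<gamma>'"
    using \<gamma>(1) \<rho>(1) by (auto simp: gauge_def \<gamma>'_def)
  then obtain p where p: "p tagged_division_of {a..b}" "\<gamma>' fine p"
    using fine_division_exists_real by blast
  have fine: "\<gamma> fine p"
    using p(2) by (auto simp: fine_def \<gamma>'_def)
  have pK: "\<exists>u v. u \<le> x \<and> x \<le> v \<and> K = {u..v} \<and> a \<le> u \<and> v \<le> b" if xK: "(x, K) \<in> p" for x K
  proof -
    obtain u v where uv: "K = cbox u v"
      using tagged_division_ofD(4)[OF p(1) xK] by blast
    have "x \<in> K" "K \<subseteq> {a..b}"
      using tagged_division_ofD(2,3)[OF p(1) xK] by blast+
    then show ?thesis using uv by auto
  qed
  define B where "B = {xK \<in> p. fst xK \<in> M}"
  have pK': "measure lborel K = Sup K - Inf K" "0 \<le> Sup K - Inf K" "K \<subseteq> {a..b}"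
      "interior K = {} \<Longrightarrow> Sup K = Inf K" if xK: "(x, K) \<in> p" for x K
    using pK[OF xK] by auto
  have finp: "finite p" using p(1) by auto
  have B: "B \<subseteq> p" "finite B" using finp by (auto simp: B_def)
  have Bpart: "B tagged_partial_division_of {a..b}"
    by (rule tagged_partial_division_subset[OF _ B(1)]) (use p(1) in \<open>simp add: tagged_division_of_def\<close>)
  have Bdiv: "B tagged_division_of \<Union>(snd ` B)"
    by (rule tagged_partial_division_of_Union_self[OF Bpart])
  have Bsum: "(\<Sum>(x, K)\<in>B. h K) = (\<Sum>K\<in>snd ` B. h K)" if "\<And>u v. v \<le> u \<Longrightarrow> h {u..v} = 0" for h :: "real set \<Rightarrow> real"
    using sum.over_tagged_division_lemma[OF Bdiv, of h] that by (auto simp: not_less)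
  have Blen: "(\<Sum>(x, K)\<in>B. Sup K - Inf K) < \<delta>'"
  proof -
    have "(\<Sum>(x, K)\<in>p. measure lborel K *\<^sub>R (indicator M x :: real)) = (\<Sum>(x, K)\<in>B. measure lborel K)"
      by (rule sum.mono_neutral_cong_right) (use finp in \<open>auto simp: B_def indicator_def\<close>)
    also have "\<dots> = (\<Sum>(x, K)\<in>B. Sup K - Inf K)"
      using B(1) pK'(1) by (intro sum.cong) auto
    finally show ?thesis
      using \<gamma>(2)[of p] p(1) fine by (auto simp: abs_less_iff)
  qed
  have Bnonneg: "0 \<le> (\<Sum>(x, K)\<in>B. Sup K - Inf K)"
    using B(1) pK'(2) by (intro sum_nonneg) auto
  have "(\<Sum>K\<in>snd ` B. norm (f (Sup K) - f (Inf K))) < e / 4"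
  proof (rule small)
    show "snd ` B division_of \<Union> (snd ` B)"
      using partial_division_of_tagged_division[OF Bpart] .
    show "\<Union> (snd ` B) \<subseteq> {a..b}"
      using B(1) pK'(3) by fastforce
    have "(\<Sum>K\<in>snd ` B. measure lborel K) = (\<Sum>(x, K)\<in>B. measure lborel K)"
      by (subst Bsum) auto
    also have "\<dots> = (\<Sum>(x, K)\<in>B. Sup K - Inf K)"
      using B(1) pK'(1) by (intro sum.cong) auto
    finally have "(\<Sum>K\<in>snd ` B. measure lborel K) < \<delta>" using Blen \<delta>' by simp
    moreover have "(\<Sum>K\<in>snd ` B. measure lborel K) = (\<Sum>K\<in>snd ` B. Sup K - Inf K)"
      using B(1) pK'(1) by (intro sum.cong) auto
    ultimately show "(\<Sum>K\<in>snd ` B. Sup K - Inf K) < \<delta>" by simp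
  qed
  moreover have "(\<Sum>K\<in>snd ` B. norm (f (Sup K) - f (Inf K))) = (\<Sum>(x, K)\<in>B. norm (f (Sup K) - f (Inf K)))"
  proof -
    let ?h = "\<lambda>K. if interior K = {} then 0 else norm (f (Sup K) - f (Inf K))"
    have eq: "norm (f (Sup K) - f (Inf K)) = ?h K" if "K \<in> snd ` B" for K
      using that B(1) pK'(4) by fastforce
    have "(\<Sum>K\<in>snd ` B. norm (f (Sup K) - f (Inf K))) = (\<Sum>K\<in>snd ` B. ?h K)"
      by (rule sum.cong) (use eq in auto)
    also have "\<dots> = (\<Sum>(x, K)\<in>B. ?h K)"
      by (rule Bsum[symmetric]) auto
    also have "\<dots> = (\<Sum>(x, K)\<in>B. norm (f (Sup K) - f (Inf K)))"
      by (rule sum.cong) (use eq in force)+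
    finally show ?thesis .
  qed
  moreover have "(\<Sum>(x, K)\<in>B. f (Sup K) - f (Inf K)) \<le> (\<Sum>(x, K)\<in>B. norm (f (Sup K) - f (Inf K)))"
    by (intro sum_mono) auto
  ultimately have Bf: "(\<Sum>(x, K)\<in>B. f (Sup K) - f (Inf K)) \<le> e / 4"
    by linarith
  have Gf: "(\<Sum>(x, K)\<in>p - B. f (Sup K) - f (Inf K)) \<le> (\<Sum>(x, K)\<in>p - B. (k + \<eta>) * (Sup K - Inf K))"
  proof (rule sum_mono, clarify)
    fix x K assume xK: "(x, K) \<in> p" "(x, K) \<notin> B"
    then obtain u v where uv: "u \<le> x" "x \<le> v" "K = {u..v}" "a \<le> u" "v \<le> b"
      using pK by blast
    have "x \<in> {a..b} - M" using xK uv by (auto simp: B_def)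
    moreover have "K \<subseteq> \<gamma>' x" using p(2) xK by (auto simp: fine_def)
    ultimately show "f (Sup K) - f (Inf K) \<le> (k + \<eta>) * (Sup K - Inf K)"
      using \<rho>(2)[of x u v] uv by (auto simp: \<gamma>'_def)
  qed
  have "f b - f a = (\<Sum>(x, K)\<in>p. f (Sup K) - f (Inf K))"
    by (rule additive_tagged_division_1[OF ab p(1), symmetric])
  also have "\<dots> = (\<Sum>(x, K)\<in>p - B. f (Sup K) - f (Inf K)) + (\<Sum>(x, K)\<in>B. f (Sup K) - f (Inf K))"
    by (rule sum.subset_diff[OF B(1) finp])
  also have "\<dots> \<le> (\<Sum>(x, K)\<in>p - B. (k + \<eta>) * (Sup K - Inf K)) + e / 4"
    using Gf Bf by simp
  also have "(\<Sum>(x, K)\<in>p - B. (k + \<eta>) * (Sup K - Inf K)) =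
      (\<Sum>(x, K)\<in>p. (k + \<eta>) * (Sup K - Inf K)) - (\<Sum>(x, K)\<in>B. (k + \<eta>) * (Sup K - Inf K))"
    using sum.subset_diff[OF B(1) finp, of "\<lambda>(x, K). (k + \<eta>) * (Sup K - Inf K)"] by simp
  also have "(\<Sum>(x, K)\<in>p. (k + \<eta>) * (Sup K - Inf K)) = (k + \<eta>) * (b - a)"
    using additive_tagged_division_1[OF ab p(1), of "\<lambda>t. (k + \<eta>) * t"] by (simp add: right_diff_distrib)
  also have "(\<Sum>(x, K)\<in>B. (k + \<eta>) * (Sup K - Inf K)) = (k + \<eta>) * (\<Sum>(x, K)\<in>B. Sup K - Inf K)"
    by (simp add: sum_distrib_left case_prod_beta)
  also have "(k + \<eta>) * (b - a) - (k + \<eta>) * (\<Sum>(x, K)\<in>B. Sup K - Inf K) \<le> k * (b - a) + e / 4 + e / 4"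
  proof -
    have "- (k + \<eta>) * (\<Sum>(x, K)\<in>B. Sup K - Inf K) \<le> \<bar>k + \<eta>\<bar> * \<delta>'"
      using Blen Bnonneg by (intro mult_mono) auto
    then show ?thesis using \<eta>(2) \<delta>'(3) by (simp add: algebra_simps)
  qed
  finally show "f b - f a \<le> k * (b - a) + e"
    using e by simp
qed

lemma abs_cont_on_subset:
  assumes "abs_cont_on a b x" "{a'..b'} \<subseteq> {a..b}"
  shows "abs_cont_on a' b' x"
  unfolding abs_cont_on_def
proof (intro allI impI)
  fix e :: real assume e0: "e > 0"
  obtain \<delta> where \<delta>: "\<delta> > 0" and small0: "\<forall>d. d division_of \<Union>d \<and> \<Union>d \<subseteq> {a..b} \<and>
      (\<Sum>K\<in>d. Sup K - Inf K) < \<delta> \<longrightarrow> (\<Sum>K\<in>d. norm (x (Sup K) - x (Inf K))) < e"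
    using assms(1) e0 unfolding abs_cont_on_def by blast
  have small: "(\<Sum>K\<in>d. norm (x (Sup K) - x (Inf K))) < e"
    if "d division_of \<Union>d" "\<Union>d \<subseteq> {a..b}" "(\<Sum>K\<in>d. Sup K - Inf K) < \<delta>" for d
    using small0 that by blast
  show "\<exists>\<delta>>0. \<forall>d. d division_of \<Union>d \<and> \<Union>d \<subseteq> {a'..b'} \<and> (\<Sum>k\<in>d. Sup k - Inf k) < \<delta>
        \<longrightarrow> (\<Sum>k\<in>d. norm (x (Sup k) - x (Inf k))) < e"
    using order_trans[OF _ assms(2)] \<delta> small by (intro exI[of _ \<delta>] conjI allI impI small) blast+
qed

lemma abs_cont_on_lipschitz_compose:
  fixes x :: "real \<Rightarrow> 'a::euclidean_space" and f :: "'a \<Rightarrow> 'b::euclidean_space"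
  assumes x: "abs_cont_on a b x" and f: "L-lipschitz_on (x ` {a..b}) f"
  shows "abs_cont_on a b (\<lambda>t. f (x t))"
  unfolding abs_cont_on_def
proof (intro allI impI)
  fix e :: real assume e: "e > 0"
  have L: "L \<ge> 0" using f lipschitz_on_nonneg by blast
  then have e1: "e / (L + 1) > 0" using e by auto
  obtain \<delta> where \<delta>: "\<delta> > 0" and small0: "\<forall>d. d division_of \<Union>d \<and> \<Union>d \<subseteq> {a..b} \<and>
      (\<Sum>K\<in>d. Sup K - Inf K) < \<delta> \<longrightarrow> (\<Sum>K\<in>d. norm (x (Sup K) - x (Inf K))) < e / (L + 1)"
    using x e1 unfolding abs_cont_on_def by blast
  have small: "(\<Sum>K\<in>d. norm (x (Sup K) - x (Inf K))) < e / (L + 1)"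
    if "d division_of \<Union>d" "\<Union>d \<subseteq> {a..b}" "(\<Sum>K\<in>d. Sup K - Inf K) < \<delta>" for d
    using small0 that by blast
  show "\<exists>\<delta>>0. \<forall>d. d division_of \<Union>d \<and> \<Union>d \<subseteq> {a..b} \<and> (\<Sum>k\<in>d. Sup k - Inf k) < \<delta>
        \<longrightarrow> (\<Sum>k\<in>d. norm (f (x (Sup k)) - f (x (Inf k)))) < e"
  proof (intro exI[of _ \<delta>] conjI allI impI \<delta>)
    fix d assume d: "d division_of \<Union>d \<and> \<Union>d \<subseteq> {a..b} \<and> (\<Sum>k\<in>d. Sup k - Inf k) < \<delta>"
    have "(\<Sum>k\<in>d. norm (f (x (Sup k)) - f (x (Inf k)))) \<le> (\<Sum>k\<in>d. L * norm (x (Sup k) - x (Inf k)))"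
    proof (rule sum_mono)
      fix k assume k: "k \<in> d"
      obtain u v where uv: "k = {u..v}" "u \<le> v"
        using d k by (metis box_real(2) division_ofD(3,4) atLeastatMost_empty_iff2)
      then have "u \<in> {a..b}" "v \<in> {a..b}" using d k by fastforce+
      then show "norm (f (x (Sup k)) - f (x (Inf k))) \<le> L * norm (x (Sup k) - x (Inf k))"
        using lipschitz_onD[OF f, of "x v" "x u"] uv by (simp add: dist_norm)
    qed
    also have "\<dots> = L * (\<Sum>k\<in>d. norm (x (Sup k) - x (Inf k)))"
      by (simp add: sum_distrib_left)
    also have "\<dots> \<le> (L + 1) * (\<Sum>k\<in>d. norm (x (Sup k) - x (Inf k)))"
      by (intro mult_right_mono) (auto intro: sum_nonneg)
    also have "\<dots> < (L + 1) * (e / (L + 1))"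
      using small[of d] d L by (intro mult_strict_left_mono) auto
    also have "\<dots> = e" using L by simp
    finally show "(\<Sum>k\<in>d. norm (f (x (Sup k)) - f (x (Inf k)))) < e" .
  qed
qed

lemma abs_cont_on_imp_continuous_on:
  fixes x :: "real \<Rightarrow> 'a::euclidean_space"
  assumes x: "abs_cont_on a b x"
  shows "continuous_on {a..b} x"
  unfolding continuous_on_iff
proof (intro ballI allI impI)
  fix t e :: real assume t: "t \<in> {a..b}" and e: "e > 0"
  obtain \<delta> where \<delta>: "\<delta> > 0" and small0: "\<forall>d. d division_of \<Union>d \<and> \<Union>d \<subseteq> {a..b} \<and>
      (\<Sum>K\<in>d. Sup K - Inf K) < \<delta> \<longrightarrow> (\<Sum>K\<in>d. norm (x (Sup K) - x (Inf K))) < e"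
    using x e unfolding abs_cont_on_def by blast
  have small: "(\<Sum>K\<in>d. norm (x (Sup K) - x (Inf K))) < e"
    if "d division_of \<Union>d" "\<Union>d \<subseteq> {a..b}" "(\<Sum>K\<in>d. Sup K - Inf K) < \<delta>" for d
    using small0 that by blast
  have *: "norm (x v - x u) < e" if "u \<le> v" "u \<in> {a..b}" "v \<in> {a..b}" "v - u < \<delta>" for u v
  proof -
    have "{{u..v}} division_of \<Union>{{u..v}}"
      using that division_of_self[of u v] by simp
    then show ?thesis
      using small[of "{{u..v}}"] that by auto
  qed
  show "\<exists>d>0. \<forall>s\<in>{a..b}. dist s t < d \<longrightarrow> dist (x s) (x t) < e"
  proof (intro exI[of _ \<delta>] conjI ballI impI \<delta>)
    fix s assume s: "s \<in> {a..b}" "dist s t < \<delta>"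
    show "dist (x s) (x t) < e"
    proof (cases "s \<le> t")
      case True
      then show ?thesis
        using *[of s t] s t by (simp add: dist_norm norm_minus_commute)
    next
      case False
      then show ?thesis
        using *[of t s] s t by (simp add: dist_norm)
    qed
  qed
qed

lemma lipschitz_on_imp_abs_cont_on:
  fixes x :: "real \<Rightarrow> 'a::euclidean_space"
  assumes "L-lipschitz_on {a..b} x"
  shows "abs_cont_on a b x"
proof -
  have "abs_cont_on a b (\<lambda>t::real. t)"
    unfolding abs_cont_on_def
  proof (intro allI impI)
    fix e :: real assume "e > 0"
    show "\<exists>\<delta>>0. \<forall>d. d division_of \<Union>d \<and> \<Union>d \<subseteq> {a..b} \<and> (\<Sum>k\<in>d. Sup k - Inf k) < \<delta>
        \<longrightarrow> (\<Sum>k\<in>d. norm (Sup k - Inf k)) < e"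
    proof (intro exI[of _ e] conjI allI impI \<open>e > 0\<close>)
      fix d :: "real set set"
      assume d: "d division_of \<Union>d \<and> \<Union>d \<subseteq> {a..b} \<and> (\<Sum>k\<in>d. Sup k - Inf k) < e"
      have "(\<Sum>k\<in>d. norm (Sup k - Inf k)) = (\<Sum>k\<in>d. Sup k - Inf k)"
      proof (rule sum.cong)
        fix k assume "k \<in> d"
        then obtain u v where "k = {u..v}" "u \<le> v"
          using d by (metis box_real(2) division_ofD(3,4) atLeastatMost_empty_iff2)
        then show "norm (Sup k - Inf k) = Sup k - Inf k" by simp
      qed simp
      then show "(\<Sum>k\<in>d. norm (Sup k - Inf k)) < e" using d by simp
    qed
  qed
  from abs_cont_on_lipschitz_compose[OF this, of L x] assms show ?thesis by simp
qed

section \<open>Existence of Filippov trajectories\<close>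

text \<open>
  The mean velocity of an Euler scheme over several steps is a convex combination of the
  velocities used in these steps.
\<close>

lemma euler_increment:
  fixes e w :: "nat \<Rightarrow> 'a::euclidean_space"
  assumes step: "\<And>i. e (Suc i) = e i + h *\<^sub>R w i"
    and C: "convex C" "\<And>i. k \<le> i \<Longrightarrow> i < l \<Longrightarrow> w i \<in> C" and kl: "k < l"
  shows "\<exists>c\<in>C. e l - e k = ((real l - real k) * h) *\<^sub>R c"
proof -
  have inc: "e l - e k = (\<Sum>i=k..<l. h *\<^sub>R w i)"
    using sum_Suc_diff'[of k l e] kl by (simp add: step)
  define c where "c = (\<Sum>i=k..<l. (1 / (real l - real k)) *\<^sub>R w i)"
  have "c \<in> C"
    unfolding c_def by (rule convex_sum) (use kl C in \<open>auto simp: of_nat_diff\<close>)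
  moreover have "e l - e k = ((real l - real k) * h) *\<^sub>R c"
    using kl by (simp add: inc c_def scaleR_sum_right)
  ultimately show ?thesis by blast
qed

text \<open>
  This is why an Euler scheme that samples the field at points of continuity produces Filippov
  velocities: the sampled values cannot be removed by discarding a null set.
\<close>

lemma isCont_value_in_closure_image:
  fixes F :: "'a::euclidean_space \<Rightarrow> 'b::euclidean_space"
  assumes "isCont F y" "open U" "y \<in> U" "negligible N"
  shows "F y \<in> closure (F ` (U - N))"
proof (subst closure_approachable, intro allI impI)
  fix e :: real assume "e > 0"
  then obtain d where d: "d > 0" "\<And>z. dist z y < d \<Longrightarrow> dist (F z) (F y) < e"
    using assms(1) unfolding continuous_at_eps_delta by blast
  have "open (ball y d \<inter> U)" "y \<in> ball y d \<inter> U"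
    using assms d by auto
  then have "\<not> negligible (ball y d \<inter> U)"
    using open_not_negligible by blast
  then obtain z where "z \<in> ball y d \<inter> U" "z \<notin> N"
    using assms(4) by (meson negligible_subset subsetI)
  then show "\<exists>v\<in>F ` (U - N). dist v (F y) < e"
    using d(2)[of z] by (auto simp: dist_commute)
qed

lemma lipschitz_AE_differentiable:
  fixes f :: "real \<Rightarrow> 'a::euclidean_space"
  assumes "L-lipschitz_on UNIV f"
  shows "negligible {t. \<not> f differentiable (at t)}"
proof -
  have "negligible (\<Union>b\<in>Basis. {t. \<not> (\<lambda>t. f t \<bullet> b) differentiable (at t)})"
  proof (intro negligible_Union finite_imageI finite_Basis, clarify)
    fix b :: 'a assume b: "b \<in> Basis"
    have "L-lipschitz_on UNIV (\<lambda>t. f t \<bullet> b)"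
    proof (rule lipschitz_onI)
      fix s t
      have "dist (f s \<bullet> b) (f t \<bullet> b) \<le> dist (f s) (f t)"
        using Basis_le_norm[OF b, of "f s - f t"] by (simp add: dist_norm inner_diff_left)
      then show "dist (f s \<bullet> b) (f t \<bullet> b) \<le> L * dist s t"
        using lipschitz_onD[OF assms, of s t] by simp
    qed (use assms lipschitz_on_nonneg in blast)
    then show "negligible {t. \<not> (\<lambda>t. f t \<bullet> b) differentiable (at t)}"
      by (rule lipschitz_AE_differentiable_real)
  qed
  moreover have "{t. \<not> f differentiable (at t)} \<subseteq> (\<Union>b\<in>Basis. {t. \<not> (\<lambda>t. f t \<bullet> b) differentiable (at t)})"
    using differentiable_componentwise_within[of f _ UNIV] by auto
  ultimately show ?thesis
    by (rule negligible_subset)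
qed

text \<open>
  Euler schemes with step \<open>h n\<close> take their velocities at points of continuity within \<open>h n\<close> of the
  current node. By Tychonoff's theorem the resulting step functions have a cluster point \<open>x\<close> for
  pointwise convergence; it is locally Lipschitz, hence differentiable almost everywhere. Its
  difference quotients near a time \<open>t\<close> are limits of mean velocities, so they belong to every closed
  convex set that contains the field near \<open>x t\<close> off a null set. Therefore each derivative of \<open>x\<close>
  is a Filippov velocity, and no weak convergence of the derivatives is involved.
\<close>

lemma filippov_existence:
  fixes F :: "'a::euclidean_space \<Rightarrow> 'a"
  assumes growth: "\<And>z. norm (F z) \<le> K * (1 + norm z)"
    and null: "negligible {z. \<not> isCont F z}"
  obtains x where "trajectory F x" "x 0 = z0"
proof -
  have K: "K \<ge> 0"
    using order_trans[OF norm_ge_zero growth[of 0]] by simp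
  define h :: "nat \<Rightarrow> real" where "h n = inverse (real (Suc n))" for n
  have h: "0 < h n" "h n \<le> 1" for n by (auto simp: h_def field_simps)
  have h_small: "eventually (\<lambda>n. h n < \<epsilon>) sequentially" if "\<epsilon> > 0" for \<epsilon>
    using LIMSEQ_inverse_real_of_nat order_tendstoD(2)[of h 0 sequentially \<epsilon>] that unfolding h_def by blast
  have "\<exists>y. dist z y < h n \<and> isCont F y" for n z
  proof -
    have "\<not> negligible (ball z (h n))"
      using h[of n] by (intro open_not_negligible) auto
    then obtain y where "y \<in> ball z (h n)" "y \<notin> {z. \<not> isCont F z}"
      using null by (meson negligible_subset subsetI)
    then show ?thesis by auto
  qed
  then have "\<forall>n z. \<exists>y. dist z y < h n \<and> isCont F y" by blast
  then obtain Y where "\<forall>n z. dist z (Y n z) < h n \<and> isCont F (Y n z)"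
    unfolding choice_iff by blast
  then have Y: "dist z (Y n z) < h n" "isCont F (Y n z)" for n z by auto
  define e where "e n = rec_nat z0 (\<lambda>k z. z + h n *\<^sub>R F (Y n z))" for n
  define w where "w n k = F (Y n (e n k))" for n k
  have e0: "e n 0 = z0" and eS: "e n (Suc k) = e n k + h n *\<^sub>R w n k" for n k
    by (auto simp: e_def w_def)
  have w_le: "norm (w n k) \<le> K * (2 + norm (e n k))" for n k
  proof -
    have "norm (Y n (e n k)) \<le> norm (e n k) + dist (e n k) (Y n (e n k))"
      by norm
    also have "\<dots> \<le> norm (e n k) + 1"
      using Y(1)[of "e n k" n] h(2)[of n] by simp
    finally show ?thesis
      using order_trans[OF growth[of "Y n (e n k)"] mult_left_mono[OF _ K]] unfolding w_def by auto
  qed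
  \<comment> \<open>A discrete Gronwall bound for the Euler nodes, uniform in the step size.\<close>
  define R where "R T = (2 + norm z0) * exp (K * \<bar>T\<bar>)" for T
  have Rpos: "R T > 0" for T by (auto simp: R_def add_pos_nonneg)
  have Rmono: "R S \<le> R T" if "0 \<le> S" "S \<le> T" for S T
    using that K by (auto simp: R_def intro!: mult_left_mono)
  have e_le: "2 + norm (e n k) \<le> R (real k * h n)" for n k
  proof (induction k)
    case (Suc k)
    have "2 + norm (e n (Suc k)) \<le> 2 + norm (e n k) + h n * norm (w n k)"
      using norm_triangle_ineq[of "e n k" "h n *\<^sub>R w n k"] h[of n] by (simp add: eS)
    also have "\<dots> \<le> 2 + norm (e n k) + h n * (K * (2 + norm (e n k)))"
      using h[of n] w_le by (intro add_left_mono mult_left_mono) auto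
    also have "\<dots> = (2 + norm (e n k)) * (1 + K * h n)"
      by (simp add: algebra_simps)
    also have "\<dots> \<le> R (real k * h n) * exp (K * h n)"
      using Suc h[of n] K exp_ge_add_one_self[of "K * h n"] Rpos
      by (intro mult_mono) (auto intro: less_imp_le)
    also have "\<dots> = R (real (Suc k) * h n)"
      using h[of n] by (simp add: R_def exp_add[symmetric] algebra_simps abs_mult)
    finally show ?case .
  qed (simp add: e0 R_def)
  define k where "k n t = nat \<lfloor>t / h n\<rfloor>" for n t
  have k_bds: "real (k n t) * h n \<le> t" "t < real (k n t) * h n + h n" if "t \<ge> 0" for n t
  proof -
    have "real (k n t) = of_int \<lfloor>t / h n\<rfloor>"
      using that h[of n] by (simp add: k_def)
    then have "real (k n t) \<le> t / h n" "t / h n < real (k n t) + 1"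
      by linarith+
    then show "real (k n t) * h n \<le> t" "t < real (k n t) * h n + h n"
      using h[of n] by (auto simp: field_simps)
  qed
  have k_mono: "k n s \<le> k n t" if "s \<le> t" for n s t
    unfolding k_def using h[of n] that by (intro nat_mono floor_mono divide_right_mono) auto
  have k0: "k n t = 0" if "t \<le> 0" for n t
    unfolding k_def using h[of n] that by (simp add: divide_nonpos_pos floor_le_zero le_floor_iff)
  define X where "X n t = e n (k n t)" for n t
  have X_in: "norm (X n t) \<le> R t" for n t
  proof (cases "t \<ge> 0")
    case True
    have "2 + norm (e n (k n t)) \<le> R t"
      using e_le[of n "k n t"] Rmono[OF _ k_bds(1)[OF True, of n]] h(1)[of n] by simp
    then show ?thesis by (simp add: X_def)
  next
    case False
    then have "norm (X n t) \<le> R 0" by (simp add: X_def k0 e0 R_def)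
    also have "\<dots> \<le> R t"
      unfolding R_def using K by (intro mult_left_mono) auto
    finally show ?thesis .
  qed
  have w_in: "norm (w n i) \<le> K * R T" if "i < k n T" "T \<ge> 0" for n i T
  proof -
    have "real i * h n \<le> real (k n T) * h n"
      using that h[of n] by (intro mult_right_mono) auto
    then have "real i * h n \<le> T"
      using k_bds(1)[OF that(2), of n] by simp
    then have "R (real i * h n) \<le> R T"
      using h(1)[of n] by (intro Rmono) auto
    then show ?thesis
      using order_trans[OF w_le[of n i] mult_left_mono[OF order_trans[OF e_le[of n i]] K]] by blast
  qed
  have X_inc: "\<exists>c\<in>C. e n i - X n s = ((real i - real (k n s)) * h n) *\<^sub>R c"
    if "convex C" "\<And>j. k n s \<le> j \<Longrightarrow> j < i \<Longrightarrow> w n j \<in> C" "k n s < i" for C n s i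
    unfolding X_def using that by (intro euler_increment[where w = "w n"]) (auto simp: eS)
  have e_lip: "norm (e n i - X n s) \<le> K * R T * (t - s + h n)"
    if "0 \<le> s" "s \<le> t" "t \<le> T" "k n s \<le> i" "i \<le> k n t" for n i s t T
  proof (cases "k n s = i")
    case True
    then show ?thesis
      using that K Rpos[of T] h(1)[of n] by (simp add: X_def)
  next
    case False
    have "\<exists>c\<in>cball 0 (K * R T). e n i - X n s = ((real i - real (k n s)) * h n) *\<^sub>R c"
    proof (rule X_inc)
      fix j assume j: "k n s \<le> j" "j < i"
      then have "j < k n T" using that k_mono[of t T n] by linarith
      then show "w n j \<in> cball 0 (K * R T)" using w_in[of j n T] that by simp
    qed (use False that in auto)
    then obtain c where c: "norm c \<le> K * R T" "e n i - X n s = ((real i - real (k n s)) * h n) *\<^sub>R c"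
      by auto
    have "(real i - real (k n s)) * h n \<le> t - s + h n"
    proof -
      have "real i * h n \<le> real (k n t) * h n"
        using that h(1)[of n] by (intro mult_right_mono) auto
      then show ?thesis
        using k_bds(1)[of t n] k_bds(2)[of s n] that by (simp add: algebra_simps)
    qed
    moreover have "0 \<le> (real i - real (k n s)) * h n"
      using that h(1)[of n] by simp
    ultimately have "norm (e n i - X n s) \<le> (t - s + h n) * (K * R T)"
      unfolding c(2) norm_scaleR using c(1) by (intro mult_mono) auto
    then show ?thesis by (simp add: mult.commute)
  qed

  have comp: "compact {f :: real \<Rightarrow> 'a. \<forall>t. f t \<in> cball 0 (R t)}"
  proof -
    have "compactin (product_topology (\<lambda>t::real. euclidean :: 'a topology) UNIV) (PiE UNIV (\<lambda>t. cball 0 (R t)))"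
      by (simp add: compactin_PiE)
    moreover have "PiE UNIV (\<lambda>t. cball 0 (R t)) = {f :: real \<Rightarrow> 'a. \<forall>t. f t \<in> cball 0 (R t)}"
      by (auto simp: PiE_UNIV_domain)
    ultimately show ?thesis
      by (simp add: euclidean_product_topology)
  qed
  have "\<exists>x\<in>{f :: real \<Rightarrow> 'a. \<forall>t. f t \<in> cball 0 (R t)}. inf (nhds x) (filtermap X sequentially) \<noteq> bot"
  proof -
    have "filtermap X sequentially \<noteq> bot"
      by (simp add: filtermap_bot_iff)
    moreover have "eventually (\<lambda>f. f \<in> {f :: real \<Rightarrow> 'a. \<forall>t. f t \<in> cball 0 (R t)}) (filtermap X sequentially)"
      using X_in by (simp add: eventually_filtermap)
    ultimately show ?thesis
      using comp unfolding compact_filter by blast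
  qed
  then obtain x where x: "inf (nhds x) (filtermap X sequentially) \<noteq> bot"
    by blast
  \<comment> \<open>A cluster point is approached at two given times simultaneously; two times suffice for difference quotients.\<close>
  have approx: "\<exists>n. h n < \<epsilon> \<and> dist (X n s) (x s) < \<epsilon> \<and> dist (X n t) (x t) < \<epsilon>" if \<epsilon>: "\<epsilon> > 0" for s t \<epsilon>
  proof -
    let ?O = "{f :: real \<Rightarrow> 'a. dist (f s) (x s) < \<epsilon> \<and> dist (f t) (x t) < \<epsilon>}"
    have "open ?O"
      by (intro open_Collect_conj open_Collect_less continuous_intros continuous_on_product_coordinates)
    then have "eventually (\<lambda>f. f \<in> ?O) (inf (nhds x) (filtermap X sequentially))"
      using \<epsilon> by (intro filter_leD[OF inf_le1]) (auto simp: eventually_nhds)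
    moreover have "eventually (\<lambda>f. \<exists>n. f = X n \<and> h n < \<epsilon>) (inf (nhds x) (filtermap X sequentially))"
      using h_small[OF \<epsilon>] by (intro filter_leD[OF inf_le2]) (auto simp: eventually_filtermap elim: eventually_mono)
    ultimately have "eventually (\<lambda>f. f \<in> ?O \<and> (\<exists>n. f = X n \<and> h n < \<epsilon>)) (inf (nhds x) (filtermap X sequentially))"
      by (rule eventually_conj)
    then show ?thesis
      using eventually_happens'[OF x] by blast
  qed
  have x0: "x 0 = z0"
  proof -
    have "dist z0 (x 0) < \<epsilon>" if "\<epsilon> > 0" for \<epsilon>
      using approx[OF that, of 0 0] by (auto simp: X_def k0 e0)
    then show ?thesis by (metis dist_pos_lt less_irrefl)
  qed
  have lip: "(K * R T)-lipschitz_on {0..T} x" for T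
  proof (rule lipschitz_onI)
    have *: "dist (x s) (x t) \<le> K * R T * (t - s)" if "0 \<le> s" "s \<le> t" "t \<le> T" for s t
    proof (rule field_le_epsilon)
      fix e :: real assume e: "e > 0"
      define \<epsilon> where "\<epsilon> = e / (K * R T + 2)"
      have pos: "K * R T + 2 > 0" using K Rpos[of T] by (simp add: add_nonneg_pos)
      then have "\<epsilon> > 0" using e by (simp add: \<epsilon>_def)
      then obtain n where n: "h n < \<epsilon>" "dist (X n s) (x s) < \<epsilon>" "dist (X n t) (x t) < \<epsilon>"
        using approx by blast
      have "dist (X n s) (X n t) \<le> K * R T * (t - s + h n)"
        using e_lip[OF that k_mono[OF that(2)] order_refl, of n] by (simp add: X_def dist_norm norm_minus_commute)
      also have "\<dots> \<le> K * R T * (t - s) + K * R T * \<epsilon>"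
        using K Rpos[of T] n by (simp add: distrib_left mult_left_mono)
      finally have "dist (x s) (x t) \<le> K * R T * (t - s) + K * R T * \<epsilon> + 2 * \<epsilon>"
        using n dist_triangle[of "x s" "x t" "X n s"] dist_triangle[of "X n s" "x t" "X n t"]
        by (simp add: dist_commute)
      also have "\<dots> = K * R T * (t - s) + \<epsilon> * (K * R T + 2)"
        by (simp add: algebra_simps)
      also have "\<dots> = K * R T * (t - s) + e"
        using pos by (simp add: \<epsilon>_def)
      finally show "dist (x s) (x t) \<le> K * R T * (t - s) + e" .
    qed
    fix s t assume "s \<in> {0..T}" "t \<in> {0..T}"
    then show "dist (x s) (x t) \<le> K * R T * dist s t"
      using *[of s t] *[of t s] by (cases "s \<le> t") (auto simp: dist_real_def dist_commute)
  qed (use K Rpos[of T] in simp)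

  have deriv_in: "v \<in> filippov F (x t)" if t: "t > 0" and v: "(x has_vector_derivative v) (at t)" for t v
    unfolding filippov_def
  proof (intro InterI, clarify)
    fix \<delta> :: real and N :: "'a set"
    assume \<delta>: "\<delta> > 0" and N: "negligible N"
    define C where "C = closure (convex hull (F ` (ball (x t) \<delta> - N)))"
    have C: "closed C" "convex C" by (auto simp: C_def convex_closure)
    define L where "L = K * R (t + 1)"
    have L: "L \<ge> 0" using K Rpos[of "t + 1"] by (simp add: L_def)
    have cancel: "c * (a / (2 * c)) = a / 2" "c * (a / c) = a" if "c > 0" for a c :: real
      using that by auto
    define \<eta> where "\<eta> = min 1 (\<delta> / (2 * (L + 1)))"
    have \<eta>: "\<eta> > 0" "\<eta> \<le> 1" "L * \<eta> \<le> \<delta> / 2"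
    proof -
      show "\<eta> > 0" "\<eta> \<le> 1" using \<delta> L by (auto simp: \<eta>_def)
      have "L * \<eta> \<le> (L + 1) * (\<delta> / (2 * (L + 1)))"
        using L \<open>\<eta> > 0\<close> by (intro mult_mono) (auto simp: \<eta>_def)
      also have "\<dots> = \<delta> / 2"
        by (rule cancel) (use L in simp)
      finally show "L * \<eta> \<le> \<delta> / 2" .
    qed
    have quot: "(1 / (s - t)) *\<^sub>R (x s - x t) \<in> C" if s: "t < s" "s < t + \<eta>" for s
    proof -
      have "\<exists>c\<in>C. dist c ((1 / (s - t)) *\<^sub>R (x s - x t)) < \<epsilon>'" if \<epsilon>': "\<epsilon>' > 0" for \<epsilon>'
      proof -
        \<comment> \<open>Of the three bounds, the first leaves room for an Euler step between \<open>t\<close> and \<open>s\<close>, the second keeps the sampled points in the ball, and the third controls the difference quotient.\<close>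
        define \<epsilon> where "\<epsilon> = min (s - t) (min (\<delta> / (2 * (L + 2))) (\<epsilon>' * (s - t) / (L + 2)))"
        have \<epsilon>: "\<epsilon> > 0" "\<epsilon> \<le> s - t" "(L + 2) * \<epsilon> \<le> \<delta> / 2" "(L + 2) * \<epsilon> \<le> \<epsilon>' * (s - t)"
        proof -
          show pos: "\<epsilon> > 0" "\<epsilon> \<le> s - t" using L \<delta> \<epsilon>' s by (auto simp: \<epsilon>_def)
          have "(L + 2) * \<epsilon> \<le> (L + 2) * (\<delta> / (2 * (L + 2)))"
            using L by (intro mult_left_mono) (auto simp: \<epsilon>_def)
          also have "\<dots> = \<delta> / 2"
            by (rule cancel) (use L in simp)
          finally show "(L + 2) * \<epsilon> \<le> \<delta> / 2" .
          have "(L + 2) * \<epsilon> \<le> (L + 2) * (\<epsilon>' * (s - t) / (L + 2))"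
            using L by (intro mult_left_mono) (auto simp: \<epsilon>_def)
          also have "\<dots> = \<epsilon>' * (s - t)"
            by (rule cancel) (use L in simp)
          finally show "(L + 2) * \<epsilon> \<le> \<epsilon>' * (s - t)" .
        qed
        obtain n where n: "h n < \<epsilon>" "dist (X n s) (x s) < \<epsilon>" "dist (X n t) (x t) < \<epsilon>"
          using approx[OF \<epsilon>(1)] by blast
        have kts: "k n t < k n s"
        proof (rule ccontr)
          assume "\<not> k n t < k n s"
          then have "k n s = k n t" using k_mono[of t s n] s by simp
          then show False
            using k_bds(2)[of s n] k_bds(1)[of t n] n(1) \<epsilon>(2) s t by simp
        qed
        have "\<exists>c\<in>C \<inter> cball 0 L. e n (k n s) - X n t = ((real (k n s) - real (k n t)) * h n) *\<^sub>R c"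
        proof (rule X_inc)
          fix i assume i: "k n t \<le> i" "i < k n s"
          have "norm (w n i) \<le> L"
            unfolding L_def using i k_mono[of s "t + 1" n] s \<eta> t by (intro w_in) auto
          moreover have "w n i \<in> C"
          proof -
            have "norm (e n i - X n t) \<le> L * (s - t + h n)"
              unfolding L_def using s \<eta> t i by (intro e_lip) auto
            also have "\<dots> \<le> L * \<eta> + L * \<epsilon>"
              using L s n by (simp add: distrib_left[symmetric] mult_left_mono)
            finally have "dist (x t) (Y n (e n i)) < L * \<eta> + L * \<epsilon> + 2 * \<epsilon>"
              using n Y(1)[of "e n i" n] dist_triangle[of "x t" "Y n (e n i)" "X n t"]
                dist_triangle[of "X n t" "Y n (e n i)" "e n i"]
              by (simp add: dist_norm norm_minus_commute)
            also have "\<dots> \<le> \<delta>"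
              using \<eta>(3) \<epsilon>(3) by (simp add: algebra_simps)
            finally have "Y n (e n i) \<in> ball (x t) \<delta>" by simp
            then have "F (Y n (e n i)) \<in> closure (F ` (ball (x t) \<delta> - N))"
              by (intro isCont_value_in_closure_image Y(2) N) auto
            also have "\<dots> \<subseteq> C"
              unfolding C_def by (intro closure_mono hull_subset)
            finally show ?thesis by (simp add: w_def)
          qed
          ultimately show "w n i \<in> C \<inter> cball 0 L" by simp
        qed (use C kts in \<open>auto intro: convex_Int\<close>)
        then obtain c where c: "c \<in> C" "norm c \<le> L"
          and eq: "X n s - X n t = ((real (k n s) - real (k n t)) * h n) *\<^sub>R c"
          by (auto simp: X_def)
        have "norm (((real (k n s) - real (k n t)) * h n) *\<^sub>R c - (s - t) *\<^sub>R c) \<le> h n * L"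
        proof -
          have "\<bar>(real (k n s) - real (k n t)) * h n - (s - t)\<bar> \<le> h n"
            using k_bds[of s n] k_bds[of t n] s t by (simp add: algebra_simps abs_le_iff)
          then have "\<bar>(real (k n s) - real (k n t)) * h n - (s - t)\<bar> * norm c \<le> h n * L"
            using c h[of n] by (intro mult_mono) auto
          then show ?thesis by (simp flip: scaleR_diff_left)
        qed
        moreover have "x s - x t - (s - t) *\<^sub>R c =
            (((real (k n s) - real (k n t)) * h n) *\<^sub>R c - (s - t) *\<^sub>R c) + ((x s - X n s) + (X n t - x t))"
          unfolding eq[symmetric] by simp
        ultimately have "norm (x s - x t - (s - t) *\<^sub>R c) \<le> h n * L + (dist (X n s) (x s) + dist (X n t) (x t))"
          by (metis (no_types, lifting) add_mono dist_norm dist_commute norm_triangle_mono order_refl)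
        also have "\<dots> < (L + 2) * \<epsilon>"
        proof -
          have "h n * L \<le> \<epsilon> * L" using n L by (intro mult_right_mono) auto
          then show ?thesis using n by (simp add: algebra_simps)
        qed
        finally have "norm (x s - x t - (s - t) *\<^sub>R c) < \<epsilon>' * (s - t)"
          using \<epsilon>(4) by simp
        then have less: "norm (x s - x t - (s - t) *\<^sub>R c) / (s - t) < \<epsilon>'"
          using s by (simp add: divide_less_eq)
        have "c - (1 / (s - t)) *\<^sub>R (x s - x t) = - (1 / (s - t)) *\<^sub>R (x s - x t - (s - t) *\<^sub>R c)"
          using s by (simp add: scaleR_diff_right)
        then have "dist c ((1 / (s - t)) *\<^sub>R (x s - x t)) = norm (x s - x t - (s - t) *\<^sub>R c) / (s - t)"
          using s by (simp only: dist_norm norm_scaleR) simp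
        with less have "dist c ((1 / (s - t)) *\<^sub>R (x s - x t)) < \<epsilon>'" by simp
        then show ?thesis using c(1) by blast
      qed
      then show ?thesis
        using C(1) by (metis closed_approachable)
    qed
    have "\<exists>q\<in>C. dist q v < \<epsilon>" if \<epsilon>: "\<epsilon> > 0" for \<epsilon>
    proof -
      obtain d where d: "d > 0" "\<And>s. norm (s - t) < d \<Longrightarrow> norm (x s - x t - (s - t) *\<^sub>R v) \<le> \<epsilon> / 2 * norm (s - t)"
        using v half_gt_zero[OF \<epsilon>] unfolding has_vector_derivative_def has_derivative_at_alt by blast
      define s where "s = t + min d \<eta> / 2"
      have s: "t < s" "s < t + \<eta>" "norm (s - t) < d"
        using d(1) \<eta>(1) by (auto simp: s_def)
      have "(1 / (s - t)) *\<^sub>R (x s - x t) - v = (1 / (s - t)) *\<^sub>R (x s - x t - (s - t) *\<^sub>R v)"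
        using s by (simp add: scaleR_diff_right)
      then have "dist ((1 / (s - t)) *\<^sub>R (x s - x t)) v = norm (x s - x t - (s - t) *\<^sub>R v) / (s - t)"
        using s by (simp only: dist_norm norm_scaleR) simp
      also have "\<dots> \<le> \<epsilon> / 2"
        using d(2)[OF s(3)] s by (simp add: divide_le_eq)
      finally have "dist ((1 / (s - t)) *\<^sub>R (x s - x t)) v < \<epsilon>"
        using \<epsilon> by simp
      with quot[OF s(1,2)] show ?thesis by blast
    qed
    then have "v \<in> C"
      using C(1) by (metis closed_approachable)
    then show "v \<in> closure (convex hull (F ` (ball (x t) \<delta> - N)))"
      by (simp add: C_def)
  qed

  \<comment> \<open>Freezing \<open>x\<close> outside \<open>[0, m]\<close> gives globally Lipschitz functions.\<close>
  have null_all: "negligible (\<Union>m::nat. {t. \<not> (\<lambda>s. x (max 0 (min (real m) s))) differentiable (at t)})"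
  proof (intro negligible_countable_Union countableI_type countable_image)
    fix S assume "S \<in> range (\<lambda>m::nat. {t. \<not> (\<lambda>s. x (max 0 (min (real m) s))) differentiable (at t)})"
    then obtain m :: nat where S: "S = {t. \<not> (\<lambda>s. x (max 0 (min (real m) s))) differentiable (at t)}"
      by blast
    have "(K * R m)-lipschitz_on UNIV (\<lambda>s. x (max 0 (min (real m) s)))"
    proof (rule lipschitz_onI)
      fix s t
      have "dist (x (max 0 (min (real m) s))) (x (max 0 (min (real m) t))) \<le>
         K * R m * dist (max 0 (min (real m) s)) (max 0 (min (real m) t))"
        using lip[of "real m"] by (rule lipschitz_onD) auto
      also have "\<dots> \<le> K * R m * dist s t"
        using K Rpos[of m] by (intro mult_left_mono) (auto simp: dist_real_def)
      finally show "dist (x (max 0 (min (real m) s))) (x (max 0 (min (real m) t))) \<le> K * R m * dist s t" .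
    qed (use K Rpos[of m] in simp)
    then show "negligible S"
      unfolding S by (rule lipschitz_AE_differentiable)
  qed
  have "trajectory F x"
    unfolding trajectory_def
  proof (intro conjI allI impI)
    fix T :: real assume "T \<ge> 0"
    show "abs_cont_on 0 T x"
      using lip by (rule lipschitz_on_imp_abs_cont_on)
  next
    let ?M = "insert 0 (\<Union>m::nat. {t. \<not> (\<lambda>s. x (max 0 (min (real m) s))) differentiable (at t)})"
    have "?M \<in> null_sets lebesgue"
      using null_all by (simp add: negligible_iff_null_sets[symmetric])
    then show "AE t in lebesgue. t \<ge> 0 \<longrightarrow> (\<exists>v\<in>filippov F (x t). (x has_vector_derivative v) (at t))"
    proof (rule AE_I')
      show "{t \<in> space lebesgue. \<not> (t \<ge> 0 \<longrightarrow> (\<exists>v\<in>filippov F (x t). (x has_vector_derivative v) (at t)))} \<subseteq> ?M"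
      proof (rule subsetI, rule ccontr)
        fix t
        assume "t \<in> {t \<in> space lebesgue. \<not> (t \<ge> 0 \<longrightarrow> (\<exists>v\<in>filippov F (x t). (x has_vector_derivative v) (at t)))}"
          and M: "t \<notin> ?M"
        then have t: "0 < t" "\<forall>v\<in>filippov F (x t). \<not> (x has_vector_derivative v) (at t)"
          by (auto simp: less_le)
        have diff: "(\<lambda>s. x (max 0 (min (real m) s))) differentiable (at t)" for m :: nat
          using M by blast
        obtain m :: nat where m: "t < real m" using reals_Archimedean2 by blast
        obtain v where "((\<lambda>s. x (max 0 (min (real m) s))) has_vector_derivative v) (at t)"
          using diff[of m] vector_derivative_works by blast
        then have "(x has_vector_derivative v) (at t)"
          by (rule has_vector_derivative_transform_within_open[where S = "{0<..<real m}"]) (use t m in auto)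
        then show False using deriv_in[of t v] t by auto
      qed
    qed
  qed
  with x0 show thesis using that by blast
qed

section \<open>Continuously differentiable functions\<close>

lemma C1_onI:
  assumes "\<And>x. x \<in> S \<Longrightarrow> (f has_derivative blinfun_apply (f' x)) (at x)" "continuous_on S f'"
  shows "C1_on f S"
  using assms unfolding C1_on_def by blast

lemma C1_on_imp_continuous_on:
  assumes "C1_on f S"
  shows "continuous_on S f"
  using assms unfolding C1_on_def by (meson continuous_at_imp_continuous_on has_derivative_continuous)

lemma C1_on_subset:
  assumes "C1_on f S" "T \<subseteq> S"
  shows "C1_on f T"
  using assms unfolding C1_on_def by (meson continuous_on_subset subsetD)

lemma C1_on_blinfun: "C1_on (blinfun_apply l) S"
  by (rule C1_onI[where f' = "\<lambda>_. l"]) (auto intro: bounded_linear_imp_has_derivative blinfun.bounded_linear_right)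

lemma C1_on_bounded_linear: "bounded_linear l \<Longrightarrow> C1_on l S"
  using C1_on_blinfun[of "Blinfun l" S] by (simp add: bounded_linear_Blinfun_apply)

lemma C1_on_add:
  assumes "C1_on f S" "C1_on g S"
  shows "C1_on (\<lambda>x. f x + g x) S"
proof -
  from assms obtain f' g' where *:
    "\<forall>x\<in>S. (f has_derivative blinfun_apply (f' x)) (at x)" "continuous_on S f'"
    "\<forall>x\<in>S. (g has_derivative blinfun_apply (g' x)) (at x)" "continuous_on S g'"
    unfolding C1_on_def by blast
  then show ?thesis
    by (intro C1_onI[where f' = "\<lambda>x. f' x + g' x"])
       (auto intro!: derivative_eq_intros continuous_intros simp: blinfun.add_left plus_blinfun.rep_eq)
qed

lemma C1_on_mult:
  assumes "C1_on f S" "C1_on g S"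
  shows "C1_on (\<lambda>x. f x * g x) S"
proof -
  from assms obtain f' g' where *:
    "\<forall>x\<in>S. (f has_derivative blinfun_apply (f' x)) (at x)" "continuous_on S f'"
    "\<forall>x\<in>S. (g has_derivative blinfun_apply (g' x)) (at x)" "continuous_on S g'"
    unfolding C1_on_def by blast
  show ?thesis
  proof (rule C1_onI[where f' = "\<lambda>x. f x *\<^sub>R g' x + g x *\<^sub>R f' x"])
    show "((\<lambda>x. f x * g x) has_derivative blinfun_apply (f x *\<^sub>R g' x + g x *\<^sub>R f' x)) (at x)" if "x \<in> S" for x
      by (rule has_derivative_eq_rhs[OF has_derivative_mult[OF *(1,3)[rule_format, OF that]]])
         (auto simp: blinfun.add_left blinfun.scaleR_left mult.commute)
    show "continuous_on S (\<lambda>x. f x *\<^sub>R g' x + g x *\<^sub>R f' x)"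
      using * assms[THEN C1_on_imp_continuous_on] by (intro continuous_intros)
  qed
qed

lemma C1_on_const: "C1_on (\<lambda>x. c) S"
  by (rule C1_onI[where f' = "\<lambda>_. 0"]) (auto simp: zero_blinfun.rep_eq)

lemma C1_on_powr:
  assumes "C1_on f S" "\<And>x. x \<in> S \<Longrightarrow> f x > 0"
  shows "C1_on (\<lambda>x. f x powr a) S"
proof -
  from assms obtain f' where f0:
    "\<forall>x\<in>S. (f has_derivative blinfun_apply (f' x)) (at x)" "continuous_on S f'"
    unfolding C1_on_def by blast
  then have f': "\<And>x. x \<in> S \<Longrightarrow> (f has_derivative blinfun_apply (f' x)) (at x)" "continuous_on S f'"
    by auto
  show ?thesis
  proof (rule C1_onI[where f' = "\<lambda>x. (a * f x powr (a - 1)) *\<^sub>R f' x"])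
    fix x assume x: "x \<in> S"
    have "((\<lambda>s. s powr a) has_real_derivative a * f x powr (a - 1)) (at (f x))"
      using assms(2)[OF x] by (rule has_real_derivative_powr)
    from DERIV_compose_FDERIV[OF this f'(1)[OF x]]
    show "((\<lambda>x. f x powr a) has_derivative blinfun_apply ((a * f x powr (a - 1)) *\<^sub>R f' x)) (at x)"
      by (rule has_derivative_eq_rhs) (auto simp: blinfun.scaleR_left mult.commute)
  next
    have "\<forall>x\<in>S. f x \<noteq> 0" using assms(2) by (metis less_irrefl)
    then show "continuous_on S (\<lambda>x. (a * f x powr (a - 1)) *\<^sub>R f' x)"
      using f'(2) C1_on_imp_continuous_on[OF assms(1)] by (intro continuous_intros) auto
  qed
qed

lemma C1_on_lipschitz_near:
  assumes "C1_on f S" "open S" "y \<in> S"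
  obtains e L where "e > 0" "ball y e \<subseteq> S" "L-lipschitz_on (ball y e) f"
proof -
  from assms obtain f' where f0:
    "\<forall>x\<in>S. (f has_derivative blinfun_apply (f' x)) (at x)" "continuous_on S f'"
    unfolding C1_on_def by blast
  then have f': "\<And>x. x \<in> S \<Longrightarrow> (f has_derivative blinfun_apply (f' x)) (at x)" "continuous_on S f'"
    by auto
  have "isCont f' y"
    using f'(2) assms by (simp add: continuous_on_eq_continuous_at)
  then obtain e1 where e1: "e1 > 0" "\<And>z. dist z y < e1 \<Longrightarrow> dist (f' z) (f' y) < 1"
    unfolding continuous_at_eps_delta by (meson zero_less_one)
  obtain e2 where e2: "e2 > 0" "ball y e2 \<subseteq> S"
    using assms openE by blast
  let ?L = "norm (f' y) + 1"
  have "?L-lipschitz_on (ball y (min e1 e2)) f"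
  proof (rule lipschitz_onI)
    fix u v assume uv: "u \<in> ball y (min e1 e2)" "v \<in> ball y (min e1 e2)"
    have "norm (f u - f v) \<le> ?L * norm (u - v)"
    proof (rule differentiable_bound[of "ball y (min e1 e2)" f "\<lambda>z. blinfun_apply (f' z)"])
      fix z assume z: "z \<in> ball y (min e1 e2)"
      then have "z \<in> S" using e2 by auto
      then show "(f has_derivative blinfun_apply (f' z)) (at z within ball y (min e1 e2))"
        using f'(1) has_derivative_at_withinI by blast
      have "dist (f' z) (f' y) < 1" using z by (intro e1) (auto simp: dist_commute)
      then have "norm (f' z) \<le> ?L"
        using norm_triangle_sub[of "f' z" "f' y"] by (simp add: dist_norm)
      then show "onorm (blinfun_apply (f' z)) \<le> ?L"
        by (simp add: norm_blinfun.rep_eq)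
    qed (use uv in auto)
    then show "dist (f u) (f v) \<le> ?L * dist u v" by (simp add: dist_norm)
  qed simp
  then show thesis
    using e1(1) e2 by (intro that[of "min e1 e2" ?L]) auto
qed

section \<open>Functions along trajectories\<close>

lemma trajectoryE:
  assumes "trajectory F x"
  obtains N where "negligible N"
    "\<forall>t. t \<ge> 0 \<and> t \<notin> N \<longrightarrow> (\<exists>v\<in>filippov F (x t). (x has_vector_derivative v) (at t))"
proof -
  from assms obtain N where "N \<in> null_sets lebesgue"
    "{t \<in> space lebesgue. \<not> (t \<ge> 0 \<longrightarrow> (\<exists>v\<in>filippov F (x t). (x has_vector_derivative v) (at t)))} \<subseteq> N"
    unfolding trajectory_def eventually_ae_filter by blast
  then show thesis
    by (intro that[of N]) (auto simp: negligible_iff_null_sets)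
qed

lemma trajectory_continuous_on:
  assumes "trajectory F x"
  shows "continuous_on {0..} x"
  unfolding continuous_on_iff
proof (intro ballI allI impI)
  fix t e :: real assume t: "t \<in> {0..}" and e: "e > 0"
  have "continuous_on {0..t + 1} x"
    using assms t unfolding trajectory_def by (intro abs_cont_on_imp_continuous_on) auto
  then obtain d where d: "d > 0" "\<forall>s\<in>{0..t + 1}. dist s t < d \<longrightarrow> dist (x s) (x t) < e"
    using t e unfolding continuous_on_iff by (metis atLeastAtMost_iff atLeast_iff le_add_same_cancel1 zero_le_one)
  show "\<exists>d>0. \<forall>s\<in>{0..}. dist s t < d \<longrightarrow> dist (x s) (x t) < e"
    using d by (intro exI[of _ "min d 1"]) (auto simp: dist_real_def)
qed

lemma trajectory_near:
  assumes "trajectory F x" "t \<ge> 0" "open U" "x t \<in> U"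
  obtains \<eta> where "\<eta> > 0" "\<And>s. s \<ge> 0 \<Longrightarrow> \<bar>s - t\<bar> < \<eta> \<Longrightarrow> x s \<in> U"
proof -
  obtain e where e: "e > 0" "ball (x t) e \<subseteq> U" using assms openE by blast
  from trajectory_continuous_on[OF assms(1)] assms(2) e(1)
  obtain d where "d > 0" "\<forall>s\<in>{0..}. dist s t < d \<longrightarrow> dist (x s) (x t) < e"
    unfolding continuous_on_iff by (metis atLeast_iff)
  then show thesis
    using e(2) by (intro that[of d]) (auto simp: dist_real_def dist_commute subset_iff)
qed

lemma has_vector_derivative_compose_derivative:
  fixes f :: "'a::euclidean_space \<Rightarrow> real"
  assumes "(x has_vector_derivative v) (at t)" "(f has_derivative f') (at (x t))"
  shows "((\<lambda>t. f (x t)) has_real_derivative f' v) (at t)"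
proof -
  have "((f \<circ> x) has_derivative f' \<circ> (\<lambda>h. h *\<^sub>R v)) (at t)"
    using assms unfolding has_vector_derivative_def by (intro diff_chain_at) auto
  moreover have "f' (h *\<^sub>R v) = f' v * h" for h
    using linear_scale[OF has_derivative_linear[OF assms(2)]] by simp
  ultimately show ?thesis
    by (simp add: has_field_derivative_def o_def)
qed

lemma trajectory_increment_le:
  fixes f :: "'a::euclidean_space \<Rightarrow> real"
  assumes x: "trajectory F x" and ab: "0 \<le> a" "a \<le> b"
    and lip: "L-lipschitz_on (x ` {a..b}) f"
    and deriv: "\<And>t v. a < t \<Longrightarrow> t < b \<Longrightarrow> v \<in> filippov F (x t) \<Longrightarrow>
        \<exists>f'. (f has_derivative f') (at (x t)) \<and> f' v \<le> k"
  shows "f (x b) - f (x a) \<le> k * (b - a)"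
proof -
  obtain N where N: "negligible N"
    "\<forall>t. t \<ge> 0 \<and> t \<notin> N \<longrightarrow> (\<exists>v\<in>filippov F (x t). (x has_vector_derivative v) (at t))"
    using x by (rule trajectoryE)
  have "abs_cont_on 0 b x" using x ab by (auto simp: trajectory_def)
  then have "abs_cont_on a b x" by (rule abs_cont_on_subset) (use ab in auto)
  then have ac: "abs_cont_on a b (\<lambda>t. f (x t))"
    using lip by (rule abs_cont_on_lipschitz_compose)
  show ?thesis
  proof (rule abs_cont_on_imp_real_increment_le[OF ac ab(2) N(1)])
    fix t assume t: "a < t" "t < b" "t \<notin> N"
    then obtain v where v: "v \<in> filippov F (x t)" "(x has_vector_derivative v) (at t)"
      using N(2) ab by (metis less_imp_le order_trans)
    obtain f' where f': "(f has_derivative f') (at (x t))" "f' v \<le> k"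
      using deriv[OF t(1,2) v(1)] by blast
    then show "\<exists>D. ((\<lambda>t. f (x t)) has_real_derivative D) (at t) \<and> D \<le> k"
      using has_vector_derivative_compose_derivative[OF v(2) f'(1)] by blast
  qed
qed

section \<open>Finite-time convergence from a strict Lyapunov function\<close>

text \<open>
  The local hypothesis compares only points on the same side of \<open>\<tau>\<close>, so continuity bridges isolated
  times at which \<open>\<phi>\<close> fails to be differentiable.
\<close>

lemma nonincreasing_if_locally:
  fixes \<phi> :: "real \<Rightarrow> real"
  assumes ab: "a \<le> b" and cont: "continuous_on {a..b} \<phi>"
    and local: "\<And>\<tau>. \<tau> \<in> {a..b} \<Longrightarrow> \<exists>\<eta>>0. \<forall>u v. a \<le> u \<and> u \<le> v \<and> v \<le> b \<and>
        (\<tau> < u \<and> v < \<tau> + \<eta> \<or> \<tau> - \<eta> < u \<and> v < \<tau>) \<longrightarrow> \<phi> v \<le> \<phi> u"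
  shows "\<phi> b \<le> \<phi> a"
proof -
  define P where "P u v \<longleftrightarrow> (a \<le> u \<and> u \<le> v \<and> v \<le> b \<longrightarrow> \<phi> v \<le> \<phi> u)" for u v
  have "P a b"
  proof (rule Bolzano[OF ab, of P])
    fix u v w assume "P u v" "P v w" "u \<le> v" "v \<le> w"
    then show "P u w" unfolding P_def by force
  next
    fix \<tau> assume \<tau>: "a \<le> \<tau>" "\<tau> \<le> b"
    then obtain \<eta> where \<eta>: "\<eta> > 0" "\<And>u v. a \<le> u \<Longrightarrow> u \<le> v \<Longrightarrow> v \<le> b \<Longrightarrow>
        \<tau> < u \<and> v < \<tau> + \<eta> \<or> \<tau> - \<eta> < u \<and> v < \<tau> \<Longrightarrow> \<phi> v \<le> \<phi> u"
      using local[of \<tau>] by auto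
    have right: "\<phi> v \<le> \<phi> \<tau>" if v: "\<tau> < v" "v < \<tau> + \<eta>" "v \<le> b" for v
    proof (rule continuous_ge_on_closure[where S = "{\<tau><..<v}" and f = \<phi>])
      show "continuous_on (closure {\<tau><..<v}) \<phi>"
        using cont v \<tau> by (auto elim: continuous_on_subset)
      show "\<phi> v \<le> \<phi> u" if "u \<in> {\<tau><..<v}" for u
        using that v \<tau> by (intro \<eta>(2)) auto
    qed (use v in auto)
    have left: "\<phi> \<tau> \<le> \<phi> u" if u: "u < \<tau>" "\<tau> - \<eta> < u" "a \<le> u" for u
    proof (rule continuous_le_on_closure[where S = "{u<..<\<tau>}" and f = \<phi>])
      show "continuous_on (closure {u<..<\<tau>}) \<phi>"
        using cont u \<tau> by (auto elim: continuous_on_subset)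
      show "\<phi> v \<le> \<phi> u" if "v \<in> {u<..<\<tau>}" for v
        using that u \<tau> by (intro \<eta>(2)) auto
    qed (use u in auto)
    show "\<exists>d>0. \<forall>u v. u \<le> \<tau> \<and> \<tau> \<le> v \<and> v - u < d \<longrightarrow> P u v"
    proof (intro exI[of _ \<eta>] conjI allI impI)
      fix u v assume uv: "u \<le> \<tau> \<and> \<tau> \<le> v \<and> v - u < \<eta>"
      show "P u v" unfolding P_def
      proof
        assume "a \<le> u \<and> u \<le> v \<and> v \<le> b"
        then have "\<phi> v \<le> \<phi> \<tau>" "\<phi> \<tau> \<le> \<phi> u"
          using right[of v] left[of u] uv by (cases "v = \<tau>"; cases "u = \<tau>"; simp)+
        then show "\<phi> v \<le> \<phi> u" by simp
      qed
    qed (rule \<eta>(1))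
  qed
  then show ?thesis using ab by (simp add: P_def)
qed

text \<open>
  A Lyapunov function that is \<open>C\<^sup>1\<close> on an open set \<open>S\<close> only. The trajectories may meet the
  complement of \<open>S\<close> outside the origin at isolated times.
\<close>

locale strict_lyapunov =
  fixes F :: "'a::euclidean_space \<Rightarrow> 'a" and W :: "'a \<Rightarrow> real" and S :: "'a set" and d \<beta> :: real
  assumes d: "d > 0" and \<beta>: "\<beta> > 0" "\<beta> < 1"
    and W_cont: "continuous_on UNIV W" and W_pd: "positive_definite W"
    and S: "open S" "0 \<notin> S" and W_C1: "C1_on W S"
    and decrease: "\<And>y v W'. y \<in> S \<Longrightarrow> v \<in> filippov F y \<Longrightarrow> (W has_derivative W') (at y) \<Longrightarrow>
        W' v \<le> - d * W y powr \<beta>"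
    and isolated: "\<And>x t. trajectory F x \<Longrightarrow> t \<ge> 0 \<Longrightarrow> x t \<noteq> 0 \<Longrightarrow> x t \<notin> S \<Longrightarrow>
        \<exists>\<eta>>0. \<forall>s\<ge>0. s \<noteq> t \<and> \<bar>s - t\<bar> < \<eta> \<longrightarrow> x s \<in> S"
begin

lemma W_pos: "y \<noteq> 0 \<Longrightarrow> W y > 0" and W_zero: "W 0 = 0" and W_nonneg: "W y \<ge> 0"
  using W_pd unfolding positive_definite_def by (auto, metis less_eq_real_def)

definition rate :: real where "rate = d * (1 - \<beta>)"

definition H :: "'a \<Rightarrow> real" where "H y = W y powr (1 - \<beta>)"

lemma rate_pos: "rate > 0"
  using d \<beta> by (simp add: rate_def)

lemma H_C1: "C1_on H S"
  unfolding H_def using W_C1 by (rule C1_on_powr) (use S W_pos in metis)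

lemma H_pos: "y \<noteq> 0 \<Longrightarrow> H y > 0" and H_zero: "H 0 = 0" and H_nonneg: "H y \<ge> 0"
  using W_pos[of y] by (auto simp: H_def W_zero)

lemma H_cont: "continuous_on UNIV H"
  unfolding H_def using W_cont W_nonneg \<beta> by (intro continuous_on_powr') auto

text \<open>
  The power \<open>W powr (1 - \<beta>)\<close> turns the inequality \<open>dW/dt \<le> - d W powr \<beta>\<close> into a constant rate of
  decrease, which forces the value zero in finite time.
\<close>

lemma H_decrease:
  assumes y: "y \<in> S" and v: "v \<in> filippov F y"
  shows "\<exists>H'. (H has_derivative H') (at y) \<and> H' v \<le> - rate"
proof -
  obtain W' where W': "(W has_derivative W') (at y)"
    using W_C1 y unfolding C1_on_def by blast
  have Wy: "W y > 0" using y S W_pos by metis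
  have "((\<lambda>s. s powr (1 - \<beta>)) has_real_derivative (1 - \<beta>) * W y powr ((1 - \<beta>) - 1)) (at (W y))"
    using Wy by (rule has_real_derivative_powr)
  from DERIV_compose_FDERIV[OF this W']
  have "(H has_derivative (\<lambda>h. W' h * ((1 - \<beta>) * W y powr ((1 - \<beta>) - 1)))) (at y)"
    by (simp add: H_def[abs_def])
  moreover have "W' v * ((1 - \<beta>) * W y powr ((1 - \<beta>) - 1)) \<le> - rate"
  proof -
    have "W' v * ((1 - \<beta>) * W y powr ((1 - \<beta>) - 1)) \<le> (- d * W y powr \<beta>) * ((1 - \<beta>) * W y powr ((1 - \<beta>) - 1))"
      using \<beta> by (intro mult_right_mono decrease[OF y v W']) auto
    also have "\<dots> = - rate * (W y powr \<beta> * W y powr (- \<beta>))"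
      by (simp add: rate_def)
    also have "W y powr \<beta> * W y powr (- \<beta>) = 1"
      using Wy by (simp flip: powr_add)
    finally show ?thesis by simp
  qed
  ultimately show ?thesis by blast
qed

lemma H_decrease_near:
  assumes x: "trajectory F x" and \<tau>: "\<tau> \<ge> 0" "x \<tau> \<in> S"
  shows "\<exists>\<eta>>0. \<forall>u v. 0 \<le> u \<and> u \<le> v \<and> \<tau> - \<eta> < u \<and> v < \<tau> + \<eta> \<longrightarrow>
      H (x v) + rate * v \<le> H (x u) + rate * u"
proof -
  obtain e L where e: "e > 0" "ball (x \<tau>) e \<subseteq> S" "L-lipschitz_on (ball (x \<tau>) e) H"
    using C1_on_lipschitz_near[OF H_C1 S(1) \<tau>(2)] by blast
  obtain \<eta> where \<eta>: "\<eta> > 0" "\<And>s. s \<ge> 0 \<Longrightarrow> \<bar>s - \<tau>\<bar> < \<eta> \<Longrightarrow> x s \<in> ball (x \<tau>) e"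
    using trajectory_near[OF x \<tau>(1), of "ball (x \<tau>) e"] e(1) by auto
  have "H (x v) + rate * v \<le> H (x u) + rate * u"
    if uv: "0 \<le> u \<and> u \<le> v \<and> \<tau> - \<eta> < u \<and> v < \<tau> + \<eta>" for u v
  proof -
    have in_ball: "x s \<in> ball (x \<tau>) e" if "s \<in> {u..v}" for s
      using that uv by (intro \<eta>(2)) auto
    have "H (x v) - H (x u) \<le> - rate * (v - u)"
    proof (rule trajectory_increment_le[OF x])
      show "L-lipschitz_on (x ` {u..v}) H"
        using e(3) in_ball by (auto elim!: lipschitz_on_subset)
      show "\<exists>f'. (H has_derivative f') (at (x t)) \<and> f' w \<le> - rate"
        if "u < t" "t < v" "w \<in> filippov F (x t)" for t w
        using in_ball[of t] that e(2) by (intro H_decrease) auto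
    qed (use uv in auto)
    then show ?thesis by (simp add: algebra_simps)
  qed
  with \<eta>(1) show ?thesis by blast
qed

lemma H_along_continuous:
  assumes x: "trajectory F x" and "0 \<le> a"
  shows "continuous_on {a..b} (\<lambda>t. H (x t) + rate * t)"
proof -
  have "continuous_on {a..b} x"
    using trajectory_continuous_on[OF x] by (rule continuous_on_subset) (use assms in auto)
  then have "continuous_on {a..b} (\<lambda>t. H (x t))"
    using continuous_on_compose2[OF H_cont] by blast
  then show ?thesis by (intro continuous_intros)
qed

lemma H_decrease_in_S:
  assumes x: "trajectory F x" and ab: "0 \<le> a" "a \<le> b" and xS: "\<And>t. t \<in> {a..b} \<Longrightarrow> x t \<in> S"
  shows "H (x b) + rate * b \<le> H (x a) + rate * a"
proof (rule nonincreasing_if_locally[OF ab(2), where \<phi> = "\<lambda>t. H (x t) + rate * t"])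
  show "continuous_on {a..b} (\<lambda>t. H (x t) + rate * t)"
    using x ab(1) by (rule H_along_continuous)
  fix \<tau> assume \<tau>: "\<tau> \<in> {a..b}"
  then obtain \<eta> where \<eta>: "\<eta> > 0" "\<forall>u v. 0 \<le> u \<and> u \<le> v \<and> \<tau> - \<eta> < u \<and> v < \<tau> + \<eta> \<longrightarrow>
      H (x v) + rate * v \<le> H (x u) + rate * u"
    using H_decrease_near[OF x, of \<tau>] xS[of \<tau>] ab by auto
  show "\<exists>\<eta>>0. \<forall>u v. a \<le> u \<and> u \<le> v \<and> v \<le> b \<and>
        (\<tau> < u \<and> v < \<tau> + \<eta> \<or> \<tau> - \<eta> < u \<and> v < \<tau>) \<longrightarrow>
        H (x v) + rate * v \<le> H (x u) + rate * u"
    using \<eta> ab(1) by (intro exI[of _ \<eta>] conjI allI impI) auto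
qed

lemma H_decrease_nonzero:
  assumes x: "trajectory F x" and ab: "0 \<le> a" "a \<le> b" and nz: "\<And>t. t \<in> {a..b} \<Longrightarrow> x t \<noteq> 0"
  shows "H (x b) + rate * b \<le> H (x a) + rate * a"
proof (rule nonincreasing_if_locally[OF ab(2), where \<phi> = "\<lambda>t. H (x t) + rate * t"])
  show "continuous_on {a..b} (\<lambda>t. H (x t) + rate * t)"
    using x ab(1) by (rule H_along_continuous)
  fix \<tau> assume \<tau>: "\<tau> \<in> {a..b}"
  have "\<exists>\<eta>>0. \<forall>s\<ge>0. s \<noteq> \<tau> \<and> \<bar>s - \<tau>\<bar> < \<eta> \<longrightarrow> x s \<in> S"
  proof (cases "x \<tau> \<in> S")
    case True
    then show ?thesis
      using trajectory_near[OF x _ S(1), of \<tau>] \<tau> ab by (metis atLeastAtMost_iff order_trans)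
  next
    case False
    then show ?thesis
      using isolated[OF x _ nz[OF \<tau>]] \<tau> ab by auto
  qed
  then obtain \<eta> where \<eta>: "\<eta> > 0" "\<And>s. s \<ge> 0 \<Longrightarrow> s \<noteq> \<tau> \<Longrightarrow> \<bar>s - \<tau>\<bar> < \<eta> \<Longrightarrow> x s \<in> S"
    by blast
  have "H (x v) + rate * v \<le> H (x u) + rate * u"
    if "a \<le> u \<and> u \<le> v \<and> v \<le> b \<and> (\<tau> < u \<and> v < \<tau> + \<eta> \<or> \<tau> - \<eta> < u \<and> v < \<tau>)" for u v
    using that ab(1) by (intro H_decrease_in_S[OF x] \<eta>(2)) auto
  with \<eta>(1) show "\<exists>\<eta>>0. \<forall>u v. a \<le> u \<and> u \<le> v \<and> v \<le> b \<and>
        (\<tau> < u \<and> v < \<tau> + \<eta> \<or> \<tau> - \<eta> < u \<and> v < \<tau>) \<longrightarrow>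
        H (x v) + rate * v \<le> H (x u) + rate * u"
    by blast
qed

text \<open>
  After the last zero before \<open>t\<close> the function \<open>H\<close> would decrease from the value zero.
\<close>

lemma zero_absorbing:
  assumes x: "trajectory F x" and st: "0 \<le> s" "s \<le> t" and zero: "x s = 0"
  shows "x t = 0"
proof (rule ccontr)
  assume nz: "x t \<noteq> 0"
  define Z where "Z = {u \<in> {s..t}. x u = 0}"
  have contx: "continuous_on {s..t} x"
    using trajectory_continuous_on[OF x] by (rule continuous_on_subset) (use st in auto)
  have "closed Z"
    unfolding Z_def by (rule continuous_closed_preimage_constant[OF contx]) simp
  moreover have "bounded Z"
    by (rule bounded_subset[of "{s..t}"]) (auto simp: Z_def)
  ultimately have comp: "compact Z"
    by (simp add: compact_eq_bounded_closed)
  have "Z \<noteq> {}" using st zero by (auto simp: Z_def)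
  then obtain r where r: "r \<in> Z" "\<And>u. u \<in> Z \<Longrightarrow> u \<le> r"
    using compact_attains_sup[OF comp] by blast
  then have r': "s \<le> r" "r < t" "x r = 0"
    using nz by (auto simp: Z_def less_le)
  have "H (x t) + rate * t \<le> H (x r) + rate * r"
  proof (rule continuous_ge_on_closure[where S = "{r<..<t}" and f = "\<lambda>u. H (x u) + rate * u"])
    show "continuous_on (closure {r<..<t}) (\<lambda>u. H (x u) + rate * u)"
      using H_along_continuous[OF x, of r t] r' st by simp
    show "r \<in> closure {r<..<t}" using r' by simp
    fix u assume u: "u \<in> {r<..<t}"
    show "H (x t) + rate * t \<le> H (x u) + rate * u"
    proof (rule H_decrease_nonzero[OF x])
      fix w assume w: "w \<in> {u..t}"
      show "x w \<noteq> 0"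
      proof
        assume "x w = 0"
        then have "w \<in> Z" using w u r' by (auto simp: Z_def)
        then show False using r(2)[of w] w u by auto
      qed
    qed (use u r' st in auto)
  qed
  then have "H (x t) \<le> rate * (r - t)"
    using r' by (simp add: H_zero algebra_simps)
  also have "\<dots> < 0" using rate_pos r' by (simp add: mult_pos_neg)
  finally show False using H_nonneg[of "x t"] by simp
qed

lemma H_bound:
  assumes x: "trajectory F x" and t: "0 \<le> t" and nz: "x t \<noteq> 0"
  shows "H (x t) + rate * t \<le> H (x 0)"
proof -
  have "x s \<noteq> 0" if "s \<in> {0..t}" for s
    using zero_absorbing[OF x, of s t] that nz by auto
  from H_decrease_nonzero[OF x order_refl t this] show ?thesis by simp
qed

text \<open>
  Stability: a trajectory that leaves the ball of radius \<open>e\<close> crosses its boundary sphere, where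
  \<open>W\<close> is bounded below by a positive constant, whereas \<open>W\<close> does not increase.
\<close>

lemma finite_time_stable: "finite_time_stable (trajectory F)"
  unfolding finite_time_stable_def lyapunov_stable_def
proof (intro conjI allI impI)
  fix e :: real assume e: "e > 0"
  have "\<exists>m>0. \<forall>y. norm y = e \<longrightarrow> W y \<ge> m"
  proof (cases "sphere (0::'a) e = {}")
    case True
    then have "norm y \<noteq> e" for y :: 'a by (auto simp: sphere_def dist_norm)
    then show ?thesis using zero_less_one by blast
  next
    case False
    have "continuous_on (sphere (0::'a) e) W"
      using W_cont continuous_on_subset by blast
    then obtain y where y: "y \<in> sphere 0 e" "\<And>z. z \<in> sphere 0 e \<Longrightarrow> W y \<le> W z"
      using continuous_attains_inf[OF compact_sphere False] by blast
    then have "W y > 0" using e by (intro W_pos) auto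
    with y(2) show ?thesis by (intro exI[of _ "W y"]) auto
  qed
  then obtain m where m: "m > 0" "\<And>y. norm y = e \<Longrightarrow> W y \<ge> m" by blast
  have "isCont W 0" using W_cont by (simp add: continuous_on_eq_continuous_at)
  then obtain \<delta> where \<delta>: "\<delta> > 0" "\<And>y. dist y 0 < \<delta> \<Longrightarrow> dist (W y) (W 0) < m"
    using m(1) unfolding continuous_at_eps_delta by blast
  show "\<exists>\<delta>>0. \<forall>x. trajectory F x \<and> norm (x 0) < \<delta> \<longrightarrow> (\<forall>t\<ge>0. norm (x t) < e)"
  proof (intro exI[of _ "min \<delta> e"] conjI allI impI)
    fix x :: "real \<Rightarrow> 'a" and t :: real
    assume x: "trajectory F x \<and> norm (x 0) < min \<delta> e" and t: "0 \<le> t"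
    show "norm (x t) < e"
    proof (rule ccontr)
      assume "\<not> norm (x t) < e"
      have "continuous_on {0..t} x"
        using x by (intro continuous_on_subset[OF trajectory_continuous_on]) auto
      then have "continuous_on {0..t} (\<lambda>s. norm (x s))"
        by (intro continuous_intros)
      then obtain s where s: "0 \<le> s" "s \<le> t" "norm (x s) = e"
        using IVT'[of "\<lambda>s. norm (x s)" 0 e t] x t \<open>\<not> norm (x t) < e\<close> by auto
      then have nz: "x s \<noteq> 0" using e by auto
      have "H (x s) + rate * s \<le> H (x 0)"
        using H_bound[OF conjunct1[OF x] s(1) nz] .
      then have "H (x s) \<le> H (x 0)"
        using rate_pos s(1) mult_nonneg_nonneg[of rate s] by linarith
      then have "W (x s) \<le> W (x 0)"
        using powr_less_mono2[of "1 - \<beta>" "W (x 0)" "W (x s)"] \<beta>(2) W_nonneg[of "x 0"]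
        unfolding H_def by linarith
      moreover have "W (x 0) < m"
        using \<delta>(2)[of "x 0"] x by (simp add: W_zero dist_real_def abs_less_iff)
      ultimately show False using m(2)[OF s(3)] by simp
    qed
  qed (use \<delta>(1) e in auto)
next
  fix x :: "real \<Rightarrow> 'a" assume x: "trajectory F x"
  show "\<exists>T\<ge>0. \<forall>t\<ge>T. x t = 0"
  proof (intro exI[of _ "H (x 0) / rate"] conjI allI impI)
    show T: "0 \<le> H (x 0) / rate" using rate_pos H_nonneg by simp
    fix t assume t: "H (x 0) / rate \<le> t"
    show "x t = 0"
    proof (rule ccontr)
      assume nz: "x t \<noteq> 0"
      have "H (x 0) \<le> rate * t" using t rate_pos by (simp add: divide_le_eq mult.commute)
      moreover have "H (x t) + rate * t \<le> H (x 0)"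
        by (rule H_bound[OF x order_trans[OF T t] nz])
      ultimately show False using H_pos[OF nz] by linarith
    qed
  qed
qed

text \<open>
  Before the first zero the times outside \<open>S\<close> are isolated, hence countable. After it the
  trajectory rests at the origin.
\<close>

lemma decay_along: "decay_along F W d \<beta>"
  unfolding decay_along_def
proof (intro allI impI, elim conjE)
  fix x assume x: "trajectory F x" and "\<not> (\<forall>t\<ge>0. x t = 0)"
  obtain N where N: "negligible N"
    "\<forall>t. t \<ge> 0 \<and> t \<notin> N \<longrightarrow> (\<exists>v\<in>filippov F (x t). (x has_vector_derivative v) (at t))"
    using x by (rule trajectoryE)
  define Z where "Z = {t. t \<ge> 0 \<and> x t = 0}"
  define D where "D = (if Z = {} then UNIV else {..<Inf Z})"
  define B where "B = {t. t \<ge> 0 \<and> x t \<noteq> 0 \<and> x t \<notin> S}"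
  have bdd: "bdd_below Z" by (auto simp: Z_def)
  have D_nz: "x t \<noteq> 0" if "t \<in> D" "t \<ge> 0" for t
    using that cInf_lower[OF _ bdd, of t] by (auto simp: D_def Z_def split: if_splits)
  have after: "x t = 0" if Z: "Z \<noteq> {}" "Inf Z < t" for t
  proof -
    obtain z where "z \<in> Z" "z < t" using cInf_lessD[OF Z] by blast
    then show ?thesis using zero_absorbing[OF x, of z t] by (auto simp: Z_def)
  qed
  have "open D" by (simp add: D_def)
  moreover have "B sparse_in D"
    unfolding sparse_in_eventually_iff[OF \<open>open D\<close>]
  proof
    fix y assume y: "y \<in> D"
    show "\<forall>\<^sub>F s in at y. s \<notin> B"
    proof (cases "y < 0")
      case True
      then have "\<forall>\<^sub>F s in at y. s < 0"
        by (rule order_tendstoD(2)[OF tendsto_ident_at])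
      then show ?thesis by eventually_elim (auto simp: B_def)
    next
      case False
      have "\<exists>\<eta>>0. \<forall>s\<ge>0. s \<noteq> y \<and> \<bar>s - y\<bar> < \<eta> \<longrightarrow> x s \<in> S"
      proof (cases "x y \<in> S")
        case True
        then show ?thesis
          using trajectory_near[OF x _ S(1), of y] False by (metis not_less)
      next
        case notS: False
        then show ?thesis
          using isolated[OF x _ D_nz[OF y]] False by simp
      qed
      then obtain \<eta> where "\<eta> > 0" "\<And>s. s \<ge> 0 \<Longrightarrow> s \<noteq> y \<Longrightarrow> \<bar>s - y\<bar> < \<eta> \<Longrightarrow> x s \<in> S"
        by blast
      then show ?thesis
        unfolding eventually_at by (intro exI[of _ \<eta>]) (auto simp: B_def dist_real_def)
    qed
  qed
  ultimately have "countable (D \<inter> B)" by (rule sparse_imp_countable)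
  then have "negligible (insert (Inf Z) (D \<inter> B))"
    by (simp only: negligible_iff_null_sets) (intro null_sets_completionI countable_imp_null_set_lborel countable_insert)
  then have null: "negligible (N \<union> insert (Inf Z) (D \<inter> B))"
    using N(1) by (rule negligible_Un[rotated])
  show "AE t in lebesgue. t \<ge> 0 \<longrightarrow>
      (\<exists>D. ((\<lambda>s. W (x s)) has_real_derivative D) (at t) \<and> D \<le> - d * W (x t) powr \<beta>)"
  proof (rule AE_I')
    show "N \<union> insert (Inf Z) (D \<inter> B) \<in> null_sets lebesgue"
      using null by (simp add: negligible_iff_null_sets)
    have "\<exists>D. ((\<lambda>s. W (x s)) has_real_derivative D) (at t) \<and> D \<le> - d * W (x t) powr \<beta>"
      if t: "t \<ge> 0" "t \<notin> N" "t \<noteq> Inf Z" "t \<notin> D \<inter> B" for t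
    proof (cases "t \<in> D")
      case True
      then have tS: "x t \<in> S" using t D_nz[of t] by (auto simp: B_def)
      obtain v where v: "v \<in> filippov F (x t)" "(x has_vector_derivative v) (at t)"
        using N(2) t by blast
      obtain W' where W': "(W has_derivative W') (at (x t))"
        using W_C1 tS unfolding C1_on_def by blast
      show ?thesis
        using has_vector_derivative_compose_derivative[OF v(2) W'] decrease[OF tS v(1) W'] by blast
    next
      case False
      then have Z: "Z \<noteq> {}" "Inf Z < t" using t by (auto simp: D_def split: if_splits)
      have "((\<lambda>s. 0) has_real_derivative 0) (at t)" by simp
      then have "((\<lambda>s. W (x s)) has_real_derivative 0) (at t)"
        by (rule has_field_derivative_transform_within_open[where S = "{Inf Z<..}"])
           (use Z after in \<open>auto simp: W_zero\<close>)
      then show ?thesis using after[OF Z] W_zero by (intro exI[of _ 0]) simp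
    qed
    then show "{t \<in> space lebesgue. \<not> (t \<ge> 0 \<longrightarrow>
        (\<exists>D. ((\<lambda>s. W (x s)) has_real_derivative D) (at t) \<and> D \<le> - d * W (x t) powr \<beta>))}
        \<subseteq> N \<union> insert (Inf Z) (D \<inter> B)" by blast
  qed
qed

end

section \<open>Homogeneity estimates for the chain of integrators\<close>

lemma coord_no_last: "coord_no (last_index :: 'n::{finite,linorder}) = CARD('n)"
proof -
  have "{j::'n. j \<le> Max UNIV} = UNIV" by auto
  then show ?thesis by (simp add: coord_no_def last_index_def)
qed

lemma coord_no_bounds: "1 \<le> coord_no i" "coord_no (i :: 'n::{finite,linorder}) \<le> CARD('n)"
proof -
  have "card {i} \<le> card {j. j \<le> i}" by (intro card_mono) auto
  then show "1 \<le> coord_no i" by (simp add: coord_no_def)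
  show "coord_no i \<le> CARD('n)"
    unfolding coord_no_def by (intro card_mono) auto
qed

lemma e_last_component: "e_last $ i = (if i = last_index then 1 else 0)"
  by (simp add: e_last_def axis_def)

lemma bounded_linear_jordan: "bounded_linear (jordan :: real^'n::{finite,linorder} \<Rightarrow> _)"
  unfolding linear_conv_bounded_linear[symmetric]
  by (intro linearI) (auto simp: jordan_def vec_eq_iff)

text \<open>
  The nominal closed loop with its Lyapunov function \<open>V1\<close>; \<open>q\<close> and \<open>pr\<close> abbreviate the weights
  \<open>p\<^sub>r\<^sub>+\<^sub>1\<close> and \<open>p\<^sub>r\<close>.
\<close>

locale chain_lyapunov =
  fixes \<kappa> p c \<alpha> q pr :: real and u0 V1 :: "real^'n::{finite,linorder} \<Rightarrow> real"
  assumes \<kappa>: "\<kappa> < 0" and p: "p > 0" and p\<kappa>: "p + (real CARD('n) + 1) * \<kappa> \<ge> 0"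
    and q_def: "q = weight p \<kappa> (CARD('n) + 1)" and pr_def: "pr = weight p \<kappa> CARD('n)"
    and u0_adm: "admissible_feedback u0"
    and u0_hom: "homogeneous_on (dil p \<kappa>) UNIV q u0"
    and field_hom: "homogeneous_field (dil p \<kappa>) \<kappa> (closed_loop u0)"
    and V1_cont: "continuous_on UNIV V1" and V1_pd: "positive_definite V1" and V1_C1: "C1_on V1 (- {0})"
    and V1_hom: "homogeneous_on (dil p \<kappa>) UNIV (2 * q) V1"
    and c: "c > 0" and \<alpha>: "0 < \<alpha>" "\<alpha> < 1"
    and V1_decay: "decay_along (closed_loop u0) V1 c \<alpha>"
    and damping: "\<forall>z. partial_last V1 z * u0 z \<le> 0"
begin

abbreviation \<delta> :: "real \<Rightarrow> real^'n::{finite,linorder} \<Rightarrow> real^'n::{finite,linorder}" where "\<delta> \<equiv> dil p \<kappa>"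
abbreviation \<omega> :: "'n \<Rightarrow> real" where "\<omega> i \<equiv> weight p \<kappa> (coord_no i)"
abbreviation G :: "real^'n::{finite,linorder} \<Rightarrow> real" where "G \<equiv> partial_last V1"

lemma q_pos: "q > 0" and pr_eq: "pr = q - \<kappa>" and pr_pos: "pr > 0"
proof -
  have "q \<ge> - \<kappa>" using p\<kappa> by (simp add: q_def weight_def algebra_simps)
  then show "q > 0" using \<kappa> by simp
  show "pr = q - \<kappa>" by (simp add: q_def pr_def weight_def algebra_simps)
  then show "pr > 0" using \<open>q > 0\<close> \<kappa> by simp
qed

lemma \<omega>_last: "\<omega> last_index = pr"
  by (simp add: coord_no_last pr_def)

lemma \<omega>_bounds: "pr \<le> \<omega> i" "\<omega> i \<le> p"
proof -
  have "(real (coord_no i) - 1) * \<kappa> \<ge> (real CARD('n) - 1) * \<kappa>"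
    using coord_no_bounds[of i] \<kappa> by (intro mult_right_mono_neg) auto
  then show "pr \<le> \<omega> i" by (simp add: pr_def weight_def)
  have "(real (coord_no i) - 1) * \<kappa> \<le> 0"
    using coord_no_bounds[of i] \<kappa> by (intro mult_nonneg_nonpos) auto
  then show "\<omega> i \<le> p" by (simp add: weight_def)
qed

lemma dil_component: "\<delta> e z $ i = e powr \<omega> i * z $ i"
  by (simp add: dil_def)

lemma dil_dil: "e > 0 \<Longrightarrow> s > 0 \<Longrightarrow> \<delta> e (\<delta> s z) = \<delta> (e * s) z"
  by (simp add: vec_eq_iff dil_component powr_mult)

lemma dil_one: "\<delta> 1 z = z"
  by (simp add: vec_eq_iff dil_component)

lemma dil_inverse: "e > 0 \<Longrightarrow> \<delta> (1 / e) (\<delta> e z) = z" "e > 0 \<Longrightarrow> \<delta> e (\<delta> (1 / e) z) = z"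
  by (simp_all add: dil_dil dil_one)

lemma bounded_linear_dil: "bounded_linear (\<delta> e)"
  unfolding linear_conv_bounded_linear[symmetric]
  by (intro linearI) (auto simp: dil_component vec_eq_iff algebra_simps)

lemma dil_e_last: "\<delta> e e_last = (e powr pr) *\<^sub>R e_last"
  by (simp add: vec_eq_iff dil_component e_last_component \<omega>_last)

lemma dil_zero_iff: "e > 0 \<Longrightarrow> \<delta> e z = 0 \<longleftrightarrow> z = 0"
  by (auto simp: vec_eq_iff dil_component)

lemma norm_dil_le:
  assumes "e > 0"
  shows "e \<le> 1 \<Longrightarrow> norm (\<delta> e z) \<le> e powr pr * norm z"
    and "1 \<le> e \<Longrightarrow> norm (\<delta> e z) \<le> e powr p * norm z"
proof -
  have le: "norm (\<delta> e z) \<le> a * norm z" if "\<And>i. e powr \<omega> i \<le> a" for a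
  proof -
    have "0 \<le> a" using that[of last_index] order_trans[OF powr_ge_zero] by blast
    then have "norm (\<delta> e z) \<le> norm (a *\<^sub>R z)"
      using that by (intro norm_le_componentwise_cart) (auto simp: dil_component abs_mult intro!: mult_right_mono)
    then show ?thesis using \<open>0 \<le> a\<close> by simp
  qed
  show "e \<le> 1 \<Longrightarrow> norm (\<delta> e z) \<le> e powr pr * norm z"
    using \<omega>_bounds(1) assms by (intro le powr_mono') auto
  show "1 \<le> e \<Longrightarrow> norm (\<delta> e z) \<le> e powr p * norm z"
    using \<omega>_bounds(2) by (intro le powr_mono) auto
qed

lemma V1_pos: "z \<noteq> 0 \<Longrightarrow> V1 z > 0" and V1_zero: "V1 0 = 0" and V1_nonneg: "V1 z \<ge> 0"
  using V1_pd unfolding positive_definite_def by (auto, metis less_eq_real_def)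

lemma V1_dil: "e > 0 \<Longrightarrow> V1 (\<delta> e z) = e powr (2 * q) * V1 z"
  using V1_hom unfolding homogeneous_on_def by simp

lemma u0_dil: "e > 0 \<Longrightarrow> u0 (\<delta> e z) = e powr q * u0 z"
  using u0_hom unfolding homogeneous_on_def by simp

lemma u0_zero: "u0 0 = 0"
proof -
  have "\<delta> 2 0 = 0" by (simp add: dil_zero_iff)
  then have "u0 0 = 2 powr q * u0 0"
    using u0_dil[of 2 0] by simp
  moreover have "(2::real) powr q \<noteq> 1" using q_pos by (simp add: powr_eq_one_iff)
  ultimately show ?thesis by simp
qed

lemma u0_locally_bounded:
  assumes "bounded S"
  obtains B where "B \<ge> 0" "\<And>z. z \<in> S \<Longrightarrow> \<bar>u0 z\<bar> \<le> B"
proof -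
  have "bounded (u0 ` S)" using u0_adm assms unfolding admissible_feedback_def by blast
  then obtain B where "\<forall>y\<in>u0 ` S. norm y \<le> B" unfolding bounded_iff by blast
  then show thesis by (intro that[of "max 0 B"]) (auto simp: max.coboundedI2)
qed

text \<open>
  The degree \<open>q\<close> of \<open>u0\<close> is smaller than all weights, so \<open>u0\<close> grows at most linearly. This makes
  the trajectories of the nominal loop global.
\<close>

lemma u0_linear_growth: "\<exists>M\<ge>0. \<forall>z. \<bar>u0 z\<bar> \<le> M * (1 + norm z)"
proof -
  obtain M where M: "M \<ge> 0" "\<And>z. z \<in> cball 0 1 \<Longrightarrow> \<bar>u0 z\<bar> \<le> M"
    using u0_locally_bounded[OF bounded_cball] by blast
  have "\<bar>u0 z\<bar> \<le> M * (1 + norm z)" for z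
  proof -
    define m where "m = max 1 (norm z)"
    define \<rho> where "\<rho> = m powr (1 / pr)"
    have m: "m \<ge> 1" "norm z \<le> m" "m \<le> 1 + norm z" by (auto simp: m_def)
    have \<rho>: "\<rho> \<ge> 1" "\<rho> powr pr = m"
      using m pr_pos by (auto simp: \<rho>_def powr_powr ge_one_powr_ge_zero)
    have "norm (\<delta> (1 / \<rho>) z) \<le> (1 / \<rho>) powr pr * norm z"
      using \<rho> by (intro norm_dil_le) auto
    also have "\<dots> = norm z / m"
      using \<rho> by (simp add: powr_divide)
    also have "\<dots> \<le> 1" using m by simp
    finally have "\<bar>u0 (\<delta> (1 / \<rho>) z)\<bar> \<le> M" using M(2) by simp
    moreover have "u0 z = \<rho> powr q * u0 (\<delta> (1 / \<rho>) z)"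
      using u0_dil[of \<rho> "\<delta> (1 / \<rho>) z"] dil_inverse(2)[of \<rho> z] \<rho> by simp
    ultimately have "\<bar>u0 z\<bar> \<le> \<rho> powr q * M"
      by (simp add: abs_mult mult_left_mono)
    also have "\<dots> \<le> \<rho> powr pr * M"
      using \<rho> pr_eq \<kappa> M by (intro mult_right_mono powr_mono) auto
    also have "\<dots> \<le> (1 + norm z) * M"
      using m \<rho> M by (intro mult_right_mono) auto
    finally show ?thesis by (simp add: mult.commute)
  qed
  with M(1) show ?thesis by blast
qed

text \<open>
  Dilating a point outside the unit ball onto the unit sphere multiplies \<open>V1\<close> by a positive power of
  the dilation factor, and \<open>V1\<close> has a positive minimum on the sphere. So the factor is bounded below
  on the level set.
\<close>

lemma level_set_bounded: "bounded {z. V1 z = 1}"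
proof -
  have cont: "continuous_on (sphere (0 :: real^'n::{finite,linorder}) 1) V1"
    using V1_cont continuous_on_subset by blast
  have ne: "sphere (0 :: real^'n::{finite,linorder}) 1 \<noteq> {}"
    by simp
  obtain y where y: "y \<in> sphere 0 1" "\<And>z. z \<in> sphere 0 1 \<Longrightarrow> V1 y \<le> V1 z"
    using continuous_attains_inf[OF compact_sphere ne cont] by blast
  define m where "m = V1 y"
  have m: "m > 0" using y by (auto simp: m_def intro!: V1_pos)
  have "norm z \<le> max 1 (m powr (- p / (2 * q)))" if z: "V1 z = 1" for z
  proof (cases "norm z \<le> 1")
    case False
    define s0 where "s0 = norm z powr (- 1 / pr)"
    have s0: "0 < s0" "s0 \<le> 1" "s0 powr pr * norm z = 1"
    proof -
      have "norm z > 0" using False by linarith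
      then show "0 < s0" by (simp add: s0_def)
      have "s0 \<le> norm z powr 0"
        unfolding s0_def using False pr_pos by (intro powr_mono) auto
      then show "s0 \<le> 1" using \<open>norm z > 0\<close> by simp
      have "s0 powr pr = norm z powr (- 1)" using pr_pos by (simp add: s0_def powr_powr)
      then show "s0 powr pr * norm z = 1"
        using \<open>norm z > 0\<close> by (simp add: powr_minus)
    qed
    have "continuous_on {s0..1} (\<lambda>s. \<delta> s z)"
      unfolding dil_def using s0 by (intro continuous_intros) auto
    then have "continuous_on {s0..1} (\<lambda>s. norm (\<delta> s z))"
      by (intro continuous_intros)
    moreover have "norm (\<delta> s0 z) \<le> 1" using norm_dil_le(1)[of s0 z] s0 by simp
    moreover have "1 \<le> norm (\<delta> 1 z)" using False by (simp add: dil_one)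
    ultimately obtain s where s: "s0 \<le> s" "s \<le> 1" "norm (\<delta> s z) = 1"
      using IVT'[of "\<lambda>s. norm (\<delta> s z)" s0 1 1] s0 by auto
    have spos: "s > 0" using s s0 by simp
    have "m \<le> V1 (\<delta> s z)" using y(2)[of "\<delta> s z"] s by (simp add: m_def)
    then have "m \<le> s powr (2 * q)" using V1_dil[OF spos, of z] z by simp
    then have "m powr (1 / (2 * q)) \<le> (s powr (2 * q)) powr (1 / (2 * q))"
      using m q_pos by (intro powr_mono2) auto
    then have ms: "m powr (1 / (2 * q)) \<le> s"
      using spos q_pos by (simp add: powr_powr)
    have "norm z = norm (\<delta> (1 / s) (\<delta> s z))" using dil_inverse(1)[OF spos] by simp
    also have "\<dots> \<le> (1 / s) powr p * norm (\<delta> s z)"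
      using spos s by (intro norm_dil_le) auto
    also have "\<dots> = s powr (- p)" using s spos by (simp add: powr_divide powr_minus_divide)
    also have "\<dots> \<le> (m powr (1 / (2 * q))) powr (- p)"
      using ms m p by (intro powr_mono2') auto
    also have "\<dots> = m powr (- p / (2 * q))" by (simp add: powr_powr)
    finally show ?thesis by simp
  qed simp
  then show ?thesis unfolding bounded_iff by blast
qed

text \<open>
  Dilate \<open>z\<close> onto the level set \<open>V1 = 1\<close>. All estimates between homogeneous functions below are
  instances of this comparison.
\<close>

lemma homogeneous_le_V1_powr:
  assumes hom: "\<And>e z. e > 0 \<Longrightarrow> z \<noteq> 0 \<Longrightarrow> f (\<delta> e z) = e powr m * f z"
    and B: "\<And>z. V1 z = 1 \<Longrightarrow> \<bar>f z\<bar> \<le> B" and z: "z \<noteq> 0"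
  shows "\<bar>f z\<bar> \<le> B * V1 z powr (m / (2 * q))"
proof -
  define e where "e = V1 z powr (- 1 / (2 * q))"
  have Vz: "V1 z > 0" using z by (rule V1_pos)
  then have e: "e > 0" by (simp add: e_def)
  have "e powr (2 * q) = V1 z powr (- 1)"
    using q_pos by (simp add: e_def powr_powr)
  then have "V1 (\<delta> e z) = 1"
    using V1_dil[OF e, of z] Vz by (simp add: powr_minus)
  then have "\<bar>f (\<delta> e z)\<bar> \<le> B" by (rule B)
  then have "e powr m * \<bar>f z\<bar> \<le> B" using hom[OF e z] by (simp add: abs_mult)
  moreover have "e powr m = V1 z powr (- (m / (2 * q)))"
    by (simp add: e_def powr_powr)
  ultimately show ?thesis
    using Vz by (simp add: powr_minus field_simps)
qed

lemma u0_bound: "\<exists>C\<ge>0. \<forall>z. \<bar>u0 z\<bar> \<le> C * sqrt (V1 z)"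
proof -
  obtain B where B: "B \<ge> 0" "\<And>z. z \<in> {z. V1 z = 1} \<Longrightarrow> \<bar>u0 z\<bar> \<le> B"
    using u0_locally_bounded[OF level_set_bounded] by blast
  have "\<bar>u0 z\<bar> \<le> B * sqrt (V1 z)" for z
  proof (cases "z = 0")
    case False
    have "\<bar>u0 z\<bar> \<le> B * V1 z powr (q / (2 * q))"
      using B(2) False by (intro homogeneous_le_V1_powr u0_dil) auto
    then show ?thesis using q_pos V1_nonneg[of z] by (simp add: powr_half_sqrt)
  qed (simp add: u0_zero V1_zero)
  with B(1) show ?thesis by blast
qed

lemma last_component_bound: "\<exists>C\<ge>0. \<forall>z. \<bar>z $ last_index\<bar> \<le> C * V1 z powr (pr / (2 * q))"
proof -
  obtain B where B: "\<And>z. V1 z = 1 \<Longrightarrow> norm z \<le> B"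
    using level_set_bounded unfolding bounded_iff by auto
  have "\<bar>z $ last_index\<bar> \<le> max 0 B * V1 z powr (pr / (2 * q))" for z
  proof (cases "z = 0")
    case False
    show ?thesis
    proof (rule homogeneous_le_V1_powr[where f = "\<lambda>z. z $ last_index"])
      show "\<bar>z $ last_index\<bar> \<le> max 0 B" if "V1 z = 1" for z
        using B[OF that] component_le_norm_cart[of z last_index] by simp
    qed (use False in \<open>auto simp: dil_component \<omega>_last\<close>)
  qed simp
  then show ?thesis by (intro exI[of _ "max 0 B"]) auto
qed

definition DV :: "real^'n::{finite,linorder} \<Rightarrow> (real^'n::{finite,linorder}) \<Rightarrow>\<^sub>L real" where
  "DV = (SOME f'. (\<forall>x\<in>- {0}. (V1 has_derivative blinfun_apply (f' x)) (at x)) \<and> continuous_on (- {0}) f')"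

lemma DV_deriv: "z \<noteq> 0 \<Longrightarrow> (V1 has_derivative blinfun_apply (DV z)) (at z)"
  and DV_cont: "continuous_on (- {0}) DV"
proof -
  have "(\<forall>x\<in>- {0}. (V1 has_derivative blinfun_apply (DV x)) (at x)) \<and> continuous_on (- {0}) DV"
    by (rule someI_ex[OF V1_C1[unfolded C1_on_def], folded DV_def])
  then show "z \<noteq> 0 \<Longrightarrow> (V1 has_derivative blinfun_apply (DV z)) (at z)" "continuous_on (- {0}) DV"
    by auto
qed

lemma DV_isCont: "z \<noteq> 0 \<Longrightarrow> isCont DV z"
  using DV_cont continuous_on_eq_continuous_at[of "- {0}" DV] by (simp add: open_Compl)

lemma G_eq: "z \<noteq> 0 \<Longrightarrow> G z = DV z e_last"
proof -
  assume z: "z \<noteq> 0"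
  have "((\<lambda>s. z + s *\<^sub>R e_last) has_vector_derivative e_last) (at 0)"
    by (auto intro!: derivative_eq_intros simp: has_vector_derivative_def)
  moreover have "(V1 has_derivative blinfun_apply (DV z)) (at (z + 0 *\<^sub>R e_last))"
    using DV_deriv[OF z] by simp
  ultimately have "((\<lambda>s. V1 (z + s *\<^sub>R e_last)) has_real_derivative DV z e_last) (at 0)"
    by (rule has_vector_derivative_compose_derivative)
  then show ?thesis unfolding partial_last_def by (rule DERIV_imp_deriv)
qed

lemma G_isCont: "z \<noteq> 0 \<Longrightarrow> isCont G z"
proof -
  assume z: "z \<noteq> 0"
  have "continuous_on (- {0}) (\<lambda>z. DV z e_last)"
    by (intro continuous_intros DV_cont)
  then have "continuous_on (- {0}) G"
    by (rule continuous_on_eq) (simp add: G_eq)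
  then show ?thesis using z continuous_on_eq_continuous_at[of "- {0}" G] by (simp add: open_Compl)
qed

lemma DV_dil:
  assumes e: "e > 0" and z: "z \<noteq> 0"
  shows "DV (\<delta> e z) (\<delta> e h) = e powr (2 * q) * DV z h"
proof -
  have ez: "\<delta> e z \<noteq> 0" using dil_zero_iff[OF e] z by simp
  have "(V1 \<circ> \<delta> e has_derivative blinfun_apply (DV (\<delta> e z)) \<circ> \<delta> e) (at z)"
    by (rule diff_chain_at[OF bounded_linear_imp_has_derivative[OF bounded_linear_dil] DV_deriv[OF ez]])
  moreover have "V1 \<circ> \<delta> e = (\<lambda>z. e powr (2 * q) * V1 z)"
    using V1_dil[OF e] by auto
  moreover have "((\<lambda>z. e powr (2 * q) * V1 z) has_derivative (\<lambda>h. e powr (2 * q) * DV z h)) (at z)"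
    by (rule has_derivative_mult_right[OF DV_deriv[OF z]])
  ultimately have "blinfun_apply (DV (\<delta> e z)) \<circ> \<delta> e = (\<lambda>h. e powr (2 * q) * DV z h)"
    by (metis has_derivative_unique)
  then show ?thesis by (metis comp_apply)
qed

lemma G_dil:
  assumes e: "e > 0" and z: "z \<noteq> 0"
  shows "\<delta> e z $ last_index * G (\<delta> e z) = e powr (2 * q) * (z $ last_index * G z)"
proof -
  have "e powr pr * G (\<delta> e z) = e powr (2 * q) * G z"
    using DV_dil[OF e z, of e_last] dil_zero_iff[OF e] z
    by (simp add: G_eq dil_e_last blinfun.scaleR_right)
  then show ?thesis by (simp add: dil_component \<omega>_last)
qed

lemma gradient_bound: "\<exists>C\<ge>0. \<forall>z. z \<noteq> 0 \<longrightarrow> \<bar>z $ last_index * G z\<bar> \<le> C * V1 z"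
proof -
  have "closed {z. V1 z = 1}"
    using V1_cont by (intro closed_Collect_eq continuous_on_const)
  then have "compact {z. V1 z = 1}"
    using level_set_bounded compact_eq_bounded_closed by blast
  moreover have "continuous_on {z. V1 z = 1} (\<lambda>z. z $ last_index * G z)"
    by (intro continuous_at_imp_continuous_on ballI continuous_intros G_isCont) (auto simp: V1_zero)
  ultimately have "bounded ((\<lambda>z. z $ last_index * G z) ` {z. V1 z = 1})"
    by (intro compact_imp_bounded compact_continuous_image)
  then obtain B where B: "\<And>z. V1 z = 1 \<Longrightarrow> \<bar>z $ last_index * G z\<bar> \<le> B"
    unfolding bounded_iff by auto
  have "\<bar>z $ last_index * G z\<bar> \<le> max 0 B * V1 z" if z: "z \<noteq> 0" for z
  proof -
    have "\<bar>z $ last_index * G z\<bar> \<le> max 0 B * V1 z powr (2 * q / (2 * q))"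
      using G_dil z B by (intro homogeneous_le_V1_powr[where f = "\<lambda>z. z $ last_index * G z"]) (auto simp: max.coboundedI2)
    then show ?thesis using q_pos V1_pos[OF z] by simp
  qed
  then show ?thesis by (intro exI[of _ "max 0 B"]) auto
qed

end

section \<open>From trajectories to a pointwise decay inequality\<close>

text \<open>
  The points at which a continuous linear functional is at most a given constant form a closed
  half-space, and a closed convex set that contains the field near \<open>x\<close> off a null set contains the
  Filippov velocities at \<open>x\<close>.
\<close>

lemma filippov_linear_le:
  fixes F :: "'a::euclidean_space \<Rightarrow> 'a" and l g :: "'a \<Rightarrow> real"
  assumes v: "v \<in> filippov F x" and l: "bounded_linear l"
    and U: "open U" "x \<in> U" and N: "negligible N"
    and le: "\<And>y. y \<in> U \<Longrightarrow> y \<notin> N \<Longrightarrow> l (F y) \<le> g y" and g: "isCont g x"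
  shows "l v \<le> g x"
proof (rule field_le_epsilon)
  fix e :: real assume e: "e > 0"
  obtain d1 where d1: "d1 > 0" "ball x d1 \<subseteq> U"
    using U openE by blast
  obtain d2 where d2: "d2 > 0" "\<And>y. dist y x < d2 \<Longrightarrow> dist (g y) (g x) < e"
    using g e unfolding continuous_at_eps_delta by blast
  let ?H = "l -` {..g x + e}"
  have "F y \<in> ?H" if y: "y \<in> ball x (min d1 d2) - N" for y
  proof -
    have "l (F y) \<le> g y" using y d1 by (intro le) auto
    moreover have "dist (g y) (g x) < e" using y by (intro d2) (auto simp: dist_commute)
    ultimately show ?thesis by (simp add: dist_real_def abs_less_iff)
  qed
  then have "F ` (ball x (min d1 d2) - N) \<subseteq> ?H" by blast
  moreover have "convex ?H"
    using l by (intro convex_linear_vimage) (auto simp: bounded_linear.linear)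
  moreover have "closed ?H"
    using l by (intro closed_vimage) (auto simp: linear_continuous_on)
  ultimately have "closure (convex hull (F ` (ball x (min d1 d2) - N))) \<subseteq> ?H"
    by (intro closure_minimal hull_minimal)
  moreover have "v \<in> closure (convex hull (F ` (ball x (min d1 d2) - N)))"
    using v N d1 d2 unfolding filippov_def by auto
  ultimately show "l v \<le> g x + e" by auto
qed

context chain_lyapunov
begin

lemma closed_loop_isCont: "isCont u0 z \<Longrightarrow> isCont (closed_loop u0) z"
  unfolding closed_loop_def
  by (intro continuous_intros bounded_linear.isCont[OF bounded_linear_jordan]) auto

lemma null_discontinuities: "negligible {z. \<not> isCont u0 z}"
  using u0_adm by (simp add: admissible_feedback_def)

lemma closed_loop_trajectory_exists:
  obtains x where "trajectory (closed_loop u0) x" "x 0 = z0"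
proof -
  obtain M where M: "M \<ge> 0" "\<And>z. \<bar>u0 z\<bar> \<le> M * (1 + norm z)"
    using u0_linear_growth by blast
  obtain K where K: "K \<ge> 0" "\<And>z :: real^'n::{finite,linorder}. norm (jordan z) \<le> norm z * K"
    using bounded_linear.nonneg_bounded[OF bounded_linear_jordan] by blast
  have "norm (e_last :: real^'n::{finite,linorder}) = 1"
    by (simp add: e_last_def)
  then have "norm (closed_loop u0 z) \<le> norm (jordan z) + \<bar>u0 z\<bar>" for z
    unfolding closed_loop_def using norm_triangle_ineq[of "jordan z" "u0 z *\<^sub>R e_last"] by simp
  also have "norm (jordan z) + \<bar>u0 z\<bar> \<le> (K + M) * (1 + norm z)" for z
    using M(2)[of z] K(2)[of z] K(1) by (simp add: algebra_simps)
  finally have "norm (closed_loop u0 z) \<le> (K + M) * (1 + norm z)" for z .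
  moreover have "negligible {z. \<not> isCont (closed_loop u0) z}"
    by (rule negligible_subset[OF null_discontinuities]) (use closed_loop_isCont in blast)
  ultimately show thesis
    using filippov_existence[of "closed_loop u0" "K + M" z0] that by blast
qed

text \<open>
  The decay of \<open>V1\<close> is assumed along trajectories only. If the inequality failed at a
  continuity point \<open>z0\<close> of \<open>u0\<close>, then it would fail with a uniform margin for all Filippov velocities
  near \<open>z0\<close>, hence along a trajectory that starts at \<open>z0\<close>, for almost all small times.
\<close>

lemma pointwise_decay:
  assumes z0: "z0 \<noteq> 0" "isCont u0 z0"
  shows "DV z0 (closed_loop u0 z0) \<le> - c * V1 z0 powr \<alpha>"
proof (rule ccontr)
  assume neg: "\<not> ?thesis"
  let ?F = "closed_loop u0"
  define \<Phi> where "\<Phi> = (\<lambda>(z, y). DV z (?F y) + c * V1 z powr \<alpha>)"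
  have V1c: "isCont V1 z0" using V1_cont by (simp add: continuous_on_eq_continuous_at)
  have "isCont \<Phi> (z0, z0)"
  proof -
    have "isCont (\<lambda>w. DV (fst w)) (z0, z0)" "isCont (\<lambda>w. V1 (fst w)) (z0, z0)"
      by (rule isCont_o2[OF isCont_fst[OF continuous_ident]], simp add: DV_isCont z0 V1c)+
    moreover have "isCont (\<lambda>w. ?F (snd w)) (z0, z0)"
      by (rule isCont_o2[OF isCont_snd[OF continuous_ident]]) (simp add: closed_loop_isCont z0)
    ultimately show ?thesis
      unfolding \<Phi>_def case_prod_unfold using V1_pos[OF z0(1)] by (intro continuous_intros) auto
  qed
  moreover have pos: "\<Phi> (z0, z0) > 0" using neg by (simp add: \<Phi>_def)
  ultimately obtain d where d: "d > 0" "\<And>w. dist w (z0, z0) < d \<Longrightarrow> dist (\<Phi> w) (\<Phi> (z0, z0)) < \<Phi> (z0, z0) / 2"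
    unfolding continuous_at_eps_delta by (metis half_gt_zero)
  define \<gamma> where "\<gamma> = \<Phi> (z0, z0) / 2"
  have \<gamma>: "\<gamma> > 0" using pos by (simp add: \<gamma>_def)
  define B where "B = ball z0 (min (d / 2) (norm z0))"
  have B: "open B" "z0 \<in> B" "0 \<notin> B" using d(1) z0 by (auto simp: B_def)
  have near: "DV z (?F y) \<ge> \<gamma> - c * V1 z powr \<alpha>" if "z \<in> B" "y \<in> B" for z y
  proof -
    have "dist (z, y) (z0, z0) \<le> dist z z0 + dist y z0"
      unfolding dist_Pair_Pair by (rule sqrt_sum_squares_le_sum) auto
    also have "\<dots> < d" using that by (auto simp: B_def dist_commute)
    finally have "dist (\<Phi> (z, y)) (\<Phi> (z0, z0)) < \<gamma>" using d(2) by (simp add: \<gamma>_def)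
    then have "\<Phi> (z, y) > \<gamma>" unfolding \<gamma>_def dist_real_def by linarith
    then show ?thesis by (simp add: \<Phi>_def)
  qed
  have fil: "DV z v \<ge> \<gamma> - c * V1 z powr \<alpha>" if z: "z \<in> B" and v: "v \<in> filippov ?F z" for z v
  proof -
    have "- DV z v \<le> - (\<gamma> - c * V1 z powr \<alpha>)"
    proof (rule filippov_linear_le[OF v _ B(1) z, where N = "{}" and l = "\<lambda>v. - DV z v"
          and g = "\<lambda>_. - (\<gamma> - c * V1 z powr \<alpha>)"])
      show "bounded_linear (\<lambda>v. - DV z v)"
        by (intro bounded_linear_minus blinfun.bounded_linear_right)
      show "- DV z (?F y) \<le> - (\<gamma> - c * V1 z powr \<alpha>)" if "y \<in> B" for y
        using near[OF z that] by simp
    qed auto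
    then show ?thesis by simp
  qed
  obtain x where x: "trajectory ?F x" "x 0 = z0" by (rule closed_loop_trajectory_exists)
  obtain \<eta> where \<eta>: "\<eta> > 0" "\<And>s. s \<ge> 0 \<Longrightarrow> \<bar>s - 0\<bar> < \<eta> \<Longrightarrow> x s \<in> B"
    using trajectory_near[OF x(1) order_refl B(1)] x(2) B(2) by metis
  have "\<not> (\<forall>t\<ge>0. x t = 0)" using x(2) z0(1) by auto
  then have "AE t in lebesgue. t \<ge> 0 \<longrightarrow>
      (\<exists>D. ((\<lambda>s. V1 (x s)) has_real_derivative D) (at t) \<and> D \<le> - c * V1 (x t) powr \<alpha>)"
    using V1_decay x(1) unfolding decay_along_def by blast
  then obtain N1 where N1: "N1 \<in> null_sets lebesgue" "{t \<in> space lebesgue. \<not> (t \<ge> 0 \<longrightarrow>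
      (\<exists>D. ((\<lambda>s. V1 (x s)) has_real_derivative D) (at t) \<and> D \<le> - c * V1 (x t) powr \<alpha>))} \<subseteq> N1"
    unfolding eventually_ae_filter by blast
  then have N1': "\<forall>t. t \<ge> 0 \<and> t \<notin> N1 \<longrightarrow>
      (\<exists>D. ((\<lambda>s. V1 (x s)) has_real_derivative D) (at t) \<and> D \<le> - c * V1 (x t) powr \<alpha>)"
    by (simp add: subset_iff) blast
  obtain N2 where N2: "negligible N2"
    "\<forall>t. t \<ge> 0 \<and> t \<notin> N2 \<longrightarrow> (\<exists>v\<in>filippov ?F (x t). (x has_vector_derivative v) (at t))"
    using x(1) by (rule trajectoryE)
  have "\<not> negligible {0<..<\<eta>}"
    using \<eta>(1) by (intro open_not_negligible) auto
  moreover have "negligible (N1 \<union> N2)"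
    by (rule negligible_Un[OF _ N2(1)]) (use N1(1) in \<open>simp add: negligible_iff_null_sets\<close>)
  ultimately have "\<not> {0<..<\<eta>} \<subseteq> N1 \<union> N2"
    using negligible_subset by blast
  then obtain t where "t \<in> {0<..<\<eta>}" "t \<notin> N1 \<union> N2"
    by blast
  then have t: "0 < t" "t < \<eta>" "t \<notin> N1" "t \<notin> N2"
    by auto
  then have xt: "x t \<in> B" using \<eta>(2)[of t] by simp
  then have xt0: "x t \<noteq> 0" using B(3) by metis
  obtain D where D: "((\<lambda>s. V1 (x s)) has_real_derivative D) (at t)" "D \<le> - c * V1 (x t) powr \<alpha>"
    using N1' t by (meson less_imp_le)
  obtain v where v: "v \<in> filippov ?F (x t)" "(x has_vector_derivative v) (at t)"
    using N2(2) t by (meson less_imp_le)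
  have "D = DV (x t) v"
    using D(1) has_vector_derivative_compose_derivative[OF v(2) DV_deriv[OF xt0]] by (rule DERIV_unique)
  then show False using fil[OF xt v(1)] D(2) \<gamma> by simp
qed

text \<open>
  Both sides of the pointwise inequality are homogeneous, of degrees \<open>2 q + \<kappa>\<close> and \<open>2 q \<alpha>\<close>. The
  inequality holds along a whole orbit of the dilations, which forces the degrees to agree.
\<close>

lemma \<alpha>_eq: "2 * q * \<alpha> = 2 * q + \<kappa>"
proof -
  have "\<not> negligible (- {0 :: real^'n::{finite,linorder}})"
  proof (rule open_not_negligible)
    have "e_last \<in> - {0 :: real^'n::{finite,linorder}}" by (simp add: e_last_def axis_eq_0_iff)
    then show "- {0 :: real^'n::{finite,linorder}} \<noteq> {}" by blast
  qed (simp add: open_Compl)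
  then have "\<not> (- {0 :: real^'n::{finite,linorder}} \<subseteq> {z. \<not> isCont u0 z})"
    using null_discontinuities negligible_subset by blast
  then obtain z where z: "z \<noteq> 0" "isCont u0 z"
    by blast
  let ?F = "closed_loop u0"
  define a b where "a = - DV z (?F z)" and "b = c * V1 z powr \<alpha>"
  have b: "b > 0" using c V1_pos[OF z(1)] by (simp add: b_def)
  have ineq: "e powr (2 * q * \<alpha>) * b \<le> e powr (2 * q + \<kappa>) * a" if e: "e > 0" for e
  proof -
    have "isCont u0 (\<delta> e z)"
    proof -
      have "isCont (\<delta> (1 / e)) (\<delta> e z)"
        by (rule linear_continuous_at[OF bounded_linear_dil])
      then have "isCont (\<lambda>y. u0 (\<delta> (1 / e) y)) (\<delta> e z)"
        by (rule isCont_o2) (simp only: dil_inverse(1)[OF e] z(2))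
      then have "isCont (\<lambda>y. e powr q * u0 (\<delta> (1 / e) y)) (\<delta> e z)"
        by (intro isCont_mult continuous_const)
      moreover have "e powr q * u0 (\<delta> (1 / e) y) = u0 y" for y
        by (simp only: u0_dil[OF e, symmetric] dil_inverse(2)[OF e])
      ultimately show ?thesis by simp
    qed
    moreover have "\<delta> e z \<noteq> 0" using dil_zero_iff[OF e] z by simp
    ultimately have "DV (\<delta> e z) (?F (\<delta> e z)) \<le> - c * V1 (\<delta> e z) powr \<alpha>"
      by (intro pointwise_decay)
    moreover have "?F (\<delta> e z) = e powr \<kappa> *\<^sub>R \<delta> e (?F z)"
      using field_hom e unfolding homogeneous_field_def by simp
    then have "DV (\<delta> e z) (?F (\<delta> e z)) = - (e powr (2 * q + \<kappa>) * a)"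
      using DV_dil[OF e z(1)] by (simp add: blinfun.scaleR_right powr_add a_def)
    moreover have "V1 (\<delta> e z) powr \<alpha> = e powr (2 * q * \<alpha>) * V1 z powr \<alpha>"
      using V1_dil[OF e] V1_nonneg[of z] by (simp add: powr_mult powr_powr)
    ultimately show ?thesis by (simp add: b_def mult_ac)
  qed
  have a: "a > 0" using ineq[of 1] b by simp
  show ?thesis
  proof (rule ccontr)
    define s where "s = 2 * q * \<alpha> - (2 * q + \<kappa>)"
    assume "\<not> ?thesis"
    then have s: "s \<noteq> 0" by (simp add: s_def)
    \<comment> \<open>With this dilation factor \<open>e powr s\<close> exceeds \<open>a / b\<close>.\<close>
    define e where "e = (a / b + 1) powr (1 / s)"
    have ab: "a / b + 1 > 0" using a b by (simp add: add_pos_pos)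
    then have e: "e > 0" by (simp add: e_def)
    have "e powr s = a / b + 1" using s ab by (simp add: e_def powr_powr)
    moreover have "e powr s * b \<le> a"
    proof -
      have "e powr (2 * q * \<alpha>) = e powr s * e powr (2 * q + \<kappa>)"
        by (simp add: s_def flip: powr_add)
      then show ?thesis using ineq[OF e] e by (simp add: mult_ac)
    qed
    ultimately have "(a / b + 1) * b \<le> a" by simp
    moreover have "(a / b + 1) * b = a + b" using b by (simp add: distrib_right)
    ultimately show False using b by simp
  qed
qed

end

section \<open>Velocities of the super-twisting inclusion\<close>

lemma negligible_Times_UNIV:
  fixes N :: "'a::euclidean_space set"
  assumes "negligible N"
  shows "negligible (N \<times> (UNIV :: 'b::euclidean_space set))"
proof -
  obtain N' where N': "N' \<in> null_sets lborel" "N \<subseteq> N'"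
    using assms unfolding negligible_iff_null_sets null_sets_completion_iff2 by blast
  then have "N' \<times> UNIV \<in> null_sets (lborel \<Otimes>\<^sub>M (lborel :: 'b measure))"
    by (intro lborel.times_in_null_sets1) auto
  then have "N' \<times> (UNIV :: 'b set) \<in> null_sets lborel"
    by (simp add: lborel_prod)
  then have "negligible (N' \<times> (UNIV :: 'b set))"
    unfolding negligible_iff_null_sets by (rule null_sets_completionI)
  then show ?thesis by (rule negligible_subset) (use N' in auto)
qed

lemma filippov_linear_eq:
  fixes F :: "'a::euclidean_space \<Rightarrow> 'a" and l g :: "'a \<Rightarrow> real"
  assumes v: "v \<in> filippov F x" and l: "bounded_linear l" and U: "open U" "x \<in> U"
    and eq: "\<And>y. y \<in> U \<Longrightarrow> l (F y) = g y" and g: "isCont g x"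
  shows "l v = g x"
proof (rule antisym)
  show "l v \<le> g x"
    by (rule filippov_linear_le[OF v l U negligible_empty _ g]) (simp add: eq)
  have "- l v \<le> - g x"
    by (rule filippov_linear_le[OF v bounded_linear_minus[OF l] U negligible_empty _ isCont_minus[OF g]]) (simp add: eq)
  then show "g x \<le> l v" by simp
qed

lemma C1_on_compose_fst:
  assumes "C1_on f T"
  shows "C1_on (\<lambda>w. f (fst w)) {w. fst w \<in> T}"
proof -
  obtain f' where f': "\<forall>x\<in>T. (f has_derivative blinfun_apply (f' x)) (at x)" "continuous_on T f'"
    using assms unfolding C1_on_def by blast
  show ?thesis
  proof (rule C1_onI[where f' = "\<lambda>w. f' (fst w) o\<^sub>L fst_blinfun"])
    fix w :: "'a \<times> 'b" assume "w \<in> {w. fst w \<in> T}"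
    then have "(f has_derivative blinfun_apply (f' (fst w))) (at (fst w))" using f'(1) by blast
    from diff_chain_at[OF has_derivative_fst[OF has_derivative_ident] this]
    show "((\<lambda>w. f (fst w)) has_derivative blinfun_apply (f' (fst w) o\<^sub>L fst_blinfun)) (at w)"
      unfolding o_def by (rule has_derivative_eq_rhs) (auto simp: fst_blinfun.rep_eq)
  next
    have "continuous_on {w :: 'a \<times> 'b. fst w \<in> T} (\<lambda>w. f' (fst w))"
      by (rule continuous_on_compose2[OF f'(2)]) (auto intro: continuous_intros)
    then show "continuous_on {w :: 'a \<times> 'b. fst w \<in> T} (\<lambda>w. f' (fst w) o\<^sub>L fst_blinfun)"
      by (intro bounded_bilinear.continuous_on[OF bounded_bilinear_blinfun_compose] continuous_on_const)
  qed
qed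

locale super_twisting = chain_lyapunov \<kappa> p c \<alpha> q pr u0 V1
  for \<kappa> p c \<alpha> q pr :: real and u0 V1 :: "real^'n::{finite,linorder} \<Rightarrow> real" +
  fixes kP kI :: real
  assumes kP: "kP \<ge> 1" and kI: "kI > 0"
begin

abbreviation F where "F \<equiv> st_field u0 V1 kP kI"

lemma st_field_last: "fst (F (y, \<eta>)) $ last_index = kP * u0 y + \<eta>"
  by (simp add: st_field_def jordan_def e_last_component)

lemma filippov_last_le:
  assumes v: "v \<in> filippov F (z, \<xi>)" and U: "open U" "z \<in> U" and N: "negligible N"
    and le: "\<And>y. y \<in> U \<Longrightarrow> y \<notin> N \<Longrightarrow> a * u0 y \<le> g y" and g: "isCont g z"
  shows "a * (fst v $ last_index - \<xi>) \<le> kP * g z"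
proof -
  have "a * (fst v $ last_index) \<le> kP * g (fst (z, \<xi>)) + a * snd (z, \<xi>)"
  proof (rule filippov_linear_le[OF v, where U = "U \<times> UNIV" and N = "N \<times> UNIV" and l = "\<lambda>v. a * (fst v $ last_index)"
        and g = "\<lambda>w. kP * g (fst w) + a * snd w"])
    show "bounded_linear (\<lambda>v. a * (fst v $ last_index))"
      by (intro bounded_linear_const_mult bounded_linear_compose[OF bounded_linear_vec_nth bounded_linear_fst])
    show "open (U \<times> UNIV)" using U by (intro open_Times) auto
    show "(z, \<xi>) \<in> U \<times> UNIV" using U by simp
    show "negligible (N \<times> UNIV)" using N by (rule negligible_Times_UNIV)
    show "isCont (\<lambda>w. kP * g (fst w) + a * snd w) (z, \<xi>)"
      by (intro continuous_intros isCont_o2[where f = fst and g = g]) (auto simp: g)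
    fix w :: "(real^'n::{finite,linorder}) \<times> real"
    assume w: "w \<in> U \<times> UNIV" "w \<notin> N \<times> UNIV"
    obtain y \<eta> where yw: "w = (y, \<eta>)" by (cases w)
    have "kP * (a * u0 y) \<le> kP * g y"
      using w yw kP by (intro mult_left_mono le) auto
    then show "a * (fst (F w) $ last_index) \<le> kP * g (fst w) + a * snd w"
      unfolding yw st_field_last by (simp add: algebra_simps)
  qed
  then show ?thesis by (simp add: algebra_simps)
qed

text \<open>
  A Filippov velocity at \<open>(z, \<xi>)\<close> is that of the field with \<open>u0 z\<close> replaced by some real
  number \<open>w\<close>. The inequalities valid for \<open>u0\<close> nearby pass to \<open>w\<close>, because \<open>\<partial>\<^sub>r V1\<close> is continuous off
  the origin; the error \<open>(\<partial>\<^sub>r V1 z - \<partial>\<^sub>r V1 y) * u0 y\<close> vanishes as \<open>y\<close> tends to \<open>z\<close>.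
\<close>

lemma filippov_velocity:
  assumes C: "C \<ge> 0" "\<And>z. \<bar>u0 z\<bar> \<le> C * sqrt (V1 z)" and v: "v \<in> filippov F (z, \<xi>)"
  obtains w where "fst v = jordan z + (kP * w + \<xi>) *\<^sub>R e_last" "\<bar>w\<bar> \<le> C * sqrt (V1 z)"
    "z \<noteq> 0 \<longrightarrow> snd v = - kI * G z \<and> G z * w \<le> 0 \<and> DV z (jordan z) + G z * w \<le> - c * V1 z powr \<alpha>"
proof
  let ?w = "(fst v $ last_index - \<xi>) / kP"
  have V1c: "isCont V1 y" for y using V1_cont by (simp add: continuous_on_eq_continuous_at)
  have w_le: "a * ?w \<le> g z" if "open U" "z \<in> U" "negligible N"
    "\<And>y. y \<in> U \<Longrightarrow> y \<notin> N \<Longrightarrow> a * u0 y \<le> g y" "isCont g z" for a g U N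
    using filippov_last_le[OF v that] kP by (simp add: divide_le_eq mult.commute)
  show "fst v = jordan z + (kP * ?w + \<xi>) *\<^sub>R e_last"
  proof (subst vec_eq_iff, rule allI)
    fix i :: 'n
    show "fst v $ i = (jordan z + (kP * ?w + \<xi>) *\<^sub>R e_last) $ i"
    proof (cases "i = last_index")
      case True
      then show ?thesis using kP by (simp add: jordan_def e_last_component)
    next
      case False
      have "fst v $ i = jordan (fst (z, \<xi>)) $ i"
      proof (rule filippov_linear_eq[OF v, where U = UNIV and l = "\<lambda>v. fst v $ i" and g = "\<lambda>w. jordan (fst w) $ i"])
        show "bounded_linear (\<lambda>v. fst v $ i)"
          by (intro bounded_linear_compose[OF bounded_linear_vec_nth bounded_linear_fst])
        show "fst (F y) $ i = jordan (fst y) $ i" for y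
          using False by (cases y) (simp add: st_field_def e_last_component)
        show "isCont (\<lambda>w. jordan (fst w) $ i) (z, \<xi>)"
          by (intro continuous_intros bounded_linear.isCont[OF bounded_linear_jordan])
      qed auto
      then show ?thesis using False by (simp add: e_last_component)
    qed
  qed
  have cont_sqrt: "isCont (\<lambda>y. C * sqrt (V1 y)) z"
    by (intro continuous_intros V1c)
  have "1 * ?w \<le> C * sqrt (V1 z)"
    by (rule w_le[where U = UNIV and N = "{}" and g = "\<lambda>y. C * sqrt (V1 y)"])
       (use C(2) cont_sqrt in \<open>auto simp: abs_le_iff\<close>)
  moreover have "- 1 * ?w \<le> C * sqrt (V1 z)"
    by (rule w_le[where U = UNIV and N = "{}" and g = "\<lambda>y. C * sqrt (V1 y)"])
       (use C(2) cont_sqrt in \<open>auto simp: abs_le_iff\<close>)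
  ultimately show "\<bar>?w\<bar> \<le> C * sqrt (V1 z)" by linarith
  show "z \<noteq> 0 \<longrightarrow> snd v = - kI * G z \<and> G z * ?w \<le> 0 \<and> DV z (jordan z) + G z * ?w \<le> - c * V1 z powr \<alpha>"
  proof
    assume z: "z \<noteq> 0"
    have open_nz: "open (- {0 :: real^'n::{finite,linorder}})" by (simp add: open_Compl)
    have "snd v = - kI * G (fst (z, \<xi>))"
    proof (rule filippov_linear_eq[OF v, where U = "(- {0}) \<times> UNIV" and l = snd and g = "\<lambda>w. - kI * G (fst w)"])
      show "open ((- {0 :: real^'n::{finite,linorder}}) \<times> (UNIV :: real set))"
        using open_nz by (intro open_Times) auto
      show "isCont (\<lambda>w. - kI * G (fst w)) (z, \<xi>)"
        by (intro continuous_intros isCont_o2[where f = fst and g = G]) (auto simp: G_isCont z)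
      show "snd (F y) = - kI * G (fst y)" for y by (cases y) (simp add: st_field_def)
    qed (auto simp: z bounded_linear_snd)
    then have 1: "snd v = - kI * G z" by simp
    \<comment> \<open>The price of freezing the factor \<open>G z\<close> while \<open>u0\<close> is evaluated at nearby points.\<close>
    let ?err = "\<lambda>y. \<bar>G z - G y\<bar> * (C * sqrt (V1 y))"
    have err_cont: "isCont ?err z"
      by (intro continuous_intros G_isCont[OF z] V1c)
    have err: "(G z - G y) * u0 y \<le> ?err y" for y
    proof -
      have "(G z - G y) * u0 y \<le> \<bar>G z - G y\<bar> * \<bar>u0 y\<bar>"
        using abs_ge_self[of "(G z - G y) * u0 y"] by (simp add: abs_mult)
      also have "\<dots> \<le> ?err y" using C(2) by (intro mult_left_mono) auto
      finally show ?thesis .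
    qed
    have "G z * ?w \<le> ?err z"
    proof (rule w_le[where U = UNIV and N = "{}" and g = ?err])
      show "G z * u0 y \<le> ?err y" for y
        using err[of y] damping[rule_format, of y] by (simp add: algebra_simps)
    qed (auto simp: err_cont)
    then have 2: "G z * ?w \<le> 0" by simp
    let ?g = "\<lambda>y. - c * V1 y powr \<alpha> - DV y (jordan y) + ?err y"
    have "G z * ?w \<le> ?g z"
    proof (rule w_le[where U = "- {0}" and N = "{y. \<not> isCont u0 y}" and g = ?g])
      show "G z * u0 y \<le> ?g y" if "y \<in> - {0}" "y \<notin> {y. \<not> isCont u0 y}" for y
      proof -
        have "DV y (closed_loop u0 y) \<le> - c * V1 y powr \<alpha>"
          using that by (intro pointwise_decay) auto
        moreover have "DV y (closed_loop u0 y) = DV y (jordan y) + u0 y * G y"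
          using that by (simp add: closed_loop_def blinfun.add_right blinfun.scaleR_right G_eq)
        ultimately show ?thesis using err[of y] by (simp add: algebra_simps)
      qed
      show "isCont ?g z"
        using V1_pos[OF z] by (intro continuous_intros err_cont V1c DV_isCont[OF z]
            bounded_linear.isCont[OF bounded_linear_jordan]) auto
    qed (auto simp: open_nz z null_discontinuities)
    then have 3: "DV z (jordan z) + G z * ?w \<le> - c * V1 z powr \<alpha>" by simp
    from 1 2 3 show "snd v = - kI * G z \<and> G z * ?w \<le> 0 \<and> DV z (jordan z) + G z * ?w \<le> - c * V1 z powr \<alpha>"
      by blast
  qed
qed

text \<open>
  At a time with \<open>z = 0\<close> and \<open>\<xi> \<noteq> 0\<close> the feedback \<open>u0\<close> is small nearby, so \<open>z\<^sub>r\<close> moves with velocity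
  close to \<open>\<xi>\<close> and does not return to \<open>0\<close> at once.
\<close>

lemma crossing_isolated:
  assumes x: "trajectory F x" and t: "t \<ge> 0" and zt: "fst (x t) = 0" and \<xi>t: "snd (x t) \<noteq> 0"
  shows "\<exists>\<eta>>0. \<forall>s\<ge>0. s \<noteq> t \<and> \<bar>s - t\<bar> < \<eta> \<longrightarrow> fst (x s) \<noteq> 0"
proof -
  obtain C where C: "C \<ge> 0" "\<And>z. \<bar>u0 z\<bar> \<le> C * sqrt (V1 z)" using u0_bound by blast
  define \<xi> where "\<xi> = snd (x t)"
  \<comment> \<open>The sign for which \<open>\<sigma> z\<^sub>r\<close> increases near the time \<open>t\<close>.\<close>
  define \<sigma> where "\<sigma> = sgn \<xi>"
  have \<xi>: "\<bar>\<xi>\<bar> > 0" "\<sigma> * \<xi> = \<bar>\<xi>\<bar>" "\<bar>\<sigma>\<bar> = 1"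
    using \<xi>t by (auto simp: \<xi>_def \<sigma>_def sgn_real_def)
  define U where "U = {w :: (real^'n::{finite,linorder}) \<times> real. kP * (C * sqrt (V1 (fst w))) - \<sigma> * snd w < - (\<bar>\<xi>\<bar> / 2)}"
  have "open U"
    unfolding U_def by (intro open_Collect_less continuous_intros continuous_on_compose2[OF V1_cont]) auto
  moreover have "x t \<in> U"
    using \<xi> zt V1_zero by (simp add: U_def flip: \<xi>_def)
  ultimately obtain \<eta> where \<eta>: "\<eta> > 0" "\<And>s. s \<ge> 0 \<Longrightarrow> \<bar>s - t\<bar> < \<eta> \<Longrightarrow> x s \<in> U"
    using trajectory_near[OF x t, of U] by metis
  let ?f = "\<lambda>w :: (real^'n::{finite,linorder}) \<times> real. - \<sigma> * (fst w $ last_index)"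
  have lin: "bounded_linear ?f"
    by (intro bounded_linear_const_mult bounded_linear_compose[OF bounded_linear_vec_nth bounded_linear_fst])
  obtain L where L: "L-lipschitz_on UNIV ?f"
    using bounded_linear.lipschitz_boundE[OF lin] by blast
  have inc: "?f (x b) - ?f (x a) \<le> - (\<bar>\<xi>\<bar> / 2) * (b - a)"
    if ab: "0 \<le> a" "a \<le> b" "t - \<eta> < a" "b < t + \<eta>" for a b
  proof (rule trajectory_increment_le[OF x ab(1,2) lipschitz_on_subset[OF L]])
    fix s v assume s: "a < s" "s < b" and v: "v \<in> filippov F (x s)"
    have xU: "x s \<in> U" using s ab by (intro \<eta>(2)) auto
    have v': "v \<in> filippov F (fst (x s), snd (x s))" using v by simp
    obtain w where w: "fst v = jordan (fst (x s)) + (kP * w + snd (x s)) *\<^sub>R e_last" "\<bar>w\<bar> \<le> C * sqrt (V1 (fst (x s)))"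
      by (rule filippov_velocity[OF C v'])
    have "fst v $ last_index = kP * w + snd (x s)"
      by (simp add: w(1) jordan_def e_last_component)
    then have "?f v = - (\<sigma> * (kP * w)) - \<sigma> * snd (x s)"
      by (simp add: algebra_simps)
    also have "\<dots> \<le> kP * \<bar>w\<bar> - \<sigma> * snd (x s)"
      using abs_ge_minus_self[of "\<sigma> * (kP * w)"] \<xi>(3) kP by (simp add: abs_mult)
    also have "\<dots> \<le> kP * (C * sqrt (V1 (fst (x s)))) - \<sigma> * snd (x s)"
      using w(2) kP by (intro diff_right_mono mult_left_mono) auto
    also have "\<dots> \<le> - (\<bar>\<xi>\<bar> / 2)" using xU by (simp add: U_def)
    finally show "\<exists>f'. (?f has_derivative f') (at (x s)) \<and> f' v \<le> - (\<bar>\<xi>\<bar> / 2)"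
      using bounded_linear_imp_has_derivative[OF lin] by blast
  qed auto
  have "fst (x s) \<noteq> 0" if s: "s \<ge> 0" "s \<noteq> t" "\<bar>s - t\<bar> < \<eta>" for s
  proof
    assume zs: "fst (x s) = 0"
    have "0 \<le> - (\<bar>\<xi>\<bar> / 2) * \<bar>s - t\<bar>"
      using inc[of s t] inc[of t s] s t zt zs by (cases "s \<le> t") auto
    then show False using \<xi>(1) s(2) by (simp add: mult_le_0_iff)
  qed
  with \<eta>(1) show ?thesis by blast
qed

end

section \<open>The Lyapunov function of the super-twisting loop\<close>

context super_twisting
begin

text \<open>
  The energy: its derivative along the inclusion contains no \<open>\<xi>\<close>.
\<close>

definition E :: "(real^'n::{finite,linorder}) \<times> real \<Rightarrow> real" where
  "E w = V1 (fst w) + (snd w)\<^sup>2 / (2 * kI)"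

lemma st_lyapunov_eq: "st_lyapunov V1 kI \<alpha> A w = A * E w powr (2 - \<alpha>) - fst w $ last_index * snd w"
  by (cases w) (simp add: st_lyapunov_def E_def)

lemma E_nonneg: "E w \<ge> 0" and E_pos: "w \<noteq> 0 \<Longrightarrow> E w > 0" and E_zero: "E 0 = 0"
  and V1_le_E: "V1 (fst w) \<le> E w"
proof -
  show "E w \<ge> 0" "V1 (fst w) \<le> E w" "E 0 = 0"
    using V1_nonneg[of "fst w"] kI by (auto simp: E_def V1_zero)
  assume w: "w \<noteq> 0"
  show "E w > 0"
  proof (cases "fst w = 0")
    case True
    then have "snd w \<noteq> 0" using w by (simp add: prod_eq_iff)
    then show ?thesis using True kI V1_nonneg[of "fst w"] by (simp add: E_def V1_zero)
  next
    case False
    then show ?thesis using V1_pos[OF False] kI by (simp add: E_def add_pos_nonneg)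
  qed
qed

lemma E_continuous: "continuous_on UNIV E"
  unfolding E_def[abs_def] using kI
  by (intro continuous_intros continuous_on_compose2[OF V1_cont]) auto

text \<open>
  The exponent \<open>2 - \<alpha>\<close> gives \<open>E powr (2 - \<alpha>)\<close> the degree of the cross term \<open>z\<^sub>r \<xi>\<close>.
\<close>

lemma exponent_eq: "2 - \<alpha> = pr / (2 * q) + 1 / 2" "2 * q * (2 - \<alpha>) = pr + q"
proof -
  show "2 * q * (2 - \<alpha>) = pr + q"
    using \<alpha>_eq pr_eq by (simp add: algebra_simps)
  then show "2 - \<alpha> = pr / (2 * q) + 1 / 2"
    using q_pos by (simp add: field_simps)
qed

lemma st_lyapunov_continuous: "continuous_on UNIV (st_lyapunov V1 kI \<alpha> A)"
  unfolding st_lyapunov_eq[abs_def] using \<alpha> E_nonneg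
  by (intro continuous_intros continuous_on_powr' E_continuous) auto

lemma st_lyapunov_homogeneous: "homogeneous_on (dil_ext p \<kappa>) UNIV (pr + q) (st_lyapunov V1 kI \<alpha> A)"
  unfolding homogeneous_on_def
proof (intro allI impI ballI)
  fix e :: real and w :: "(real^'n::{finite,linorder}) \<times> real" assume e: "e > 0"
  have fst_w: "fst (dil_ext p \<kappa> e w) = \<delta> e (fst w)" and snd_w: "snd (dil_ext p \<kappa> e w) = e powr q * snd w"
    by (cases w, simp add: dil_ext_def q_def)+
  have "E (dil_ext p \<kappa> e w) = e powr (2 * q) * E w"
  proof -
    have "(e powr q * snd w)\<^sup>2 = e powr (2 * q) * (snd w)\<^sup>2"
      by (simp add: power_mult_distrib power2_eq_square flip: powr_add)
    then show ?thesis by (simp add: E_def fst_w snd_w V1_dil[OF e] distrib_left)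
  qed
  then have "E (dil_ext p \<kappa> e w) powr (2 - \<alpha>) = e powr (pr + q) * E w powr (2 - \<alpha>)"
    using E_nonneg[of w] by (simp add: powr_mult powr_powr exponent_eq(2))
  then show "st_lyapunov V1 kI \<alpha> A (dil_ext p \<kappa> e w) = e powr (pr + q) * st_lyapunov V1 kI \<alpha> A w"
    by (simp add: st_lyapunov_eq fst_w snd_w dil_component \<omega>_last powr_add algebra_simps)
qed

lemma st_lyapunov_C1:
  assumes "C1_on V1 T"
  shows "C1_on (st_lyapunov V1 kI \<alpha> A) {w. fst w \<in> T \<and> w \<noteq> 0}"
proof -
  let ?S = "{w :: (real^'n::{finite,linorder}) \<times> real. fst w \<in> T \<and> w \<noteq> 0}"
  have V: "C1_on (\<lambda>w. V1 (fst w)) ?S"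
    by (rule C1_on_subset[OF C1_on_compose_fst[OF assms]]) auto
  have snd: "C1_on snd ?S"
    by (rule C1_on_bounded_linear[OF bounded_linear_snd])
  have last: "C1_on (\<lambda>w. fst w $ last_index) ?S"
    by (rule C1_on_bounded_linear[OF bounded_linear_compose[OF bounded_linear_vec_nth bounded_linear_fst]])
  have E: "C1_on (\<lambda>w. V1 (fst w) + (snd w * snd w) * (1 / (2 * kI))) ?S"
    by (intro C1_on_add C1_on_mult C1_on_const V snd)
  have E_eq: "(\<lambda>w. V1 (fst w) + (snd w * snd w) * (1 / (2 * kI))) = E"
    by (auto simp: E_def power2_eq_square)
  have "C1_on (\<lambda>w. E w powr (2 - \<alpha>)) ?S"
    using E unfolding E_eq by (rule C1_on_powr) (use E_pos in auto)
  then have "C1_on (\<lambda>w. A * E w powr (2 - \<alpha>) + (- 1) * (fst w $ last_index * snd w)) ?S"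
    by (intro C1_on_add C1_on_mult C1_on_const last snd)
  then show ?thesis by (simp add: st_lyapunov_eq[abs_def])
qed

lemma cross_term_bound: "\<exists>C\<ge>0. \<forall>w. \<bar>fst w $ last_index * snd w\<bar> \<le> C * E w powr (2 - \<alpha>)"
proof -
  obtain C where C: "C \<ge> 0" "\<And>z. \<bar>z $ last_index\<bar> \<le> C * V1 z powr (pr / (2 * q))"
    using last_component_bound by blast
  have "\<bar>fst w $ last_index * snd w\<bar> \<le> (C * sqrt (2 * kI)) * E w powr (2 - \<alpha>)" for w
  proof -
    have "\<bar>fst w $ last_index\<bar> \<le> C * E w powr (pr / (2 * q))"
      using C V1_le_E[of w] V1_nonneg[of "fst w"] pr_pos q_pos
      by (intro order_trans[OF C(2)] mult_left_mono powr_mono2) auto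
    moreover have "\<bar>snd w\<bar> \<le> sqrt (2 * kI) * E w powr (1 / 2)"
    proof -
      have "(snd w)\<^sup>2 \<le> 2 * kI * E w"
        using kI V1_nonneg[of "fst w"] by (simp add: E_def field_simps)
      then have "\<bar>snd w\<bar> \<le> sqrt (2 * kI * E w)"
        using real_sqrt_le_mono by fastforce
      then show ?thesis using E_nonneg[of w] by (simp add: powr_half_sqrt real_sqrt_mult)
    qed
    ultimately have "\<bar>fst w $ last_index\<bar> * \<bar>snd w\<bar> \<le> (C * E w powr (pr / (2 * q))) * (sqrt (2 * kI) * E w powr (1 / 2))"
      using C by (intro mult_mono) auto
    also have "\<dots> = (C * sqrt (2 * kI)) * E w powr (2 - \<alpha>)"
      by (simp add: exponent_eq(1) powr_add)
    finally show ?thesis by (simp add: abs_mult)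
  qed
  then show ?thesis using C(1) kI by (intro exI[of _ "C * sqrt (2 * kI)"]) auto
qed

lemma E_has_derivative:
  assumes "fst w \<noteq> 0"
  shows "(E has_derivative (\<lambda>h. DV (fst w) (fst h) + snd w * snd h / kI)) (at w)"
proof -
  have "((\<lambda>w. V1 (fst w)) has_derivative (\<lambda>h. DV (fst w) (fst h))) (at w)"
    using diff_chain_at[OF has_derivative_fst[OF has_derivative_ident] DV_deriv[OF assms]] by (simp add: o_def)
  moreover have "((\<lambda>w. (snd w)\<^sup>2 / (2 * kI)) has_derivative (\<lambda>h. snd w * snd h / kI)) (at w)"
    using kI by (auto intro!: derivative_eq_intros simp: field_simps)
  ultimately show ?thesis
    unfolding E_def[abs_def] by (rule has_derivative_add)
qed

lemma st_lyapunov_has_derivative: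
  assumes w: "fst w \<noteq> 0"
  shows "(st_lyapunov V1 kI \<alpha> A has_derivative
      (\<lambda>h. A * ((2 - \<alpha>) * E w powr (1 - \<alpha>) * (DV (fst w) (fst h) + snd w * snd h / kI))
         - (fst h $ last_index * snd w + fst w $ last_index * snd h))) (at w)"
proof -
  have "w \<noteq> 0" using w by auto
  then have "((\<lambda>s. s powr (2 - \<alpha>)) has_real_derivative (2 - \<alpha>) * E w powr ((2 - \<alpha>) - 1)) (at (E w))"
    by (intro has_real_derivative_powr E_pos)
  from DERIV_compose_FDERIV[OF this E_has_derivative[OF w]]
  have 1: "((\<lambda>w. E w powr (2 - \<alpha>)) has_derivative
      (\<lambda>h. (DV (fst w) (fst h) + snd w * snd h / kI) * ((2 - \<alpha>) * E w powr ((2 - \<alpha>) - 1)))) (at w)" .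
  have "((\<lambda>w. fst w $ last_index) has_derivative (\<lambda>h. fst h $ last_index)) (at w)"
    by (intro bounded_linear_imp_has_derivative bounded_linear_compose[OF bounded_linear_vec_nth bounded_linear_fst])
  then have 2: "((\<lambda>w. fst w $ last_index * snd w) has_derivative
      (\<lambda>h. fst w $ last_index * snd h + fst h $ last_index * snd w)) (at w)"
    by (rule has_derivative_mult[OF _ has_derivative_snd[OF has_derivative_ident]])
  show ?thesis
    unfolding st_lyapunov_eq[abs_def]
    by (rule has_derivative_eq_rhs[OF has_derivative_diff[OF has_derivative_mult_right[OF 1] 2]])
       (auto simp: algebra_simps)
qed

text \<open>
  In the derivative of the energy \<open>E\<close> the terms \<open>\<xi> \<partial>\<^sub>r V1\<close> cancel, and what remains is at most
  \<open>- c V1 powr \<alpha>\<close>. The cross term contributes \<open>- \<xi>\<^sup>2\<close>. The other two terms, \<open>kP w \<xi>\<close> and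
  \<open>kI z\<^sub>r \<partial>\<^sub>r V1\<close>, are bounded by \<open>\<xi>\<^sup>2 / 2\<close> and a multiple of \<open>V1\<close>, which a large \<open>A\<close> absorbs.
\<close>

lemma st_lyapunov_derivative_le:
  assumes Cu: "Cu \<ge> 0" "\<And>z. \<bar>u0 z\<bar> \<le> Cu * sqrt (V1 z)"
    and Cd: "\<And>z. z \<noteq> 0 \<Longrightarrow> \<bar>z $ last_index * G z\<bar> \<le> Cd * V1 z"
    and A: "A \<ge> 0" "A * (2 - \<alpha>) * c \<ge> kP\<^sup>2 * Cu\<^sup>2 / 2 + kI * Cd + 1"
    and z: "z \<noteq> 0" and v: "v \<in> filippov F (z, \<xi>)"
    and W': "(st_lyapunov V1 kI \<alpha> A has_derivative W') (at (z, \<xi>))"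
  shows "W' v \<le> - min 1 kI * E (z, \<xi>)"
proof -
  obtain w where w: "fst v = jordan z + (kP * w + \<xi>) *\<^sub>R e_last" "\<bar>w\<bar> \<le> Cu * sqrt (V1 z)"
    and "z \<noteq> 0 \<longrightarrow> snd v = - kI * G z \<and> G z * w \<le> 0 \<and> DV z (jordan z) + G z * w \<le> - c * V1 z powr \<alpha>"
    by (rule filippov_velocity[OF Cu v])
  with z have w': "snd v = - kI * G z" "G z * w \<le> 0" "DV z (jordan z) + G z * w \<le> - c * V1 z powr \<alpha>"
    by auto
  let ?E = "E (z, \<xi>)"
  have Vz: "V1 z > 0" using z by (rule V1_pos)
  have V_E: "V1 z \<le> ?E" using V1_le_E[of "(z, \<xi>)"] by simp
  define D where "D = DV z (fst v) + \<xi> * snd v / kI"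
  have "D = (DV z (jordan z) + G z * w) + (kP - 1) * (G z * w)"
    using kI z w'(1) by (simp add: D_def w(1) blinfun.add_right blinfun.scaleR_right G_eq algebra_simps)
  moreover have "(kP - 1) * (G z * w) \<le> 0"
    by (rule mult_nonneg_nonpos) (use kP w'(2) in auto)
  ultimately have D: "D \<le> - c * V1 z powr \<alpha>" using w'(3) by linarith
  have energy: "A * ((2 - \<alpha>) * ?E powr (1 - \<alpha>) * D) \<le> - (A * (2 - \<alpha>) * c) * V1 z"
  proof -
    have "V1 z = V1 z powr (1 - \<alpha>) * V1 z powr \<alpha>"
      using Vz by (simp flip: powr_add)
    also have "\<dots> \<le> ?E powr (1 - \<alpha>) * V1 z powr \<alpha>"
      using V_E Vz \<alpha> by (intro mult_right_mono powr_mono2) auto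
    finally have "V1 z \<le> ?E powr (1 - \<alpha>) * V1 z powr \<alpha>" .
    then have "(A * (2 - \<alpha>) * c) * V1 z \<le> (A * (2 - \<alpha>) * c) * (?E powr (1 - \<alpha>) * V1 z powr \<alpha>)"
      using A \<alpha> c by (intro mult_left_mono) auto
    moreover have "A * ((2 - \<alpha>) * ?E powr (1 - \<alpha>) * D) \<le> A * ((2 - \<alpha>) * ?E powr (1 - \<alpha>) * (- c * V1 z powr \<alpha>))"
      using A \<alpha> D by (intro mult_left_mono mult_nonneg_nonneg) auto
    ultimately show ?thesis by (simp add: algebra_simps)
  qed
  have last: "fst v $ last_index = kP * w + \<xi>"
    by (simp add: w(1) jordan_def e_last_component)
  have "w\<^sup>2 \<le> Cu\<^sup>2 * V1 z"
  proof -
    have "\<bar>w\<bar>\<^sup>2 \<le> (Cu * sqrt (V1 z))\<^sup>2" using w(2) by (intro power_mono) auto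
    then show ?thesis using Vz by (simp add: power_mult_distrib)
  qed
  then have "kP\<^sup>2 * w\<^sup>2 \<le> kP\<^sup>2 * (Cu\<^sup>2 * V1 z)" by (intro mult_left_mono) auto
  moreover have "- (kP * w * \<xi>) \<le> (kP\<^sup>2 * w\<^sup>2) / 2 + \<xi>\<^sup>2 / 2"
    using zero_le_power2[of "kP * w + \<xi>"] by (simp add: power2_sum power_mult_distrib algebra_simps)
  moreover have "- (z $ last_index * snd v) \<le> kI * (Cd * V1 z)"
  proof -
    have "z $ last_index * G z \<le> Cd * V1 z" using Cd[OF z] by linarith
    then have "kI * (z $ last_index * G z) \<le> kI * (Cd * V1 z)" using kI by (intro mult_left_mono) auto
    then show ?thesis using w'(1) by (simp add: mult_ac)
  qed
  moreover have "- (fst v $ last_index * \<xi>) = - (kP * w * \<xi>) - \<xi>\<^sup>2"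
    by (simp add: last power2_eq_square algebra_simps)
  ultimately have cross: "- (fst v $ last_index * \<xi> + z $ last_index * snd v)
      \<le> (kP\<^sup>2 * Cu\<^sup>2 / 2 + kI * Cd) * V1 z - \<xi>\<^sup>2 / 2"
    by (simp add: algebra_simps)
  have "W' v = A * ((2 - \<alpha>) * ?E powr (1 - \<alpha>) * D) - (fst v $ last_index * \<xi> + z $ last_index * snd v)"
    using has_derivative_unique[OF W' st_lyapunov_has_derivative[of "(z, \<xi>)"]] z
    by (simp add: D_def)
  also have "\<dots> \<le> - (A * (2 - \<alpha>) * c) * V1 z + ((kP\<^sup>2 * Cu\<^sup>2 / 2 + kI * Cd) * V1 z - \<xi>\<^sup>2 / 2)"
    using energy cross by linarith
  also have "\<dots> \<le> - V1 z - \<xi>\<^sup>2 / 2"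
    using mult_right_mono[OF A(2), of "V1 z"] Vz by (simp add: algebra_simps)
  also have "\<dots> \<le> - min 1 kI * ?E"
  proof -
    have "min 1 kI * V1 z \<le> 1 * V1 z" using Vz by (intro mult_right_mono) auto
    moreover have "min 1 kI * (\<xi>\<^sup>2 / (2 * kI)) \<le> kI * (\<xi>\<^sup>2 / (2 * kI))"
      using kI by (intro mult_right_mono) auto
    ultimately show ?thesis using kI by (simp add: E_def distrib_left)
  qed
  finally show ?thesis .
qed

text \<open>
  The constant \<open>A\<close> exceeds the constant of the cross term, which gives positive definiteness, and
  the constant that the derivative estimate needs. The decay rate follows from
  \<open>W \<le> (A + C) E powr (2 - \<alpha>)\<close>.
\<close>

lemma super_twisting_lyapunov:
  "\<exists>A>0. positive_definite (st_lyapunov V1 kI \<alpha> A) \<and>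
     (\<exists>d>0. strict_lyapunov F (st_lyapunov V1 kI \<alpha> A) {(z, \<xi>). z \<noteq> 0} d (1 / (2 - \<alpha>)))"
proof -
  obtain Cu where Cu: "Cu \<ge> 0" "\<And>z. \<bar>u0 z\<bar> \<le> Cu * sqrt (V1 z)"
    using u0_bound by blast
  obtain Cd where Cd: "Cd \<ge> 0" "\<And>z. z \<noteq> 0 \<Longrightarrow> \<bar>z $ last_index * G z\<bar> \<le> Cd * V1 z"
    using gradient_bound by blast
  obtain C where C: "C \<ge> 0" "\<And>w. \<bar>fst w $ last_index * snd w\<bar> \<le> C * E w powr (2 - \<alpha>)"
    using cross_term_bound by blast
  \<comment> \<open>The first summand of \<open>A\<close> dominates the cross term, the last one makes \<open>A (2 - \<alpha>) c\<close> at least \<open>K\<close>.\<close>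
  define K where "K = kP\<^sup>2 * Cu\<^sup>2 / 2 + kI * Cd + 1"
  define A where "A = C + 1 + K / ((2 - \<alpha>) * c)"
  have K: "K > 0" using Cd kI by (simp add: K_def add_nonneg_pos)
  have \<alpha>c: "(2 - \<alpha>) * c > 0" using \<alpha> c by simp
  have A: "A > C" "A > 0" using K \<alpha>c C by (auto simp: A_def add_pos_pos add_nonneg_pos)
  have "K = (K / ((2 - \<alpha>) * c)) * ((2 - \<alpha>) * c)" using \<alpha> c by simp
  also have "\<dots> \<le> A * ((2 - \<alpha>) * c)"
    using \<alpha>c C by (intro mult_right_mono) (auto simp: A_def)
  finally have AK: "A * (2 - \<alpha>) * c \<ge> kP\<^sup>2 * Cu\<^sup>2 / 2 + kI * Cd + 1"
    by (simp add: K_def mult_ac)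
  let ?W = "st_lyapunov V1 kI \<alpha> A"
  define \<beta> where "\<beta> = 1 / (2 - \<alpha>)"
  have \<beta>: "0 < \<beta>" "\<beta> < 1" using \<alpha> by (auto simp: \<beta>_def)
  have pd: "positive_definite ?W"
    unfolding positive_definite_def
  proof (intro conjI allI impI)
    show "?W 0 = 0" by (simp add: st_lyapunov_eq E_zero)
    fix w :: "(real^'n::{finite,linorder}) \<times> real" assume "w \<noteq> 0"
    then have "(A - C) * E w powr (2 - \<alpha>) > 0" using A E_pos[of w] by simp
    then show "?W w > 0" using C(2)[of w] by (simp add: st_lyapunov_eq algebra_simps abs_le_iff)
  qed
  have W_nonneg: "?W w \<ge> 0" for w
    using pd unfolding positive_definite_def by (metis less_eq_real_def)
  have E_ge: "(A + C) powr (- \<beta>) * ?W w powr \<beta> \<le> E w" for w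
  proof -
    have "?W w \<le> (A + C) * E w powr (2 - \<alpha>)"
      using C(2)[of w] by (simp add: st_lyapunov_eq algebra_simps abs_le_iff)
    then have "?W w powr \<beta> \<le> ((A + C) * E w powr (2 - \<alpha>)) powr \<beta>"
      using W_nonneg \<beta> by (intro powr_mono2) auto
    also have "\<dots> = (A + C) powr \<beta> * E w"
      using A C \<alpha> E_nonneg[of w] by (simp add: powr_mult powr_powr \<beta>_def)
    finally have "(A + C) powr (- \<beta>) * ?W w powr \<beta> \<le> (A + C) powr (- \<beta>) * ((A + C) powr \<beta> * E w)"
      by (intro mult_left_mono) auto
    also have "\<dots> = E w" using A C by (simp add: powr_minus)
    finally show ?thesis .
  qed
  define d where "d = min 1 kI * (A + C) powr (- \<beta>)"
  have "strict_lyapunov F ?W {(z, \<xi>). z \<noteq> 0} d \<beta>"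
  proof
    show "d > 0" using kI A C by (simp add: d_def)
    show "0 < \<beta>" "\<beta> < 1" by (fact \<beta>)+
    show "continuous_on UNIV ?W" by (rule st_lyapunov_continuous)
    show "positive_definite ?W" by (fact pd)
    have S_eq: "{(z, \<xi>). z \<noteq> 0} = (- {0 :: real^'n::{finite,linorder}}) \<times> (UNIV :: real set)" by auto
    show "open {(z :: real^'n::{finite,linorder}, \<xi> :: real). z \<noteq> 0}"
      unfolding S_eq by (intro open_Times) (auto simp: open_Compl)
    show "0 \<notin> {(z :: real^'n::{finite,linorder}, \<xi> :: real). z \<noteq> 0}" by (simp add: zero_prod_def)
    show "C1_on ?W {(z, \<xi>). z \<noteq> 0}"
      by (rule C1_on_subset[OF st_lyapunov_C1[OF V1_C1]]) (auto simp: zero_prod_def)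
  next
    fix w v W' assume w: "w \<in> {(z :: real^'n::{finite,linorder}, \<xi> :: real). z \<noteq> 0}" and v: "v \<in> filippov F w"
      and W': "(?W has_derivative W') (at w)"
    obtain z \<xi> where w_eq: "w = (z, \<xi>)" "z \<noteq> 0" using w by auto
    have "W' v \<le> - min 1 kI * E w"
      using v W' A unfolding w_eq(1) by (intro st_lyapunov_derivative_le[OF Cu Cd(2) _ AK w_eq(2)]) auto
    also have "\<dots> \<le> - min 1 kI * ((A + C) powr (- \<beta>) * ?W w powr \<beta>)"
      using E_ge[of w] kI by (intro mult_left_mono_neg) auto
    finally show "W' v \<le> - d * ?W w powr \<beta>" by (simp add: d_def)
  next
    fix x t assume x: "trajectory F x" and t: "t \<ge> (0::real)" and nz: "x t \<noteq> 0"
      and "x t \<notin> {(z :: real^'n::{finite,linorder}, \<xi> :: real). z \<noteq> 0}"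
    then have "fst (x t) = 0" by (auto simp: case_prod_unfold)
    moreover have "snd (x t) \<noteq> 0" using nz \<open>fst (x t) = 0\<close> by (simp add: prod_eq_iff)
    ultimately show "\<exists>\<eta>>0. \<forall>s\<ge>0. s \<noteq> t \<and> \<bar>s - t\<bar> < \<eta> \<longrightarrow> x s \<in> {(z, \<xi>). z \<noteq> 0}"
      using crossing_isolated[OF x t] by (auto simp: case_prod_unfold)
  qed
  moreover have "d > 0" using kI A C by (simp add: d_def)
  ultimately show ?thesis using A(2) pd unfolding \<beta>_def by blast
qed

lemma st_controlled_finite_time_stable:
  assumes "finite_time_stable (trajectory F)"
  shows "finite_time_stable (st_controlled u0 V1 kP kI)"
  unfolding finite_time_stable_def lyapunov_stable_def
proof (intro conjI allI impI)
  fix e :: real assume "e > 0"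
  then obtain d where d: "d > 0" "\<And>x. trajectory F x \<Longrightarrow> norm (x 0) < d \<Longrightarrow> (\<forall>t\<ge>0. norm (x t) < e)"
    using assms unfolding finite_time_stable_def lyapunov_stable_def by blast
  show "\<exists>d>0. \<forall>z. st_controlled u0 V1 kP kI z \<and> norm (z 0) < d \<longrightarrow> (\<forall>t\<ge>0. norm (z t) < e)"
  proof (intro exI[of _ d] conjI allI impI d(1))
    fix z :: "real \<Rightarrow> real^'n::{finite,linorder}" and t :: real
    assume z: "st_controlled u0 V1 kP kI z \<and> norm (z 0) < d" and t: "0 \<le> t"
    then obtain \<xi> where \<xi>: "trajectory F (\<lambda>t. (z t, \<xi> t))" "\<xi> 0 = 0"
      unfolding st_controlled_def by blast
    have "norm (z t, \<xi> t) < e"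
      using d(2)[OF \<xi>(1)] z t \<xi>(2) by (simp add: norm_Pair)
    then show "norm (z t) < e"
      using norm_fst_le[of "z t" "\<xi> t"] by simp
  qed
next
  fix z assume "st_controlled u0 V1 kP kI z"
  then obtain \<xi> where "trajectory F (\<lambda>t. (z t, \<xi> t))"
    unfolding st_controlled_def by blast
  then show "\<exists>T\<ge>0. \<forall>t\<ge>T. z t = 0"
    using assms unfolding finite_time_stable_def by (fastforce simp: zero_prod_def)
qed

end

theorem theorem1:
  fixes \<kappa> p c \<alpha> :: real
    and u0 V1 :: "real^'n::{finite,linorder} \<Rightarrow> real"
  assumes "\<kappa> < 0" and "p > 0" and "p + (real CARD('n) + 1) * \<kappa> \<ge> 0"
    and "admissible_feedback u0"
    and "homogeneous_on (dil p \<kappa>) UNIV (weight p \<kappa> (CARD('n) + 1)) u0"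
    and "finite_time_stable (trajectory (closed_loop u0))"
    and "homogeneous_field (dil p \<kappa>) \<kappa> (closed_loop u0)"
    and "continuous_on UNIV V1" and "positive_definite V1" and "C1_on V1 (- {0})"
    and "homogeneous_on (dil p \<kappa>) UNIV (2 * weight p \<kappa> (CARD('n) + 1)) V1"
    and "c > 0" and "0 < \<alpha>" and "\<alpha> < 1"
    and "decay_along (closed_loop u0) V1 c \<alpha>"
    and "\<exists>q\<ge>0. homogeneous_on (dil p \<kappa>) (- {0}) q (partial_last V1)"
    and "\<forall>z. partial_last V1 z * u0 z \<le> 0"
  shows "\<forall>kP\<ge>1. \<forall>kI>0.
    finite_time_stable (st_controlled u0 V1 kP kI) \<and>
    (\<exists>A>0. let W = st_lyapunov V1 kI \<alpha> A in
       continuous_on UNIV W \<and> positive_definite W \<and>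
       C1_on W {(z, \<xi>). z \<noteq> 0} \<and> (C1_on V1 UNIV \<longrightarrow> C1_on W (- {0})) \<and>
       (\<exists>q. homogeneous_on (dil_ext p \<kappa>) UNIV q W) \<and>
       (\<exists>d>0. decay_along (st_field u0 V1 kP kI) W d (1 / (2 - \<alpha>)))) \<and>
    finite_time_stable (trajectory (st_field u0 V1 kP kI))"
proof (intro allI impI)
  fix kP kI :: real assume "1 \<le> kP" "0 < kI"
  interpret super_twisting \<kappa> p c \<alpha> "weight p \<kappa> (CARD('n) + 1)" "weight p \<kappa> CARD('n)" u0 V1 kP kI
    by unfold_locales (use assms \<open>1 \<le> kP\<close> \<open>0 < kI\<close> in auto)
  obtain A d where A: "A > 0" "positive_definite (st_lyapunov V1 kI \<alpha> A)" and d: "d > 0"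
    and sl: "strict_lyapunov F (st_lyapunov V1 kI \<alpha> A) {(z, \<xi>). z \<noteq> 0} d (1 / (2 - \<alpha>))"
    using super_twisting_lyapunov by blast
  have fts: "finite_time_stable (trajectory F)"
    by (rule strict_lyapunov.finite_time_stable[OF sl])
  have "C1_on (st_lyapunov V1 kI \<alpha> A) (- {0})" if "C1_on V1 UNIV"
    by (rule C1_on_subset[OF st_lyapunov_C1[OF that]]) auto
  then have "let W = st_lyapunov V1 kI \<alpha> A in
       continuous_on UNIV W \<and> positive_definite W \<and>
       C1_on W {(z, \<xi>). z \<noteq> 0} \<and> (C1_on V1 UNIV \<longrightarrow> C1_on W (- {0})) \<and>
       (\<exists>q. homogeneous_on (dil_ext p \<kappa>) UNIV q W) \<and>
       (\<exists>d>0. decay_along F W d (1 / (2 - \<alpha>)))"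
    unfolding Let_def
    using st_lyapunov_continuous A(2) strict_lyapunov.W_C1[OF sl] st_lyapunov_homogeneous
      strict_lyapunov.decay_along[OF sl] d by blast
  then show "finite_time_stable (st_controlled u0 V1 kP kI) \<and>
    (\<exists>A>0. let W = st_lyapunov V1 kI \<alpha> A in
       continuous_on UNIV W \<and> positive_definite W \<and>
       C1_on W {(z, \<xi>). z \<noteq> 0} \<and> (C1_on V1 UNIV \<longrightarrow> C1_on W (- {0})) \<and>
       (\<exists>q. homogeneous_on (dil_ext p \<kappa>) UNIV q W) \<and>
       (\<exists>d>0. decay_along F W d (1 / (2 - \<alpha>)))) \<and>
    finite_time_stable (trajectory F)"
    using A(1) fts st_controlled_finite_time_stable[OF fts] by blast
qed

end
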